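(* Let $k, \ell$ be positive integers such that $k \geq \ell+2$. Then there exists a constant $c>0$ (depending only on $k$ and $\ell$) such that the following holds. Let $A$ and $B$ be systems of linear equations for which both of their underlying matrices are irredundant and satisfy property $( * )$, and whose cores $C(A)$ and $C(B)$ are both of dimension $\ell \times k$. If $p=p(n)$ satisfies $$p \leq c\,n^{-1/m(A,B)}=c\,n^{-\frac{k-\ell-1}{k-1}},$$ then $$\lim_{n \to \infty} \mathbb{P}\big[\, [n]_p \text{ is } (A,B)\text{-Rado}\,\big]=0.$$
   Context: $\mathbb{N}$ is the set of positive integers and $[n]:=\{1,\dots,n\}$. The random set $[n]_p$ is obtained by including each element of $[n]$ with probability $p$, independently of all other elements. A system of linear equations has the form $Mx=b$ with $M$ an integer matrix, called the underlying matrix of the system, and $b$ an integer vector (possibly zero). For a set $S$ of integers, a $q$-distinct solution in $S$ of a system in $q$ variables is a solution $x=(x_1,\dots,x_q)\in S^q$ with pairwise distinct entries. An integer matrix $M$ with $q$ columns is irredundant if $Mx=0$ has a $q$-distinct solution in $\mathbb{N}$. Property $( * )$ of a matrix: under Gaussian elimination the matrix does not have any row which consists of precisely two non-zero rational entries. If $A$ and $B$ are systems in $k_A$ and $k_B$ variables respectively, a set $S$ of integers is $(A,B)$-Rado if for every colouring of $S$ with colours $1$ and $2$ there is either a $k_A$-distinct solution of $A$ in $S$ all of whose entries have colour $1$, or a $k_B$-distinct solution of $B$ in $S$ all of whose entries have colour $2$. For an integer matrix $M$ with columns indexed by $[q]$ and a partition $[q]=W\,\dot\cup\,\overline{W}$,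 let $M_{\overline{W}}$ be the matrix obtained from $M$ by restricting to the columns indexed by $\overline W$, with $\operatorname{rank}(M_{\overline{W}})=0$ if $\overline W=\emptyset$. Define $$m(M):=\max_{\substack{W \dot{\cup} \overline{W} = [q] \\ |W|\geq 2}} \frac{|W|-1}{|W|-1+\operatorname{rank}(M_{\overline{W}})-\operatorname{rank}(M)},$$ and for integer matrices $M,N$, where $M$ has $q$ columns, $$m(M,N):= \max_{\substack{W \dot\cup \overline{W} = [q]\\ |W| \geq 2}} \frac{|W|}{|W|-1+\operatorname{rank}(M_{\overline{W}})-\operatorname{rank}(M)+1/m(N)}.$$ For irredundant matrices satisfying $( * )$ these are well defined (positive denominators). For systems of linear equations $A$, $B$, the quantities $m(A)$ and $m(A,B)$ are those of the underlying matrices. An $\ell\times k$ matrix $M$ of full rank is strictly balanced if for every $W\subseteq[k]$ with $2\le |W|<k$, $$\frac{|W|-1}{|W|-1+\operatorname{rank}(M_{\overline{W}})-\ell} < \frac{k-1}{k-1-\ell}.$$ Given an irredundant matrix $M$ satisfying $( * )$, a core $C(M)$ is a matrix obtained from $M$ by deleting rows and columns of $M$, such that $m(C(M))=m(M)$, which is irredundant, of full rank and strictly balanced (it is known that $C(M)$ is well defined and itself satisfies $( * )$). For a system of linear equations $A$, $C(A)$ denotes a core of the underlying matrix of $A$. *)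

theory Defs
  imports
    "HOL-Probability.Product_PMF"
    "Jordan_Normal_Form.DL_Rank"
    "Jordan_Normal_Form.DL_Submatrix"
    "Jordan_Normal_Form.Gauss_Jordan_Elimination"
begin

text \<open>
  Matrices and vectors are those of Jordan_Normal_Form, so rows, columns and entries are indexed
  from 0 and the index set of the columns of a matrix with \<open>q\<close> columns is \<open>{..<q}\<close>.
\<close>

subsection \<open>Systems of linear equations and solutions\<close>

text \<open>The pair \<open>(M, b)\<close> stands for the system \<open>M x = b\<close>.\<close>

type_synonym linsys = "int mat \<times> int vec"

definition is_linsys :: "linsys \<Rightarrow> bool" where
  "is_linsys A \<longleftrightarrow> dim_vec (snd A) = dim_row (fst A)"

definition distinct_solution :: "linsys \<Rightarrow> int set \<Rightarrow> int vec \<Rightarrow> bool" where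
  "distinct_solution A S x \<longleftrightarrow>
     dim_vec x = dim_col (fst A) \<and> fst A *\<^sub>v x = snd A \<and>
     set\<^sub>v x \<subseteq> S \<and> distinct (list_of_vec x)"

definition irredundant :: "int mat \<Rightarrow> bool" where
  "irredundant M \<longleftrightarrow> (\<exists>x. distinct_solution (M, 0\<^sub>v (dim_row M)) {0<..} x)"

definition rado :: "linsys \<Rightarrow> linsys \<Rightarrow> int set \<Rightarrow> bool" where
  "rado A B S \<longleftrightarrow>
     (\<forall>f :: int \<Rightarrow> nat. f ` S \<subseteq> {1, 2} \<longrightarrow>
        (\<exists>x. distinct_solution A {s \<in> S. f s = 1} x) \<or>
        (\<exists>x. distinct_solution B {s \<in> S. f s = 2} x))"

subsection \<open>Property \<open>(*)\<close>\<close>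

inductive row_operation :: "rat mat \<Rightarrow> rat mat \<Rightarrow> bool" where
  swap: "i < dim_row M \<Longrightarrow> j < dim_row M \<Longrightarrow> row_operation M (swaprows i j M)"
| scale: "i < dim_row M \<Longrightarrow> a \<noteq> 0 \<Longrightarrow> row_operation M (multrow i a M)"
| add: "i < dim_row M \<Longrightarrow> j < dim_row M \<Longrightarrow> i \<noteq> j \<Longrightarrow> row_operation M (addrow a i j M)"

text \<open>
  ``Under Gaussian elimination'' has to cover every matrix reachable by row operations. Looking only
  at the reduced row echelon form is not enough: \<open>x0 = 4 x2 + 6 x3\<close>, \<open>x1 = 2 x2 + 3 x3\<close> has a reduced
  form without a two-entry row, but implies \<open>x0 = 2 x1\<close>, and for its matrix the choice \<open>W = {0, 1}\<close>
  in \<open>m_param\<close> below gives the denominator 0.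
\<close>

definition property_star :: "int mat \<Rightarrow> bool" where
  "property_star M \<longleftrightarrow>
     (\<forall>N. row_operation\<^sup>*\<^sup>* (map_mat rat_of_int M) N \<longrightarrow>
        (\<forall>i < dim_row N. card {j. j < dim_col N \<and> N $$ (i, j) \<noteq> 0} \<noteq> 2))"

subsection \<open>The parameters \<open>m(M)\<close> and \<open>m(M, N)\<close>\<close>

definition mrank :: "int mat \<Rightarrow> nat" where
  "mrank M = vec_space.rank (dim_row M) (map_mat rat_of_int M)"

definition restrict_cols :: "int mat \<Rightarrow> nat set \<Rightarrow> int mat" where
  "restrict_cols M J = submatrix M UNIV J"

text \<open>The convention that a matrix without columns has rank 0 holds for the library rank.\<close>

lemma mrank_restrict_cols_empty: "mrank (restrict_cols M {}) = 0"
proof -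
  have "map_mat rat_of_int (submatrix M UNIV {}) \<in> carrier_mat (dim_row M) 0"
    by (rule carrier_matI) (simp_all add: dim_submatrix)
  from vec_space.rank_le_nc[OF this] show ?thesis
    unfolding mrank_def restrict_cols_def by (simp add: dim_submatrix)
qed

definition m_param :: "int mat \<Rightarrow> real" where
  "m_param M = Max {(real (card W) - 1) /
       (real (card W) - 1 + real (mrank (restrict_cols M ({..<dim_col M} - W))) - real (mrank M))
     | W. W \<subseteq> {..<dim_col M} \<and> 2 \<le> card W}"

definition m_param2 :: "int mat \<Rightarrow> int mat \<Rightarrow> real" where
  "m_param2 M N = Max {real (card W) /
       (real (card W) - 1 + real (mrank (restrict_cols M ({..<dim_col M} - W))) - real (mrank M)
          + 1 / m_param N) | W. W \<subseteq> {..<dim_col M} \<and> 2 \<le> card W}"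

subsection \<open>Cores\<close>

definition full_rank :: "int mat \<Rightarrow> bool" where
  "full_rank M \<longleftrightarrow> mrank M = dim_row M"

definition strictly_balanced :: "int mat \<Rightarrow> bool" where
  "strictly_balanced M \<longleftrightarrow>
     (\<forall>W \<subseteq> {..<dim_col M}. 2 \<le> card W \<and> card W < dim_col M \<longrightarrow>
        (real (card W) - 1) /
        (real (card W) - 1 + real (mrank (restrict_cols M ({..<dim_col M} - W)))
           - real (dim_row M))
        < (real (dim_col M) - 1) / (real (dim_col M) - 1 - real (dim_row M)))"

text \<open>
  Every core satisfies \<open>(*)\<close>. The property is listed because \<open>m_param C\<close> and the quotients in
  \<open>strictly_balanced C\<close> only have their intended meaning in its presence: without it a denominator
  could vanish, and division by zero yields 0 here.
\<close>

definition is_core :: "int mat \<Rightarrow> int mat \<Rightarrow> bool" where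
  "is_core M C \<longleftrightarrow>
     (\<exists>I J. I \<subseteq> {..<dim_row M} \<and> J \<subseteq> {..<dim_col M} \<and> C = submatrix M I J) \<and>
     irredundant C \<and> property_star C \<and> m_param C = m_param M \<and> full_rank C \<and> strictly_balanced C"

subsection \<open>The random set \<open>[n]\<^sub>p\<close>\<close>

definition random_subset :: "nat \<Rightarrow> real \<Rightarrow> int set pmf" where
  "random_subset n p =
     map_pmf (\<lambda>f. {i \<in> {1..int n}. f i}) (Pi_pmf {1..int n} False (\<lambda>_. bernoulli_pmf p))"

end

theory Submission
  imports Defs "HOL-Library.Function_Algebras" "HOL-Real_Asymp.Real_Asymp"
begin

text \<open>
  Both systems have the parameter \<open>K / (K - l)\<close> with \<open>K = k - 1\<close>. A minimal set of unknowns of a system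
  that attains this parameter turns solutions into hyperedges, and it suffices to colour the vertices
  of the random set without monochromatic hyperedges. To a set of vertices on which \<open>r\<close>
  independent linear relations hold, assign the potential \<open>l * card - K * r\<close>, which is \<open>l\<close> for an
  edge as well as for a vertex. Attaching an edge at one vertex preserves the potential, while
  attaching it at more vertices, or inside the structure with a new relation, decreases it. Hence a component that is
  explored in breadth-first order either ends with nonnegative potential, or has negative potential, or
  is longer than a logarithm. The last two events have vanishing probability, because at most \<open>l + 1\<close>
  steps decrease the potential and the constant in \<open>p\<close> outweighs the number of choices in the regular ones.
  A component of nonnegative potential can be two-coloured by a matroid partition argument.
\<close>

section \<open>Partition into two sparse sets\<close>

text \<open>The obstacle is that counting overlaps of edges, as for a hypergraph, does not work
  here. A further solution on vertices already found need not lower the expected number of copies,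
  because its relations may follow from those recorded. Such solutions are never recorded, so the
  colouring has to serve all tuples whose relations lie in the span of the recorded ones. This is
  why the deterministic part speaks of a matroid of linear relations, and why the partition has to
  be balanced against its rank and not against a number of edges. The logarithm comes from the
  weights: one regular move halves the total weight of the shapes, while a shape of nonnegative
  potential has fewer than \<open>n\<close> expected copies up to its weight, so about
  \<open>2 * log 2 n\<close> moves are enough. The constant is absolute. A minimal set of unknowns
  attaining the parameter has at least three elements, and this alone makes the choices in regular
  moves summable.\<close>

definition sparse :: "('a set \<Rightarrow> nat) \<Rightarrow> 'a set \<Rightarrow> bool" where
  "sparse g V \<longleftrightarrow> (\<forall>Y\<subseteq>V. Y \<noteq> {} \<longrightarrow> card Y \<le> g Y)"

text \<open>\<open>half\<close> is clearly necessary for a partition into two sparse sets; the point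
  of the locale is that it suffices. Only intersecting sets are compared in
  \<open>submodular\<close>, because the function \<open>b * (rank - 1) + 1\<close> used later would
  need the value \<open>1 - b\<close> at the empty set.\<close>

locale submodular_count =
  fixes g :: "'a set \<Rightarrow> nat" and V :: "'a set"
  assumes finite_V: "finite V"
    and mono: "\<And>Y Z. Y \<noteq> {} \<Longrightarrow> Y \<subseteq> Z \<Longrightarrow> Z \<subseteq> V \<Longrightarrow> g Y \<le> g Z"
    and submodular: "\<And>Y Z. Y \<subseteq> V \<Longrightarrow> Z \<subseteq> V \<Longrightarrow> Y \<inter> Z \<noteq> {} \<Longrightarrow>
      g (Y \<union> Z) + g (Y \<inter> Z) \<le> g Y + g Z"
    and half: "\<And>Y. Y \<subseteq> V \<Longrightarrow> Y \<noteq> {} \<Longrightarrow> card Y \<le> 2 * g Y"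
begin

lemma sparse_inter_le:
  assumes "sparse g P" "Y \<subseteq> V" "Y \<noteq> {}"
  shows "card (Y \<inter> P) \<le> g Y"
proof (cases "Y \<inter> P = {}")
  case False
  then have "card (Y \<inter> P) \<le> g (Y \<inter> P)" using assms(1) unfolding sparse_def by blast
  also have "\<dots> \<le> g Y" using mono[of "Y \<inter> P" Y] False assms by auto
  finally show ?thesis .
qed simp

text \<open>Uncrossing: the size of the trace on \<open>P\<close> is modular, while \<open>g\<close>
  is submodular and bounds the traces on union and intersection, so equality for \<open>Y\<close>
  and \<open>Z\<close> leaves no slack.\<close>

lemma tight_union:
  assumes "sparse g P" "Y \<subseteq> V" "Z \<subseteq> V" "Y \<inter> Z \<noteq> {}"
    and "card (Y \<inter> P) = g Y" "card (Z \<inter> P) = g Z"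
  shows "card ((Y \<union> Z) \<inter> P) = g (Y \<union> Z)"
proof -
  have fin: "finite Y" "finite Z" using assms finite_V finite_subset by auto
  have "card ((Y \<union> Z) \<inter> P) + card ((Y \<inter> Z) \<inter> P) = card (Y \<inter> P) + card (Z \<inter> P)"
  proof -
    have "(Y \<union> Z) \<inter> P = (Y \<inter> P) \<union> (Z \<inter> P)" "(Y \<inter> Z) \<inter> P = (Y \<inter> P) \<inter> (Z \<inter> P)" by auto
    then show ?thesis using card_Un_Int[of "Y \<inter> P" "Z \<inter> P"] fin by simp
  qed
  moreover have "card ((Y \<inter> Z) \<inter> P) \<le> g (Y \<inter> Z)"
    using sparse_inter_le[of P "Y \<inter> Z"] assms by auto
  moreover have "card ((Y \<union> Z) \<inter> P) \<le> g (Y \<union> Z)"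
    using sparse_inter_le[of P "Y \<union> Z"] assms by auto
  moreover have "g (Y \<union> Z) + g (Y \<inter> Z) \<le> g Y + g Z" using submodular assms by auto
  ultimately show ?thesis using assms by linarith
qed

text \<open>\<open>C\<close> is the fundamental circuit of \<open>u\<close>. Every violating set
  contains \<open>u\<close> and exceeds \<open>g\<close> by exactly one, so uncrossing makes the
  violating sets closed under intersection. The smallest one lies in all others, and removing any of
  its elements destroys every violation.\<close>

lemma circuit:
  assumes sp: "sparse g P" and V: "insert u P \<subseteq> V" and u: "u \<notin> P" and ns: "\<not> sparse g (insert u P)"
  obtains C where "C \<subseteq> insert u P" "u \<in> C" "card (C \<inter> P) = g C"
    "\<And>w. w \<in> C \<Longrightarrow> sparse g (insert u P - {w})"
    "\<And>w. w \<notin> C \<Longrightarrow> \<not> sparse g (insert u P - {w})"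
proof -
  define viol where "viol Y \<longleftrightarrow> Y \<subseteq> insert u P \<and> Y \<noteq> {} \<and> g Y < card Y" for Y
  have "\<exists>Y. viol Y" using ns unfolding sparse_def viol_def not_le[symmetric] by blast
  then obtain Y0 where Y0: "viol Y0" ..
  define C where "C = arg_min card viol"
  have C: "viol C" unfolding C_def by (fact arg_min_natI[of viol, OF Y0])
  have min: "card C \<le> card Y" if "viol Y" for Y
    unfolding C_def by (fact arg_min_nat_le[of viol, OF that])
  have finP: "finite (insert u P)" by (rule finite_subset[OF V finite_V])
  have mem: "u \<in> Y" "card (Y \<inter> P) = g Y" "card Y = Suc (g Y)" if "viol Y" for Y
  proof -
    show uY: "u \<in> Y"
    proof (rule ccontr)
      assume "u \<notin> Y"
      then have "Y \<subseteq> P" using that unfolding viol_def by auto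
      then show False using sp that unfolding sparse_def viol_def by (meson leD)
    qed
    have "Y = insert u (Y \<inter> P)" using that uY unfolding viol_def by auto
    moreover have "finite (Y \<inter> P)" using that finP unfolding viol_def by auto
    ultimately have c: "card Y = Suc (card (Y \<inter> P))" using u
      by (metis Int_iff card_insert_disjoint)
    have "card (Y \<inter> P) \<le> g Y" using sparse_inter_le[OF sp, of Y] that V unfolding viol_def by auto
    then show "card (Y \<inter> P) = g Y" "card Y = Suc (g Y)" using c that unfolding viol_def by auto
  qed
  show thesis
  proof
    show "C \<subseteq> insert u P" "u \<in> C" "card (C \<inter> P) = g C" using C mem unfolding viol_def by auto
    show "sparse g (insert u P - {w})" if w: "w \<in> C" for w
    proof (rule ccontr)
      assume "\<not> sparse g (insert u P - {w})"
      then obtain Y where Y: "Y \<subseteq> insert u P - {w}" "Y \<noteq> {}" "g Y < card Y"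
        unfolding sparse_def not_le[symmetric] by blast
      then have vY: "viol Y" unfolding viol_def by auto
      have sub: "Y \<subseteq> V" "C \<subseteq> V" using vY C V unfolding viol_def by auto
      have uYC: "u \<in> Y \<inter> C" using mem vY C by auto
      have fin: "finite Y" "finite C" using sub finite_V finite_subset by auto
      have "card (Y \<union> C) + card (Y \<inter> C) = card Y + card C" using card_Un_Int[OF fin] by simp
      moreover have "g (Y \<union> C) + g (Y \<inter> C) \<le> g Y + g C" using submodular sub uYC by blast
      moreover have "card Y = Suc (g Y)" "card C = Suc (g C)" using mem vY C by auto
      moreover have "card (Y \<union> C) \<le> Suc (g (Y \<union> C))"
      proof (cases "viol (Y \<union> C)")
        case True then show ?thesis using mem by auto
      next
        case False then show ?thesis using vY C unfolding viol_def by auto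
      qed
      ultimately have "g (Y \<inter> C) < card (Y \<inter> C)" by linarith
      then have "viol (Y \<inter> C)" using vY uYC unfolding viol_def by auto
      moreover have "card (Y \<inter> C) < card C" using w Y fin by (intro psubset_card_mono) auto
      ultimately show False using min by (meson leD)
    qed
    show "\<not> sparse g (insert u P - {w})" if w: "w \<notin> C" for w
    proof -
      have "C \<subseteq> insert u P - {w}" "C \<noteq> {}" "\<not> card C \<le> g C" using C w unfolding viol_def by auto
      then show ?thesis unfolding sparse_def by blast
    qed
  qed
qed

text \<open>Maximal tight subsets are disjoint by uncrossing and partition \<open>R\<close>; on each
  of them \<open>half\<close> applies with \<open>g Z\<close> equal to the size of the trace of
  \<open>P\<close>.\<close>

lemma tight_cover_half:
  assumes sp: "sparse g P" and R: "R \<subseteq> V"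
    and cov: "\<And>x. x \<in> R \<Longrightarrow> \<exists>Z\<subseteq>R. x \<in> Z \<and> card (Z \<inter> P) = g Z"
  shows "card R \<le> 2 * card (R \<inter> P)"
proof -
  define tight where "tight Z \<longleftrightarrow> Z \<subseteq> R \<and> Z \<noteq> {} \<and> card (Z \<inter> P) = g Z" for Z
  have finR: "finite R" using R finite_V finite_subset by auto
  have main: "card T \<le> 2 * card (T \<inter> P)"
    if "T \<subseteq> R" "\<And>x. x \<in> T \<Longrightarrow> \<exists>Z. tight Z \<and> x \<in> Z \<and> Z \<subseteq> T" for T
    using that
  proof (induction "card T" arbitrary: T rule: less_induct)
    case less
    show ?case
    proof (cases "T = {}")
      case False
      then obtain x where x: "x \<in> T" by auto
      have finT: "finite T" using finite_subset[OF less.prems(1) finR] .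
      \<comment> \<open>This union is tight, and a tight subset of \<open>T\<close> that meets it is
        contained in it, so the rest \<open>T - Z\<close> is again covered by tight subsets.\<close>
      define Z where "Z = \<Union>{Z. tight Z \<and> x \<in> Z \<and> Z \<subseteq> T}"
      have fam: "finite {Z. tight Z \<and> x \<in> Z \<and> Z \<subseteq> T}"
        by (rule finite_subset[of _ "Pow T"]) (use finT in auto)
      have "\<F> \<noteq> {} \<longrightarrow> tight (\<Union>\<F>)"
        if "finite \<F>" "\<F> \<subseteq> {Z. tight Z \<and> x \<in> Z \<and> Z \<subseteq> T}" for \<F>
        using that
      proof (induction \<F> rule: finite_induct)
        case (insert Y \<F>)
        show ?case
        proof (cases "\<F> = {}")
          case True then show ?thesis using insert by auto
        next
          case False
          then have t: "tight (\<Union>\<F>)" "tight Y" "x \<in> \<Union>\<F>" "x \<in> Y" using insert by auto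
          then have "tight (Y \<union> \<Union>\<F>)"
            using tight_union[OF sp, of Y "\<Union>\<F>"] R unfolding tight_def by auto
          then show ?thesis by simp
        qed
      qed simp
      then have "tight Z" using fam less.prems(2)[OF x] unfolding Z_def by blast
      have xZ: "x \<in> Z" "Z \<subseteq> T" using less.prems(2)[OF x] unfolding Z_def by auto
      have "card (T - Z) < card T" using xZ finT by (intro psubset_card_mono) auto
      moreover have "\<exists>Z'. tight Z' \<and> y \<in> Z' \<and> Z' \<subseteq> T - Z" if y: "y \<in> T - Z" for y
      proof -
        obtain Y where Y: "tight Y" "y \<in> Y" "Y \<subseteq> T" using less.prems(2) y by blast
        have "Y \<inter> Z = {}"
        proof (rule ccontr)
          assume "Y \<inter> Z \<noteq> {}"
          then have "tight (Y \<union> Z)" using tight_union[OF sp, of Y Z] R Y \<open>tight Z\<close>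
            unfolding tight_def by auto
          then have "Y \<union> Z \<subseteq> Z" using xZ Y unfolding Z_def by auto
          then show False using Y y by auto
        qed
        then show ?thesis using Y by blast
      qed
      ultimately have IH: "card (T - Z) \<le> 2 * card ((T - Z) \<inter> P)"
        using less.hyps[of "T - Z"] less.prems(1) by blast
      have "Z \<subseteq> V" using xZ less.prems R by auto
      then have Zc: "card Z \<le> 2 * card (Z \<inter> P)" using half[of Z] \<open>tight Z\<close> unfolding tight_def by auto
      have "card T = card (T - Z) + card Z"
      proof -
        have "finite Z" using xZ finT finite_subset by blast
        then show ?thesis using xZ finT card_Diff_subset[of Z T] card_mono[of T Z] by auto
      qed
      moreover have "card (T \<inter> P) = card ((T - Z) \<inter> P) + card (Z \<inter> P)"
      proof -
        have "T \<inter> P = ((T - Z) \<inter> P) \<union> (Z \<inter> P)" using xZ by auto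
        moreover have "finite (Z \<inter> P)" using xZ finT finite_subset by blast
        ultimately show ?thesis using card_Un_disjoint[of "(T - Z) \<inter> P" "Z \<inter> P"] finT by auto
      qed
      ultimately show ?thesis using IH Zc by linarith
    qed simp
  qed
  have "\<exists>Z. tight Z \<and> x \<in> Z \<and> Z \<subseteq> R" if "x \<in> R" for x
    using cov[OF that] that unfolding tight_def by blast
  then show ?thesis using main[of R] by blast
qed

text \<open>
  Exchange argument for the union of the count matroid with itself. If one element \<open>u\<close> remains
  uncovered, let \<open>R\<close> be the set of all elements that can become the uncovered one by successive
  exchanges. Exchanges are reversible and preserve the property of lying in a tight subset of \<open>R\<close>,
  so each class fills at least half of \<open>R\<close>, although \<open>u\<close> is in neither of them.
\<close>

lemma exists_partition:
  "\<exists>P :: bool \<Rightarrow> 'a set. P True \<union> P False = V \<and> (\<forall>i. sparse g (P i))"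
proof -
  define good where "good W \<longleftrightarrow> (\<exists>P :: bool \<Rightarrow> 'a set. P True \<union> P False = W \<and> P True \<inter> P False = {} \<and>
      (\<forall>i. sparse g (P i)))" for W
  have "good W" if "finite W" "W \<subseteq> V" for W
    using that
  proof (induction W rule: finite_induct)
    case empty
    show ?case unfolding good_def by (rule exI[of _ "\<lambda>_. {}"]) (simp add: sparse_def)
  next
    case (insert v W)
    show ?case
    proof (rule ccontr)
      assume bad: "\<not> good (insert v W)"
      obtain P0 where P0: "P0 True \<union> P0 False = W" "P0 True \<inter> P0 False = {}" "\<forall>i. sparse g (P0 i)"
        using insert unfolding good_def by auto
      define W' where "W' = insert v W"
      define valid :: "(bool \<Rightarrow> 'a set) \<Rightarrow> 'a \<Rightarrow> bool" where
        "valid P u \<longleftrightarrow> insert u (P True \<union> P False) = W' \<and> P True \<inter> P False = {} \<and> (\<forall>i. u \<notin> P i) \<and>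
          (\<forall>i. sparse g (P i))" for P u
      define step where "step c c' \<longleftrightarrow> (case (c, c') of ((P, u), (P', w)) \<Rightarrow>
         valid P u \<and> valid P' w \<and> (\<exists>i. w \<in> P i \<and> P' = P(i := insert u (P i) - {w})))" for c c'
      define R where "R = {u. \<exists>P. step\<^sup>*\<^sup>* (P0, v) (P, u)}"
      define cov where "cov P i x \<longleftrightarrow> (\<exists>Z\<subseteq>R. x \<in> Z \<and> card (Z \<inter> P i) = g Z)"
        for P :: "bool \<Rightarrow> 'a set" and i x
      have W'V: "W' \<subseteq> V" using insert W'_def by auto
      have "v \<notin> P0 i" for i using P0(1) insert.hyps by (cases i) auto
      then have valid0: "valid P0 v" using P0 unfolding valid_def W'_def by auto
      have validI: "valid P u" if "step\<^sup>*\<^sup>* (P0, v) (P, u)" for P u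
        using that by (induction rule: rtranclp_induct2) (auto simp: valid0 step_def)
      have ns: "\<not> sparse g (insert u (P i))" if "valid P u" for P u i
      proof
        assume s: "sparse g (insert u (P i))"
        define P' where "P' = P(i := insert u (P i))"
        have "P' True \<union> P' False = W' \<and> P' True \<inter> P' False = {} \<and> (\<forall>i. sparse g (P' i))"
          using that s unfolding valid_def P'_def by (cases i) auto
        then show False using bad unfolding good_def W'_def by blast
      qed
      have circ: "\<exists>C. C \<subseteq> insert u (P i) \<and> u \<in> C \<and> card (C \<inter> P i) = g C \<and>
          (\<forall>w. w \<notin> C \<longrightarrow> \<not> sparse g (insert u (P i) - {w})) \<and>
          (\<forall>w\<in>C - {u}. step (P, u) (P(i := insert u (P i) - {w}), w))"
        if v: "valid P u" for P u i
      proof -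
        have "insert u (P i) \<subseteq> V" using v W'V unfolding valid_def by (cases i) auto
        moreover have "u \<notin> P i" "sparse g (P i)" using v unfolding valid_def by auto
        ultimately obtain C where C: "C \<subseteq> insert u (P i)" "u \<in> C" "card (C \<inter> P i) = g C"
          "\<And>w. w \<in> C \<Longrightarrow> sparse g (insert u (P i) - {w})"
          "\<And>w. w \<notin> C \<Longrightarrow> \<not> sparse g (insert u (P i) - {w})"
          using circuit[of "P i" u] ns[OF v, of i] by metis
        have "step (P, u) (P(i := insert u (P i) - {w}), w)" if w: "w \<in> C - {u}" for w
        proof -
          have "w \<in> P i" using w C by auto
          moreover have "valid (P(i := insert u (P i) - {w})) w"
            using v w \<open>w \<in> P i\<close> C(4)[of w] unfolding valid_def by (cases i) auto
          ultimately show ?thesis using v unfolding step_def by auto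
        qed
        then show ?thesis using C by blast
      qed
      have step_sym: "step c' c" if "step c c'" for c c'
      proof -
        obtain P u P' w where cc: "c = (P, u)" "c' = (P', w)" by (cases c, cases c')
        then have "\<exists>i. valid P u \<and> valid P' w \<and> w \<in> P i \<and> P' = P(i := insert u (P i) - {w})"
          using that unfolding step_def by simp
        then obtain i where i: "valid P u" "valid P' w" "w \<in> P i" "P' = P(i := insert u (P i) - {w})"
          by blast
        then have "P = P'(i := insert w (P' i) - {u})" "u \<in> P' i"
          unfolding valid_def by (auto simp: fun_eq_iff)
        then show ?thesis using i cc unfolding step_def by blast
      qed
      have sub_R: "C \<subseteq> R" if "step\<^sup>*\<^sup>* (P0, v) (P, u)" "u \<in> C"
        "\<forall>w\<in>C - {u}. step (P, u) (P(i := insert u (P i) - {w}), w)" for P u C and i :: bool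
        using that unfolding R_def by (auto intro: rtranclp.rtrancl_into_rtrancl)
      have R_W': "R \<subseteq> W'" using validI unfolding R_def valid_def by auto
      have cov_step: "cov P' i x" if r: "step\<^sup>*\<^sup>* (P0, v) (P, u)" and st: "step (P, u) (P', w)"
        and c: "cov P i x" for P u P' w i x
      proof -
        obtain j where j: "w \<in> P j" "P' = P(j := insert u (P j) - {w})" and vv: "valid P u" "valid P' w"
          using st unfolding step_def by auto
        obtain Z where Z: "Z \<subseteq> R" "x \<in> Z" "card (Z \<inter> P i) = g Z" using c unfolding cov_def by auto
        show ?thesis
        proof (cases "i = j")
          case False
          then show ?thesis using c j unfolding cov_def by auto
        next
          case True
          have uP: "u \<notin> P i" using vv unfolding valid_def by auto
          have "P i \<subseteq> V" using vv(1) W'V unfolding valid_def by (cases i) auto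
          then have finP: "finite (P i)" using finite_V finite_subset by blast
          have sp: "sparse g (P i)" "sparse g (P' i)" using vv unfolding valid_def by auto
          have ZV: "Z \<subseteq> V" using Z R_W' W'V by auto
          have uw: "u \<noteq> w" using j uP True by auto
          have tightI: "card (Y \<inter> P' i) = g Y" if "u \<in> Y" "w \<in> Y" "card (Y \<inter> P i) = g Y" for Y
          proof -
            have "Y \<inter> P' i = insert u (Y \<inter> P i - {w})" using that j True uw by auto
            moreover have "card (insert u (Y \<inter> P i - {w})) = Suc (card (Y \<inter> P i - {w}))"
              using uP finP by (intro card_insert_disjoint) auto
            moreover have "Suc (card (Y \<inter> P i - {w})) = card (Y \<inter> P i)"
              using that j True finP by (intro card_Suc_Diff1) auto
            ultimately show ?thesis using that by simp
          qed
          consider "u \<in> Z" "w \<in> Z" | "u \<notin> Z" "w \<notin> Z" | "u \<in> Z" "w \<notin> Z" | "u \<notin> Z" "w \<in> Z" by blast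
          then show ?thesis
          proof cases
            case 1
            then show ?thesis using tightI Z unfolding cov_def by blast
          next
            case 2
            then have "Z \<inter> P' i = Z \<inter> P i" using j True by auto
            then have "card (Z \<inter> P' i) = g Z" using Z by simp
            then show ?thesis using Z unfolding cov_def by blast
          next
            case 3
            then have "Z \<inter> P' i = insert u (Z \<inter> P i)" using j True uw by auto
            then have "card (Z \<inter> P' i) = Suc (g Z)" using uP finP Z by simp
            moreover have "card (Z \<inter> P' i) \<le> g Z" using sparse_inter_le[OF sp(2) ZV] Z by auto
            ultimately show ?thesis by simp
          next
            case 4
            \<comment> \<open>The trace on \<open>Z\<close> loses \<open>w\<close> without gaining
              \<open>u\<close>. Adjoining the fundamental circuit of \<open>u\<close> repairs this:
              it contains \<open>w\<close>, since removing \<open>w\<close> from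
              \<open>insert u (P i)\<close> leaves a sparse set, and it lies in \<open>R\<close>,
              since all its elements can be exchanged for \<open>u\<close>.\<close>
            obtain C where C: "C \<subseteq> insert u (P i)" "u \<in> C" "card (C \<inter> P i) = g C"
              "\<forall>w. w \<notin> C \<longrightarrow> \<not> sparse g (insert u (P i) - {w})"
              "\<forall>w\<in>C - {u}. step (P, u) (P(i := insert u (P i) - {w}), w)"
              using circ[OF vv(1), of i] by auto
            have "w \<in> C" using C(4) sp(2) j True by auto
            have CR: "C \<subseteq> R" using sub_R[OF r C(2) C(5)] .
            have "card ((Z \<union> C) \<inter> P i) = g (Z \<union> C)"
              using tight_union[OF sp(1) ZV, of C] CR R_W' W'V Z C \<open>w \<in> C\<close> 4 by auto
            then have "card ((Z \<union> C) \<inter> P' i) = g (Z \<union> C)"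
              by (intro tightI) (use C \<open>w \<in> C\<close> in auto)
            then show ?thesis using CR Z unfolding cov_def by (intro exI[of _ "Z \<union> C"]) auto
          qed
        qed
      qed
      have cov_back: "cov P0 i x" if "step\<^sup>*\<^sup>* (P0, v) (P, u)" "cov P i x" for P u i x
        using that
      proof (induction rule: rtranclp_induct2)
        case (step P u P' w)
        then have "step\<^sup>*\<^sup>* (P0, v) (P', w)" by (auto intro: rtranclp.rtrancl_into_rtrancl)
        then have "cov P i x" using cov_step[of P' w P u] step_sym[OF step(2)] step by auto
        then show ?case using step by auto
      qed
      \<comment> \<open>In a configuration with uncovered element \<open>x\<close>, the fundamental
        circuit of \<open>x\<close> is tight and every other element of it is uncovered after one
        more exchange. Reversed exchanges carry this cover back to \<open>P0\<close>.\<close>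
      have cov0: "cov P0 i x" if x: "x \<in> R" for i x
      proof -
        obtain P where r: "step\<^sup>*\<^sup>* (P0, v) (P, x)" using x unfolding R_def by auto
        obtain C where C: "x \<in> C" "card (C \<inter> P i) = g C"
           "\<forall>w\<in>C - {x}. step (P, x) (P(i := insert x (P i) - {w}), w)"
          using circ[OF validI[OF r], of i] by auto
        have "C \<subseteq> R" using sub_R[OF r C(1) C(3)] .
        then have "cov P i x" using C unfolding cov_def by auto
        then show ?thesis using cov_back r by auto
      qed
      have RV: "R \<subseteq> V" using R_W' W'V by auto
      have h: "card R \<le> 2 * card (R \<inter> P0 i)" for i
        using tight_cover_half[of "P0 i" R] P0(3) RV cov0[of _ i] unfolding cov_def by auto
      have finR: "finite R" using RV finite_V finite_subset by auto
      have "v \<in> R" unfolding R_def by auto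
      then have "R \<inter> P0 True \<union> R \<inter> P0 False \<subset> R" using insert.hyps P0(1) by auto
      then have "card (R \<inter> P0 True \<union> R \<inter> P0 False) < card R" using finR psubset_card_mono by blast
      moreover have "card (R \<inter> P0 True \<union> R \<inter> P0 False) = card (R \<inter> P0 True) + card (R \<inter> P0 False)"
        using finR P0(2) by (intro card_Un_disjoint) auto
      ultimately show False using h[of True] h[of False] by linarith
    qed
  qed
  then have "good V" using finite_V by blast
  then show ?thesis unfolding good_def by blast
qed

end

section \<open>Nullities of spaces of linear relations\<close>

text \<open>Relations are functions on all of \<open>nat\<close>, so that adding or renaming
  unknowns never changes the type. Finiteness enters only through \<open>supported\<close>.\<close>

interpretation fv: vector_space "\<lambda>(c::rat) (f::nat \<Rightarrow> rat) i. c * f i"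
  by unfold_locales (auto simp: fun_eq_iff algebra_simps)

definition supported :: "nat set \<Rightarrow> (nat \<Rightarrow> rat) set" where
  "supported Y = {f. \<forall>i. i \<notin> Y \<longrightarrow> f i = 0}"

text \<open>For relations \<open>L\<close> on finitely many unknowns,
  \<open>card Y - nullity L Y\<close> is the rank of \<open>Y\<close> in the matroid of the
  coordinate functions on the vectors annihilated by \<open>L\<close>: the degrees of freedom that
  \<open>L\<close> leaves to \<open>Y\<close>.\<close>

definition nullity :: "(nat \<Rightarrow> rat) set \<Rightarrow> nat set \<Rightarrow> nat" where
  "nullity L Y = fv.dim (L \<inter> supported Y)"

text \<open>\<open>forced L Y y\<close>: on the vectors annihilated by \<open>L\<close>, the coordinates in \<open>Y\<close> determine the coordinate \<open>y\<close>.\<close>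

definition forced :: "(nat \<Rightarrow> rat) set \<Rightarrow> nat set \<Rightarrow> nat \<Rightarrow> bool" where
  "forced L Y y \<longleftrightarrow> (\<exists>\<rho>\<in>L \<inter> supported (insert y Y). \<rho> y \<noteq> 0)"

lemma supported_mono: "Y \<subseteq> Z \<Longrightarrow> supported Y \<subseteq> supported Z"
  unfolding supported_def by auto

lemma subspace_supported: "fv.subspace (supported Y)"
  unfolding supported_def by (rule fv.subspaceI) auto

lemma forced_mono: "forced L Y y \<Longrightarrow> L \<subseteq> L' \<Longrightarrow> Y \<subseteq> Y' \<Longrightarrow> forced L' Y' y"
  unfolding forced_def using supported_mono[of "insert y Y" "insert y Y'"] by blast

lemma independent_supported:
  assumes "fv.independent B" "B \<subseteq> supported Y" "finite Y"
  shows "finite B" "card B \<le> card Y"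
proof -
  define e :: "nat \<Rightarrow> nat \<Rightarrow> rat" where "e i = (\<lambda>j. if j = i then 1 else 0)" for i
  have "f \<in> fv.span (e ` Y)" if "f \<in> supported Y" for f
  proof -
    have "f = (\<Sum>i\<in>Y. (\<lambda>j. f i * e i j))"
    proof
      fix j
      have "(\<Sum>i\<in>Y. (\<lambda>j. f i * e i j)) j = (\<Sum>i\<in>Y. f i * e i j)"
        by (induction Y rule: infinite_finite_induct) auto
      also have "\<dots> = (\<Sum>i\<in>Y. if i = j then f j else 0)"
        by (rule sum.cong) (auto simp: e_def)
      also have "\<dots> = f j" using that \<open>finite Y\<close> by (auto simp: supported_def)
      finally show "f j = (\<Sum>i\<in>Y. (\<lambda>j. f i * e i j)) j" by simp
    qed
    also have "\<dots> \<in> fv.span (e ` Y)"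
      by (intro fv.span_sum fv.span_scale fv.span_base) auto
    finally show ?thesis .
  qed
  then have "B \<subseteq> fv.span (e ` Y)" using assms by auto
  then have "finite B \<and> card B \<le> card (e ` Y)"
    using fv.independent_span_bound[of "e ` Y" B] assms by auto
  moreover have "card (e ` Y) \<le> card Y" using assms by (intro card_image_le)
  ultimately show "finite B" "card B \<le> card Y" by auto
qed

lemma nullity_basis:
  assumes "finite Y"
  obtains B where "B \<subseteq> L \<inter> supported Y" "fv.independent B" "L \<inter> supported Y \<subseteq> fv.span B"
    "finite B" "card B = nullity L Y"
proof -
  obtain B where B: "B \<subseteq> L \<inter> supported Y" "fv.independent B" "L \<inter> supported Y \<subseteq> fv.span B"
    using fv.maximal_independent_subset[of "L \<inter> supported Y"] by blast
  moreover have "card B = nullity L Y" unfolding nullity_def using fv.basis_card_eq_dim B by blast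
  ultimately show thesis using that independent_supported[of B Y] assms by blast
qed

lemma nullity_le_card:
  assumes "finite Y"
  shows "nullity L Y \<le> card Y"
proof -
  obtain B where "B \<subseteq> L \<inter> supported Y" "fv.independent B" "L \<inter> supported Y \<subseteq> fv.span B"
    "finite B" "card B = nullity L Y" using nullity_basis[OF assms] by blast
  then show ?thesis using independent_supported(2)[of B Y] assms by (metis le_inf_iff)
qed

lemma nullity_empty [simp]: "nullity L {} = 0"
  using nullity_le_card[of "{}" L] by simp

text \<open>One relation \<open>\<rho>\<close> that touches \<open>y\<close> eliminates
  \<open>y\<close> from every other relation, so a new unknown adds at most one dimension. Most
  nullity inequalities below are inductions with this step.\<close>

lemma nullity_insert:
  assumes L: "fv.subspace L" and Y: "finite Y" "y \<notin> Y"
  shows "nullity L (insert y Y) = nullity L Y + (if forced L Y y then 1 else 0)"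
proof (cases "forced L Y y")
  case False
  then have "L \<inter> supported (insert y Y) = L \<inter> supported Y"
    unfolding forced_def supported_def by auto
  then show ?thesis using False unfolding nullity_def by simp
next
  case True
  then obtain \<rho> where \<rho>: "\<rho> \<in> L" "\<rho> \<in> supported (insert y Y)" "\<rho> y \<noteq> 0" unfolding forced_def by auto
  obtain B where B: "B \<subseteq> L \<inter> supported Y" "fv.independent B" "L \<inter> supported Y \<subseteq> fv.span B"
    "finite B" "card B = nullity L Y" using nullity_basis[OF Y(1)] by blast
  have "fv.span B \<subseteq> supported Y" using B(1) subspace_supported by (intro fv.span_minimal) auto
  then have n: "\<rho> \<notin> fv.span B" using \<rho>(3) Y(2) unfolding supported_def by auto
  then have "\<rho> \<notin> B" using fv.span_base by blast
  have "insert \<rho> B \<subseteq> L \<inter> supported (insert y Y)"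
    using B(1) \<rho> supported_mono[of Y "insert y Y"] by auto
  moreover have "fv.independent (insert \<rho> B)" using B(2) n fv.independent_insert by auto
  moreover have "L \<inter> supported (insert y Y) \<subseteq> fv.span (insert \<rho> B)"
  proof
    fix \<sigma> assume \<sigma>: "\<sigma> \<in> L \<inter> supported (insert y Y)"
    define \<tau> where "\<tau> = \<sigma> - (\<lambda>i. (\<sigma> y / \<rho> y) * \<rho> i)"
    have "\<tau> i = 0" if "i \<notin> Y" for i
      using \<sigma> \<rho> that unfolding supported_def \<tau>_def by (cases "i = y") auto
    then have "\<tau> \<in> supported Y" unfolding supported_def by blast
    moreover have "\<tau> \<in> L" unfolding \<tau>_def using \<sigma> \<rho> fv.subspace_diff[OF L] fv.subspace_scale[OF L] by blast
    ultimately have "\<tau> \<in> fv.span B" using B(3) by auto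
    then show "\<sigma> \<in> fv.span (insert \<rho> B)" unfolding \<tau>_def using fv.span_breakdown_eq by blast
  qed
  ultimately have "card (insert \<rho> B) = nullity L (insert y Y)"
    unfolding nullity_def using fv.basis_card_eq_dim by blast
  then show ?thesis using True \<open>\<rho> \<notin> B\<close> B by simp
qed

lemma nullity_less:
  assumes "fv.subspace L" "L \<subset> L'" "L' \<subseteq> supported Y" "finite Y"
  shows "nullity L Y < nullity L' Y"
proof -
  obtain B where B: "B \<subseteq> L \<inter> supported Y" "fv.independent B" "L \<inter> supported Y \<subseteq> fv.span B"
    "finite B" "card B = nullity L Y" using nullity_basis[OF assms(4)] by blast
  obtain B' where B': "B \<subseteq> B'" "B' \<subseteq> L'" "fv.independent B'" "L' \<subseteq> fv.span B'"
    using fv.maximal_independent_subset_extend[of B L'] B assms by blast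
  have "card B' = nullity L' Y" unfolding nullity_def
    using B' assms fv.basis_card_eq_dim[of B' "L' \<inter> supported Y"] by blast
  moreover have "finite B'" using independent_supported[of B' Y] B' assms by auto
  moreover have "B \<noteq> B'"
  proof
    assume "B = B'"
    then have "L' \<subseteq> fv.span B" using B' by auto
    also have "\<dots> \<subseteq> L" using B assms by (intro fv.span_minimal) auto
    finally show False using assms by auto
  qed
  ultimately show ?thesis using B B' psubset_card_mono[of B' B] by auto
qed

text \<open>Nullities grow exactly at forced elements, so it is enough that an element forced in the
  source stays forced in the target. With \<open>h\<close> the identity this yields supermodularity;
  with \<open>h\<close> a tuple it bounds from below the relations that an edge brings.\<close>

lemma nullity_transport:
  assumes L: "fv.subspace L" "fv.subspace L'"
    and fin: "finite X" "finite X'" "finite N"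
    and disj: "X \<inter> N = {}" "h ` N \<inter> X' = {}" and h: "inj_on h (X \<union> N)" "h ` X \<subseteq> X'"
    and tr: "\<And>Y y. Y \<subseteq> X \<union> N \<Longrightarrow> y \<in> N - Y \<Longrightarrow> forced L Y y \<Longrightarrow> forced L' (h ` Y) (h y)"
  shows "nullity L (X \<union> N) + nullity L' X' \<le> nullity L' (X' \<union> h ` N) + nullity L X"
  using fin(3) disj h(1) tr
proof (induction N rule: finite_induct)
  case (insert y N)
  have IH: "nullity L (X \<union> N) + nullity L' X' \<le> nullity L' (X' \<union> h ` N) + nullity L X"
  proof (rule insert.IH)
    show "inj_on h (X \<union> N)" using insert.prems(3) by (rule inj_on_subset) auto
    show "forced L' (h ` Y) (h z)" if "Y \<subseteq> X \<union> N" "z \<in> N - Y" "forced L Y z" for Y z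
      using insert.prems(4)[of Y z] that by auto
  qed (use insert.prems in auto)
  have 1: "nullity L (X \<union> insert y N) = nullity L (X \<union> N) + (if forced L (X \<union> N) y then 1 else 0)"
    using nullity_insert[OF L(1), of "X \<union> N" y] insert fin by auto
  have "h y \<notin> h ` N"
    using insert.prems(3) insert.hyps by (auto simp: inj_on_def)
  then have 2: "nullity L' (X' \<union> h ` insert y N) =
      nullity L' (X' \<union> h ` N) + (if forced L' (X' \<union> h ` N) (h y) then 1 else 0)"
    using nullity_insert[OF L(2), of "X' \<union> h ` N" "h y"] insert fin by auto
  have 3: "forced L' (X' \<union> h ` N) (h y)" if "forced L (X \<union> N) y"
  proof -
    have "forced L' (h ` (X \<union> N)) (h y)"
      using insert.prems(4)[of "X \<union> N" y] that insert.prems(1) insert.hyps by auto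
    then show ?thesis by (rule forced_mono) (use h(2) in auto)
  qed
  show ?case using IH 1 2 3 by (auto split: if_splits)
qed simp

lemma nullity_increment:
  assumes "fv.subspace L" "fv.subspace L'" "L \<subseteq> L'"
    and "finite X" "finite X'" "finite N" "X \<inter> N = {}" "X' \<inter> N = {}" "X \<subseteq> X'"
  shows "nullity L (X \<union> N) + nullity L' X' \<le> nullity L' (X' \<union> N) + nullity L X"
  using nullity_transport[of L L' X X' N id] assms forced_mono[OF _ assms(3)] by (simp add: Int_commute)

lemma nullity_supermodular:
  assumes "fv.subspace L" "finite X" "finite Y"
  shows "nullity L X + nullity L Y \<le> nullity L (X \<union> Y) + nullity L (X \<inter> Y)"
proof -
  have "nullity L (X \<inter> Y \<union> (X - Y)) + nullity L Y \<le> nullity L (Y \<union> (X - Y)) + nullity L (X \<inter> Y)"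
    using assms by (intro nullity_increment) auto
  moreover have "X \<inter> Y \<union> (X - Y) = X" "Y \<union> (X - Y) = X \<union> Y" by auto
  ultimately show ?thesis by simp
qed

lemma nullity_mono:
  assumes "fv.subspace L" "fv.subspace L'" "L \<subseteq> L'" "finite Y" "X \<subseteq> Y"
  shows "nullity L X \<le> nullity L' Y"
proof -
  have "finite X" using assms finite_subset by auto
  then have "nullity L ({} \<union> X) + nullity L' {} \<le> nullity L' ({} \<union> X) + nullity L {}"
    using assms by (intro nullity_increment) auto
  moreover have "nullity L' ({} \<union> (Y - X)) + nullity L' X \<le> nullity L' (X \<union> (Y - X)) + nullity L' {}"
    using assms \<open>finite X\<close> by (intro nullity_increment) auto
  moreover have "X \<union> (Y - X) = Y" using assms by auto
  ultimately show ?thesis by simp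
qed

lemma nullity_diff_le:
  assumes "fv.subspace L" "finite X" "finite N"
  shows "nullity L (X \<union> N) \<le> nullity L X + card N"
  using assms(3)
proof (induction N rule: finite_induct)
  case (insert y N)
  have "nullity L (insert y (X \<union> N)) \<le> Suc (nullity L (X \<union> N))"
  proof (cases "y \<in> X \<union> N")
    case True then show ?thesis by (simp add: insert_absorb)
  next
    case False then show ?thesis using nullity_insert[OF assms(1), of "X \<union> N" y] insert assms by auto
  qed
  then show ?case using insert by simp
qed simp

lemma nullity_forced_union:
  assumes "fv.subspace L" "finite X" "finite N" "X \<inter> N = {}" "\<And>y. y \<in> N \<Longrightarrow> forced L X y"
  shows "nullity L X + card N \<le> nullity L (X \<union> N)"
  using assms(3-5)
proof (induction N rule: finite_induct)
  case (insert y N)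
  have "forced L (X \<union> N) y" by (rule forced_mono[of L X]) (use insert.prems in auto)
  then have "nullity L (insert y (X \<union> N)) = Suc (nullity L (X \<union> N))"
    using nullity_insert[OF assms(1), of "X \<union> N" y] insert assms by auto
  then show ?case using insert by auto
qed simp

section \<open>Relations carried along a tuple of vertices\<close>

definition push :: "nat list \<Rightarrow> (nat \<Rightarrow> rat) \<Rightarrow> nat \<Rightarrow> rat" where
  "push t \<rho> v = (\<Sum>i<length t. if t ! i = v then \<rho> i else 0)"

lemma push_nth: "distinct t \<Longrightarrow> i < length t \<Longrightarrow> push t \<rho> (t ! i) = \<rho> i"
proof -
  assume a: "distinct t" "i < length t"
  have "push t \<rho> (t ! i) = (\<Sum>j<length t. if j = i then \<rho> i else 0)"
    unfolding push_def using a by (intro sum.cong) (auto simp: nth_eq_iff_index_eq)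
  then show ?thesis using a by simp
qed

lemma push_outside: "v \<notin> set t \<Longrightarrow> push t \<rho> v = 0"
  unfolding push_def by (intro sum.neutral) auto

lemma push_supported: "push t \<rho> \<in> supported (set t)"
  unfolding supported_def using push_outside by auto

lemma push_forced:
  assumes t: "distinct t" and sub: "push t ` R \<subseteq> L" and Y: "Y \<subseteq> {..<length t}" "y < length t"
    and f: "forced R Y y"
  shows "forced L ((!) t ` Y) (t ! y)"
proof -
  obtain \<rho> where \<rho>: "\<rho> \<in> R" "\<rho> \<in> supported (insert y Y)" "\<rho> y \<noteq> 0" using f unfolding forced_def by auto
  have "push t \<rho> v = 0" if v: "v \<notin> insert (t ! y) ((!) t ` Y)" for v
  proof (cases "v \<in> set t")
    case True
    then obtain i where "i < length t" "v = t ! i" by (metis in_set_conv_nth)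
    moreover have "i \<notin> insert y Y" using v \<open>v = t ! i\<close> by auto
    ultimately show ?thesis using push_nth[OF t] \<rho>(2) unfolding supported_def by auto
  qed (simp add: push_outside)
  then have "push t \<rho> \<in> supported (insert (t ! y) ((!) t ` Y))" unfolding supported_def by blast
  moreover have "push t \<rho> (t ! y) \<noteq> 0" using \<rho> push_nth[OF t Y(2)] by simp
  ultimately show ?thesis using \<rho> sub unfolding forced_def by blast
qed

text \<open>A template relation that determines one position from others still does so once it is
  written in the vertices of \<open>t\<close>. Other relations in \<open>L\<close> may determine
  further vertices, so only a lower bound results.\<close>

lemma nullity_push:
  assumes "fv.subspace R" "fv.subspace L" and t: "distinct t" and sub: "push t ` R \<subseteq> L"
    and W: "W \<subseteq> {..<length t}" "N \<subseteq> {..<length t}" "W \<inter> N = {}"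
    and X: "finite X" "(!) t ` W \<subseteq> X" "(!) t ` N \<inter> X = {}"
  shows "nullity R (W \<union> N) + nullity L X \<le> nullity L (X \<union> (!) t ` N) + nullity R W"
proof (rule nullity_transport)
  show "inj_on ((!) t) (W \<union> N)" by (rule inj_on_nth[OF t]) (use W in auto)
  show "forced L ((!) t ` Y) (t ! y)" if "Y \<subseteq> W \<union> N" "y \<in> N - Y" "forced R Y y" for Y y
    using push_forced[OF t sub, of Y y] that W by auto
  show "finite W" by (rule finite_subset[OF W(1)]) simp
  show "finite N" by (rule finite_subset[OF W(2)]) simp
qed (use assms in auto)

section \<open>Two-colourings from a potential\<close>

text \<open>
  The two indices \<open>True\<close> and \<open>False\<close> stand for the systems \<open>A\<close> and \<open>B\<close>, and \<open>R a\<close> is the space of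
  the linear relations that hold between the \<open>arity a\<close> selected entries of every solution. The
  quotient \<open>l / K\<close> is common to both systems, whereas the arities may differ.
\<close>

locale templates =
  fixes arity :: "bool \<Rightarrow> nat" and R :: "bool \<Rightarrow> (nat \<Rightarrow> rat) set" and K l :: nat
  assumes l_pos: "0 < l" and l_less: "l < K"
    and R_subspace: "fv.subspace (R a)"
    and R_supported: "R a \<subseteq> supported {..<arity a}"
    and arity_ge2: "2 \<le> arity a"
    and R_full: "nullity (R a) {..<arity a} * K = l * (arity a - 1)"
    and R_proper: "W \<subseteq> {..<arity a} \<Longrightarrow> 2 \<le> card W \<Longrightarrow> card W < arity a \<Longrightarrow>
      nullity (R a) W * K < l * (card W - 1)"
    and R_single: "i < arity a \<Longrightarrow> nullity (R a) {i} = 0"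
begin

text \<open>
  Solutions to the relations \<open>L\<close> on a set \<open>Y\<close> of unknowns appear in the random set about
  \<open>n powr (pot L Y / K)\<close> times, since \<open>p\<close> has order \<open>n powr (- (K - l) / K)\<close>.
\<close>

definition pot :: "(nat \<Rightarrow> rat) set \<Rightarrow> nat set \<Rightarrow> int" where
  "pot L Y = int l * int (card Y) - int K * int (nullity L Y)"

text \<open>With two entries, \<open>R_full\<close> would make \<open>l\<close> a multiple of
  \<open>K\<close>, although \<open>0 < l < K\<close>. The bound makes pairs of positions proper
  subsets and keeps the weights of regular moves summable.\<close>

lemma arity_ge3: "3 \<le> arity a"
proof (rule ccontr)
  assume "\<not> 3 \<le> arity a"
  then have "arity a = 2" using arity_ge2[of a] by simp
  then have e: "nullity (R a) {..<arity a} * K = l" using R_full[of a] by simp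
  then have "nullity (R a) {..<arity a} = 0"
    using l_less by (cases "nullity (R a) {..<arity a}") auto
  then show False using e l_pos by simp
qed

text \<open>
  Nonnegative potentials mean that the matroid with rank \<open>card Y - nullity L Y\<close> has no set of size
  more than \<open>K / (K - l)\<close> times its rank. They also force the relations among the entries of an edge to be
  those of \<open>R a\<close> only, so no edge contains two proportional vertices, and each vertex may be
  replaced by a representative of its proportionality class. With \<open>b\<close> the largest integer below
  \<open>K / (K - l)\<close>, the function \<open>b * (rank - 1) + 1\<close> is at least half of the size of any set of
  representatives, but smaller than the size of any edge.
\<close>

lemma colouring:
  assumes L: "fv.subspace L" and V: "finite V"
    and pot: "\<And>Y. Y \<subseteq> V \<Longrightarrow> 0 \<le> pot L Y"
    and E: "\<And>a t. (a, t) \<in> E \<Longrightarrow>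
      distinct t \<and> length t = arity a \<and> set t \<subseteq> V \<and> push t ` R a \<subseteq> L"
  shows "\<exists>clr :: nat \<Rightarrow> bool. \<forall>(a, t)\<in>E. \<exists>u\<in>set t. \<exists>w\<in>set t. clr u \<noteq> clr w"
proof -
  have pot': "K * nullity L Y \<le> l * card Y" if "Y \<subseteq> V" for Y
    using pot[OF that] unfolding pot_def by (simp flip: of_nat_mult)
  have finV: "finite Y" if "Y \<subseteq> V" for Y using that V finite_subset by blast
  have single: "nullity L {u} = 0" if "u \<in> V" for u
  proof -
    have "K * nullity L {u} \<le> l" using pot'[of "{u}"] that by simp
    then have "K * nullity L {u} < K * 1" using l_less by linarith
    then show ?thesis by simp
  qed
  \<comment> \<open>One more relation would bring the potential of \<open>set t\<close> down to
    \<open>l - K\<close>, which is negative.\<close>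
  have n_edge: "nullity L (set t) = nullity (R a) {..<arity a}" if "(a, t) \<in> E" for a t
  proof -
    note e = E[OF that]
    have "(!) t ` {..<arity a} = set t" using e by (auto simp: set_conv_nth)
    then have 1: "nullity (R a) {..<arity a} \<le> nullity L (set t)"
      using nullity_push[OF R_subspace L, of t a "{}" "{..<arity a}" "{}"] e by auto
    have "card (set t) = arity a" using e distinct_card by fastforce
    then have "K * nullity L (set t) \<le> l * arity a" using pot'[of "set t"] e by simp
    also have "\<dots> = l * (arity a - 1) + l" using arity_ge2[of a] by (cases "arity a") auto
    also have "\<dots> < K * (nullity (R a) {..<arity a} + 1)" using R_full[of a] l_less by (simp add: mult.commute)
    finally have "nullity L (set t) < nullity (R a) {..<arity a} + 1" unfolding mult_less_cancel1 by blast
    then show ?thesis using 1 by simp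
  qed
  \<comment> \<open>The template has no relation on a pair, so a relation between two entries would
    come on top of the template relations and contradict \<open>n_edge\<close>.\<close>
  have n_pair: "nullity L {u, w} = 0" if uw: "(a, t) \<in> E" "u \<in> set t" "w \<in> set t" "u \<noteq> w" for a t u w
  proof -
    note e = E[OF uw(1)]
    obtain i j where ij: "i < arity a" "j < arity a" "u = t ! i" "w = t ! j"
      using uw(2,3) e unfolding in_set_conv_nth by auto
    then have "i \<noteq> j" using uw by auto
    define W where "W = {i, j}"
    have W: "W \<subseteq> {..<arity a}" "card W = 2" using ij \<open>i \<noteq> j\<close> unfolding W_def by auto
    have "nullity (R a) W * K < l * 1" using R_proper[of W a] W arity_ge3[of a] by simp
    then have W0: "nullity (R a) W = 0" using l_less by (cases "nullity (R a) W") auto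
    have un: "W \<union> ({..<arity a} - W) = {..<arity a}" using W by auto
    have img: "(!) t ` W = {u, w}" using ij unfolding W_def by auto
    have inj: "inj_on ((!) t) {..<arity a}" by (rule inj_on_nth) (use e in auto)
    have "(!) t ` ({..<arity a} - W) \<inter> {u, w} = {}"
      unfolding img[symmetric] using inj W by (auto simp: inj_on_def)
    moreover have "{u, w} \<union> (!) t ` ({..<arity a} - W) = set t"
    proof -
      have "(!) t ` W \<union> (!) t ` ({..<arity a} - W) = (!) t ` {..<arity a}" using W by blast
      also have "\<dots> = set t" using e by (auto simp: set_conv_nth)
      finally show ?thesis using img by simp
    qed
    ultimately have "nullity (R a) {..<arity a} + nullity L {u, w} \<le> nullity L (set t) + nullity (R a) W"
      using nullity_push[OF R_subspace L, of t a W "{..<arity a} - W" "{u, w}"] e W un img by auto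
    then show ?thesis using W0 n_edge[OF uw(1)] by simp
  qed
  \<comment> \<open>Parallelism in the matroid. By \<open>single\<close> there are no loops, which
    makes it transitive on distinct elements.\<close>
  define par where "par u w \<longleftrightarrow> u \<noteq> w \<and> nullity L {u, w} \<noteq> 0" for u w
  have par_sym: "par u w \<Longrightarrow> par w u" for u w unfolding par_def by (simp add: insert_commute)
  have par_trans: "par u z" if "par u w" "par w z" "u \<noteq> z" "u \<in> V" "w \<in> V" "z \<in> V" for u w z
  proof -
    have I: "{u, w} \<inter> {w, z} = {w}" using that unfolding par_def by auto
    have "nullity L {u, w} + nullity L {w, z} \<le> nullity L ({u, w} \<union> {w, z}) + nullity L ({u, w} \<inter> {w, z})"
      by (intro nullity_supermodular[OF L]) auto
    then have "nullity L {u, w} + nullity L {w, z} \<le> nullity L ({u, w} \<union> {w, z})"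
      unfolding I single[OF \<open>w \<in> V\<close>] by simp
    moreover have "nullity L ({u, z} \<union> {w}) \<le> nullity L {u, z} + 1"
      using nullity_diff_le[OF L, of "{u, z}" "{w}"] by simp
    moreover have "{u, w} \<union> {w, z} = {u, z} \<union> {w}" by auto
    moreover have "1 \<le> nullity L {u, w}" "1 \<le> nullity L {w, z}" using that unfolding par_def by auto
    ultimately have "1 \<le> nullity L {u, z}" by simp
    then show ?thesis using that unfolding par_def by simp
  qed
  define free where "free U \<longleftrightarrow> U \<subseteq> V \<and> (\<forall>u\<in>U. \<forall>w\<in>U. \<not> par u w)" for U
  have "free {}" unfolding free_def by simp
  moreover have "\<forall>U. free U \<longrightarrow> card U \<le> card V" unfolding free_def using V card_mono by blast
  ultimately obtain V' where V': "free V'" "\<And>U. free U \<Longrightarrow> card U \<le> card V'"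
    using ex_has_greatest_nat[of free "{}" card "Suc (card V)"] by (metis less_Suc_eq_le)
  have V'V: "V' \<subseteq> V" using V' unfolding free_def by auto
  have rep: "\<exists>z\<in>V'. z = u \<or> par u z" if "u \<in> V" for u
  proof (rule ccontr)
    assume n: "\<not> ?thesis"
    have "\<not> par u z" "\<not> par z u" if "z \<in> V'" for z using n that par_sym by blast+
    moreover have "\<not> par u u" unfolding par_def by simp
    ultimately have "free (insert u V')" using V'(1) \<open>u \<in> V\<close> unfolding free_def by blast
    then have "card (insert u V') \<le> card V'" using V' by blast
    moreover have "u \<notin> V'" using n by auto
    ultimately show False using finV[OF V'V] by simp
  qed
  define \<nu> where "\<nu> u = (SOME z. z \<in> V' \<and> (z = u \<or> par u z))" for u
  have \<nu>: "\<nu> u \<in> V' \<and> (\<nu> u = u \<or> par u (\<nu> u))" if "u \<in> V" for u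
    unfolding \<nu>_def by (rule someI_ex) (use rep[OF that] in blast)
  have \<nu>_inj: "inj_on \<nu> (set t)" if "(a, t) \<in> E" for a t
  proof (rule inj_onI, rule ccontr)
    fix u w assume uw: "u \<in> set t" "w \<in> set t" "\<nu> u = \<nu> w" "u \<noteq> w"
    have "u \<in> V" "w \<in> V" "\<nu> u \<in> V" using E[OF that] uw \<nu> V'V by auto
    then have "par u w" using \<nu>[of u] \<nu>[of w] uw par_sym par_trans by metis
    then show False using n_pair[OF that uw(1,2,4)] unfolding par_def by simp
  qed
  \<comment> \<open>A representative outside the edge is forced by the entry that it replaces and so
    adds a relation, while dropping an entry loses at most one. Equally many vertices are added and
    dropped.\<close>
  have \<nu>_null: "nullity (R a) {..<arity a} \<le> nullity L (\<nu> ` set t)" if e: "(a, t) \<in> E" for a t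
  proof -
    define T where "T = set t"
    have TV: "T \<subseteq> V" using E[OF e] unfolding T_def by auto
    have finT: "finite T" unfolding T_def by simp
    have "forced L T y" if y: "y \<in> \<nu> ` T - T" for y
    proof -
      obtain u where u: "u \<in> T" "y = \<nu> u" using y by auto
      then have "u \<in> V" "y \<noteq> u" using y TV by auto
      then have p: "par u y" "u \<in> V" using \<nu>[of u] u by auto
      then have "nullity L (insert y {u}) \<noteq> 0" "y \<notin> {u}" unfolding par_def by (auto simp: insert_commute)
      then have "forced L {u} y"
        using nullity_insert[OF L, of "{u}" y] single[OF p(2)] by (auto split: if_splits)
      then show ?thesis by (rule forced_mono) (use u in auto)
    qed
    then have "nullity L T + card (\<nu> ` T - T) \<le> nullity L (T \<union> (\<nu> ` T - T))"
      using finT by (intro nullity_forced_union[OF L]) auto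
    moreover have "nullity L (\<nu> ` T \<union> (T - \<nu> ` T)) \<le> nullity L (\<nu> ` T) + card (T - \<nu> ` T)"
      using finT by (intro nullity_diff_le[OF L]) auto
    moreover have "T \<union> (\<nu> ` T - T) = \<nu> ` T \<union> (T - \<nu> ` T)" by auto
    moreover have "card (\<nu> ` T) = card T" using \<nu>_inj[OF e] unfolding T_def by (rule card_image)
    moreover have "card (T - \<nu> ` T) + card (T \<inter> \<nu> ` T) = card T"
      "card (\<nu> ` T - T) + card (T \<inter> \<nu> ` T) = card (\<nu> ` T)"
      using finT card_Diff_subset_Int[of T "\<nu> ` T"] card_Diff_subset_Int[of "\<nu> ` T" T]
        card_mono[of T "T \<inter> \<nu> ` T"] card_mono[of "\<nu> ` T" "T \<inter> \<nu> ` T"] by (auto simp: Int_commute)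
    ultimately show ?thesis using n_edge[OF e] unfolding T_def by simp
  qed
  define rk where "rk Y = int (card Y) - int (nullity L Y)" for Y
  \<comment> \<open>The numerator is \<open>K - 1\<close> so that \<open>b * (K - l) < K\<close>
    remains strict when \<open>K - l\<close> divides \<open>K\<close>, while
    \<open>K \<le> (b + 1) * (K - l)\<close> still holds.\<close>
  define b where "b = (K - 1) div (K - l)"
  have b_less: "b * (K - l) < K"
  proof -
    have "b * (K - l) \<le> K - 1" unfolding b_def by simp
    then show ?thesis using l_less by simp
  qed
  have b_ge: "K \<le> (b + 1) * (K - l)"
  proof -
    have "K - 1 = b * (K - l) + (K - 1) mod (K - l)"
      unfolding b_def by (rule div_mult_mod_eq[symmetric])
    moreover have "(K - 1) mod (K - l) < K - l" using l_less by simp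
    ultimately have "K - 1 < (b + 1) * (K - l)" unfolding distrib_right mult_1 by linarith
    then show ?thesis by simp
  qed
  have b1: "1 \<le> b" unfolding b_def using l_less l_pos by (simp add: div_greater_zero_iff Suc_leI)
  have rk_mono: "rk Y \<le> rk Z" if "Y \<subseteq> Z" "Z \<subseteq> V" for Y Z
  proof -
    have "finite Z" "finite Y" using that finV by auto
    then have "nullity L Z \<le> nullity L Y + card (Z - Y)"
      using nullity_diff_le[OF L, of Y "Z - Y"] that by (simp add: Un_absorb1)
    moreover have "card Z = card Y + card (Z - Y)"
      using \<open>finite Z\<close> \<open>finite Y\<close> that card_mono[of Z Y] by (simp add: card_Diff_subset)
    ultimately show ?thesis unfolding rk_def by simp
  qed
  have rk_ge: "int (K - l) * int (card Y) \<le> int K * rk Y" if "Y \<subseteq> V" for Y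
  proof -
    have "int K * int (nullity L Y) \<le> int l * int (card Y)" using pot'[OF that] by (simp flip: of_nat_mult)
    then show ?thesis using l_less unfolding rk_def by (simp add: algebra_simps of_nat_diff)
  qed
  have rk_pos: "1 \<le> rk Y" if "Y \<subseteq> V" "Y \<noteq> {}" for Y
  proof -
    have "0 < int (K - l) * int (card Y)" using l_less that finV[OF that(1)] by (simp add: card_gt_0_iff)
    then have "0 < int K * rk Y" using rk_ge[OF that(1)] by linarith
    then show ?thesis by (simp add: zero_less_mult_iff)
  qed
  define g where "g Y = nat (int b * (rk Y - 1) + 1)" for Y
  have g_int: "int (g Y) = int b * (rk Y - 1) + 1" if "Y \<subseteq> V" "Y \<noteq> {}" for Y
    unfolding g_def using rk_pos[OF that] by simp
  interpret sc: submodular_count g V'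
  proof
    show "finite V'" using finV[OF V'V] .
    show "g Y \<le> g Z" if "Y \<noteq> {}" "Y \<subseteq> Z" "Z \<subseteq> V'" for Y Z
    proof -
      have "rk Y \<le> rk Z" using that V'V by (intro rk_mono) auto
      then have "int b * (rk Y - 1) \<le> int b * (rk Z - 1)" by (intro mult_left_mono) auto
      then show ?thesis unfolding g_def by simp
    qed
    show "g (Y \<union> Z) + g (Y \<inter> Z) \<le> g Y + g Z" if s: "Y \<subseteq> V'" "Z \<subseteq> V'" "Y \<inter> Z \<noteq> {}" for Y Z
    proof -
      have sub: "Y \<subseteq> V" "Z \<subseteq> V" "Y \<union> Z \<subseteq> V" "Y \<inter> Z \<subseteq> V" using s V'V by auto
      have ne: "Y \<noteq> {}" "Z \<noteq> {}" "Y \<union> Z \<noteq> {}" using s by auto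
      have "card Y + card Z = card (Y \<union> Z) + card (Y \<inter> Z)" using finV sub by (intro card_Un_Int) auto
      moreover have "nullity L Y + nullity L Z \<le> nullity L (Y \<union> Z) + nullity L (Y \<inter> Z)"
        using finV sub by (intro nullity_supermodular[OF L]) auto
      ultimately have "rk (Y \<union> Z) + rk (Y \<inter> Z) \<le> rk Y + rk Z" unfolding rk_def by simp
      then have "int b * (rk (Y \<union> Z) + rk (Y \<inter> Z)) \<le> int b * (rk Y + rk Z)" by (intro mult_left_mono) auto
      then have "int (g (Y \<union> Z)) + int (g (Y \<inter> Z)) \<le> int (g Y) + int (g Z)"
        unfolding g_int[OF sub(1) ne(1)] g_int[OF sub(2) ne(2)] g_int[OF sub(3) ne(3)] g_int[OF sub(4) s(3)]
        by (simp add: algebra_simps)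
      then show ?thesis by simp
    qed
    show "card Y \<le> 2 * g Y" if Y: "Y \<subseteq> V'" "Y \<noteq> {}" for Y
    proof -
      have YV: "Y \<subseteq> V" using Y V'V by auto
      have "int K * int (card Y) \<le> (int b + 1) * int (K - l) * int (card Y)"
        using b_ge by (intro mult_right_mono) (simp_all flip: of_nat_mult of_nat_Suc add: add.commute)
      also have "\<dots> = (int b + 1) * (int (K - l) * int (card Y))" by simp
      also have "\<dots> \<le> (int b + 1) * (int K * rk Y)" using rk_ge[OF YV] by (intro mult_left_mono) auto
      finally have "int K * int (card Y) \<le> int K * ((int b + 1) * rk Y)" by (simp add: algebra_simps)
      then have c: "int (card Y) \<le> (int b + 1) * rk Y" using l_less by simp
      \<comment> \<open>The desired \<open>(b + 1) * rk Y \<le> 2 * (b * (rk Y - 1) + 1)\<close> is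
        equivalent to \<open>0 \<le> (b - 1) * (rk Y - 2)\<close>. It fails only in rank one with
        \<open>b > 1\<close>, and there a set of representatives is a singleton; this is what the
        passage to representatives is for.\<close>
      show ?thesis
      proof (cases "b = 1 \<or> 2 \<le> rk Y")
        case True
        then have "0 \<le> (int b - 1) * (rk Y - 2)" using b1 by auto
        then have "(int b + 1) * rk Y \<le> 2 * (int b * (rk Y - 1) + 1)" by (simp add: algebra_simps)
        then have "int (card Y) \<le> 2 * int (g Y)" unfolding g_int[OF YV Y(2)] using c by (rule order_trans[rotated])
        then show ?thesis by simp
      next
        case False
        have "card Y \<le> 1"
        proof (rule ccontr)
          assume "\<not> card Y \<le> 1"
          then obtain u w where uw: "u \<in> Y" "w \<in> Y" "u \<noteq> w"
            using card_le_Suc0_iff_eq[OF finV[OF YV]] by auto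
          then have "nullity L {u, w} = 0" using V' Y unfolding free_def par_def by blast
          then have "rk {u, w} = 2" using uw unfolding rk_def by simp
          moreover have "rk {u, w} \<le> rk Y" using uw YV by (intro rk_mono) auto
          ultimately show False using False by simp
        qed
        moreover have "1 \<le> int (g Y)" using g_int[OF YV Y(2)] rk_pos[OF YV Y(2)] by simp
        ultimately show ?thesis by simp
      qed
    qed
  qed
  obtain P where P: "P True \<union> P False = V'" "\<And>i. sparse g (P i)" using sc.exists_partition by blast
  define clr where "clr u \<longleftrightarrow> \<nu> u \<in> P True" for u
  have "\<exists>u\<in>set t. \<exists>w\<in>set t. clr u \<noteq> clr w" if e: "(a, t) \<in> E" for a t
  proof (rule ccontr)
    assume n: "\<not> ?thesis"
    have tV: "set t \<subseteq> V" using E[OF e] by auto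
    have "\<exists>c. \<forall>u\<in>set t. clr u = c" using n by blast
    then obtain c where c: "\<And>u. u \<in> set t \<Longrightarrow> clr u = c" by blast
    have "\<nu> u \<in> P c" if "u \<in> set t" for u
      using c[OF that] \<nu>[of u] that tV P(1) unfolding clr_def by (cases c) auto
    then have sub: "\<nu> ` set t \<subseteq> P c" by auto
    have sV: "\<nu> ` set t \<subseteq> V" using \<nu> tV V'V by auto
    have ne: "\<nu> ` set t \<noteq> {}" using E[OF e] arity_ge2[of a] by auto
    have "length t = arity a" "distinct t" using E[OF e] by auto
    then have cd: "card (\<nu> ` set t) = arity a" using card_image[OF \<nu>_inj[OF e]] distinct_card[of t] by simp
    have "card (\<nu> ` set t) \<le> g (\<nu> ` set t)" using P(2)[of c] sub ne unfolding sparse_def by blast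
    then have "arity a \<le> g (\<nu> ` set t)" unfolding cd .
    \<comment> \<open>By \<open>R_full\<close>, the rank of the edge minus one is at most
      \<open>(arity a - 1) * (K - l) / K\<close>. An edge inside one class would therefore give
      \<open>K \<le> b * (K - l)\<close>, against the choice of \<open>b\<close>.\<close>
    then have "int (arity a) \<le> int b * (rk (\<nu> ` set t) - 1) + 1" unfolding g_int[OF sV ne, symmetric] by simp
    moreover have "rk (\<nu> ` set t) \<le> int (arity a) - int (nullity (R a) {..<arity a})"
      using \<nu>_null[OF e] cd unfolding rk_def by simp
    then have "int b * (rk (\<nu> ` set t) - 1) \<le> int b * (int (arity a) - int (nullity (R a) {..<arity a}) - 1)"
      by (intro mult_left_mono) auto
    ultimately have "int (arity a) - 1 \<le> int b * (int (arity a) - 1 - int (nullity (R a) {..<arity a}))"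
      by (simp add: algebra_simps)
    then have "int K * (int (arity a) - 1) \<le> int K * (int b * (int (arity a) - 1 - int (nullity (R a) {..<arity a})))"
      by (intro mult_left_mono) auto
    also have "\<dots> = int b * (int K * (int (arity a) - 1) - int (nullity (R a) {..<arity a} * K))"
      by (simp add: algebra_simps)
    also have "int (nullity (R a) {..<arity a} * K) = int l * (int (arity a) - 1)"
      unfolding R_full using arity_ge2[of a] by (simp add: of_nat_diff)
    also have "int b * (int K * (int (arity a) - 1) - int l * (int (arity a) - 1)) =
        (int b * int (K - l)) * (int (arity a) - 1)" using l_less by (simp add: of_nat_diff algebra_simps)
    also have "\<dots> < int K * (int (arity a) - 1)"
      using b_less arity_ge2[of a] by (intro mult_strict_right_mono) (simp_all flip: of_nat_mult)
    finally show False by simp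
  qed
  then show ?thesis by (intro exI[of _ clr]) auto
qed

section \<open>Exploration of a component\<close>


definition relations :: "(bool \<times> nat list) set \<Rightarrow> (nat \<Rightarrow> rat) set" where
  "relations F = fv.span (\<Union>(a, t)\<in>F. push t ` R a)"

lemma subspace_relations: "fv.subspace (relations F)"
  unfolding relations_def by (rule fv.subspace_span)

lemma relations_mono: "F \<subseteq> G \<Longrightarrow> relations F \<subseteq> relations G"
  unfolding relations_def by (intro fv.span_mono) auto

lemma push_relations: "(a, t) \<in> F \<Longrightarrow> push t ` R a \<subseteq> relations F"
  unfolding relations_def using fv.span_superset by fastforce

lemma relations_supported:
  assumes "\<And>a t. (a, t) \<in> F \<Longrightarrow> set t \<subseteq> V"
  shows "relations F \<subseteq> supported V"
  unfolding relations_def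
proof (rule fv.span_minimal[OF _ subspace_supported])
  show "(\<Union>(a, t)\<in>F. push t ` R a) \<subseteq> supported V"
    using assms push_supported supported_mono by blast
qed

text \<open>The loss of potential when an edge is added that meets the structure in the positions \<open>W\<close>.\<close>

definition gain :: "bool \<Rightarrow> nat set \<Rightarrow> int" where
  "gain a W = int l * (int (card W) - 1) - int K * int (nullity (R a) W)"

lemma gain_singleton: "i < arity a \<Longrightarrow> gain a {i} = 0"
  unfolding gain_def using R_single by simp

lemma gain_full: "gain a {..<arity a} = 0"
proof -
  have "int (nullity (R a) {..<arity a} * K) = int (l * (arity a - 1))" using R_full by simp
  then show ?thesis unfolding gain_def using arity_ge2[of a] by (simp add: of_nat_diff algebra_simps)
qed

lemma gain_pos:
  assumes "W \<subseteq> {..<arity a}" "2 \<le> card W" "card W < arity a"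
  shows "1 \<le> gain a W"
proof -
  have "int (nullity (R a) W * K) < int (l * (card W - 1))"
    using R_proper[OF assms] by (simp only: of_nat_less_iff)
  then have "int (nullity (R a) W) * int K < int l * int (card W - 1)" unfolding of_nat_mult .
  moreover have "int (card W - 1) = int (card W) - 1" using assms by simp
  ultimately show ?thesis unfolding gain_def by (simp add: mult.commute)
qed

lemma gain_nonneg:
  assumes "W \<subseteq> {..<arity a}" "W \<noteq> {}"
  shows "0 \<le> gain a W"
proof -
  have fin: "finite W" using assms finite_subset by blast
  have le: "card W \<le> arity a" using card_mono[OF _ assms(1)] by simp
  consider "card W = 1" | "2 \<le> card W" "card W < arity a" | "card W = arity a"
    using le assms(2) fin card_gt_0_iff[of W] by linarith
  then show ?thesis
  proof cases
    case 1
    then obtain i where "W = {i}" using card_1_singletonE by blast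
    then show ?thesis using gain_singleton assms by simp
  next
    case 2
    then show ?thesis using gain_pos[OF assms(1)] by simp
  next
    case 3
    then have "W = {..<arity a}" using assms card_subset_eq[of "{..<arity a}" W] by simp
    then show ?thesis using gain_full by simp
  qed
qed

text \<open>Each vertex outside \<open>X\<close> contributes \<open>l\<close>, the edge brings at
  least the relations of the template beyond those on \<open>W\<close>, and \<open>R_full\<close>
  turns the balance into \<open>gain\<close>. Equality may fail, since the edge can imply more
  together with \<open>L\<close>.\<close>

lemma pot_edge:
  assumes L: "fv.subspace L" "fv.subspace L'" "L \<subseteq> L'" "push t ` R a \<subseteq> L'"
    and t: "distinct t" "length t = arity a" and X: "finite X" and W: "W = {i. i < arity a \<and> t ! i \<in> X}"
  shows "pot L' (X \<union> set t) \<le> pot L X - gain a W"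
proof -
  have inj: "inj_on ((!) t) {..<arity a}" by (rule inj_on_nth) (use t in auto)
  have st: "(!) t ` {..<arity a} = set t" using t by (auto simp: set_conv_nth)
  define N where "N = {..<arity a} - W"
  have un: "W \<union> N = {..<arity a}" unfolding N_def W by auto
  have XN: "X \<union> (!) t ` N = X \<union> set t" unfolding st[symmetric] N_def W by auto
  have disj: "(!) t ` N \<inter> X = {}" unfolding N_def W by auto
  have "nullity (R a) (W \<union> N) + nullity L' X \<le> nullity L' (X \<union> (!) t ` N) + nullity (R a) W"
    using disj X W by (intro nullity_push[OF R_subspace L(2) t(1) L(4)]) (auto simp: N_def t)
  then have 1: "nullity (R a) {..<arity a} + nullity L' X \<le> nullity L' (X \<union> set t) + nullity (R a) W"
    unfolding un XN .
  have 2: "nullity L X \<le> nullity L' X" using nullity_mono[OF L(1-3) X, of X] by simp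
  have "card (X \<union> (!) t ` N) = card X + card N"
    using disj X inj card_image[of "(!) t" N] inj_on_subset[of "(!) t" "{..<arity a}" N]
    by (subst card_Un_disjoint) (auto simp: N_def)
  then have 3: "card (X \<union> set t) = card X + card N" unfolding XN .
  have 4: "card N + card W = arity a"
  proof -
    have "card (W \<union> N) = card W + card N" unfolding N_def W by (rule card_Un_disjoint) auto
    then show ?thesis unfolding un by simp
  qed
  have 5: "int K * int (nullity (R a) {..<arity a}) = int l * (int (arity a) - 1)"
    using gain_full[of a] unfolding gain_def by simp
  have "int K * (int (nullity (R a) {..<arity a}) + int (nullity L X))
      \<le> int K * (int (nullity L' (X \<union> set t)) + int (nullity (R a) W))"
    using 1 2 by (intro mult_left_mono) auto
  then have "int l * (int (arity a) - 1) + int K * int (nullity L X) \<le>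
     int K * int (nullity L' (X \<union> set t)) + int K * int (nullity (R a) W)"
    using 5 by (simp add: distrib_left)
  moreover have "int l * (int (card X) + int (card N)) =
     int l * int (card X) + int l * (int (arity a) - 1) - int l * (int (card W) - 1)"
  proof -
    have cN: "int (card N) = int (arity a) - int (card W)" using 4 by linarith
    show ?thesis unfolding cN by (simp add: algebra_simps)
  qed
  ultimately show ?thesis unfolding pot_def gain_def 3 by simp
qed

text \<open>
  Shapes of breadth-first explorations: in \<open>reach N d v j F\<close>, after \<open>N\<close> moves the vertices
  \<open>0, \<dots>, v - 1\<close> have been found, those below \<open>j\<close> have been processed, \<open>F\<close> is the set of the recorded
  edges and \<open>d\<close> of them decreased the potential. Since edges are only attached at the current vertex \<open>j\<close>, a
  regular edge leaves no choice except the position of \<open>j\<close> in it.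
\<close>

inductive reach :: "nat \<Rightarrow> nat \<Rightarrow> nat \<Rightarrow> nat \<Rightarrow> (bool \<times> nat list) set \<Rightarrow> bool" where
  start: "reach 0 0 1 0 {}"
| advance: "reach N d v j F \<Longrightarrow> j < v \<Longrightarrow> reach (Suc N) d v (Suc j) F"
| regular: "reach N d v j F \<Longrightarrow> j < v \<Longrightarrow> i < arity a \<Longrightarrow>
    reach (Suc N) d (v + (arity a - 1)) j (insert (a, [v..<v + i] @ j # [v + i..<v + (arity a - 1)]) F)"
| irregular: "reach N d v j F \<Longrightarrow> distinct t \<Longrightarrow> length t = arity a \<Longrightarrow> set t \<union> {..<v} = {..<v'} \<Longrightarrow>
    2 \<le> card (set t \<inter> {..<v}) \<Longrightarrow>
    (set t \<subseteq> {..<v} \<Longrightarrow> \<not> push t ` R a \<subseteq> relations F) \<Longrightarrow>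
    reach (Suc N) (Suc d) v' j (insert (a, t) F)"

lemma reach_bounds: "reach N d v j F \<Longrightarrow> 1 \<le> v \<and> j \<le> v \<and> v \<le> 1 + N * (arity True + arity False) \<and> finite F"
proof (induction rule: reach.induct)
  case (regular N d v j F i a)
  then show ?case by (cases a) auto
next
  case (irregular N d v j F t a v')
  have "v \<le> v'" using irregular(4) by (metis Un_upper2 lessThan_subset_iff)
  moreover have "v' \<le> v + arity a"
  proof -
    have "v' = card (set t \<union> {..<v})" using irregular(4) by simp
    also have "\<dots> \<le> card (set t) + card {..<v}" by (rule card_Un_le)
    also have "\<dots> \<le> arity a + v" using irregular(3) card_length[of t] by simp
    finally show ?thesis by simp
  qed
  ultimately show ?case using irregular by (cases a) auto
qed auto

lemma regular_tuple:
  assumes "i < arity a" "j < v"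
  defines "t \<equiv> [v..<v + i] @ j # [v + i..<v + (arity a - 1)]"
  shows "distinct t" "length t = arity a" "set t = insert j {v..<v + (arity a - 1)}"
    "{m. m < arity a \<and> t ! m \<in> {..<v}} = {i}"
proof -
  show d: "distinct t" using assms by auto
  show len: "length t = arity a" using assms by auto
  show "set t = insert j {v..<v + (arity a - 1)}" using assms by auto
  have "t ! m < v \<longleftrightarrow> m = i" if "m < arity a" for m
  proof -
    consider "m < i" | "m = i" | "i < m" by linarith
    then show ?thesis using that assms by cases (auto simp: nth_append nth_Cons split: nat.splits)
  qed
  then show "{m. m < arity a \<and> t ! m \<in> {..<v}} = {i}" using assms by auto
qed

lemma reach_edges:
  "reach N d v j F \<Longrightarrow> (a, t) \<in> F \<Longrightarrow> distinct t \<and> length t = arity a \<and> set t \<subseteq> {..<v}"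
proof (induction arbitrary: a t rule: reach.induct)
  case (regular N d v j F i b)
  show ?case
  proof (cases "(a, t) \<in> F")
    case True
    then show ?thesis using regular.IH[OF True] by auto
  next
    case False
    then have "a = b" "t = [v..<v + i] @ j # [v + i..<v + (arity b - 1)]" using regular.prems by auto
    then show ?thesis using regular_tuple[OF regular.hyps(3,2)] regular.hyps by auto
  qed
next
  case (irregular N d v j F s b v')
  then have sub: "{..<v} \<subseteq> {..<v'}" "set s \<subseteq> {..<v'}" by auto
  show ?case
  proof (cases "(a, t) \<in> F")
    case True
    then show ?thesis using irregular.IH[OF True] sub by auto
  next
    case False
    then show ?thesis using irregular sub by auto
  qed
qed auto

text \<open>A single vertex has potential \<open>l\<close>. An overlap in a proper part of an edge
  costs at least 1 by \<open>gain_pos\<close>, and an edge on known vertices with a new relation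
  raises the nullity, which costs at least \<open>K\<close>. Hence nonnegative potential leaves room
  for at most \<open>l\<close> irregular edges.\<close>

lemma reach_pot: "reach N d v j F \<Longrightarrow> pot (relations F) {..<v} \<le> int l - int d"
proof (induction rule: reach.induct)
  case start
  have "0 \<le> int K * int (nullity (relations {}) {..<1})" by simp
  then show ?case unfolding pot_def by simp
next
  case (regular N d v j F i a)
  define t where "t = [v..<v + i] @ j # [v + i..<v + (arity a - 1)]"
  note rt = regular_tuple[OF regular.hyps(3,2), folded t_def]
  have "{..<v} \<union> {v..<v + (arity a - 1)} = {..<v + (arity a - 1)}" by (rule ivl_disj_un_one(2)) simp
  moreover have "j \<in> {..<v}" using regular.hyps(2) by simp
  ultimately have un: "{..<v} \<union> set t = {..<v + (arity a - 1)}" unfolding rt(3) by blast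
  have "pot (relations (insert (a, t) F)) ({..<v} \<union> set t) \<le> pot (relations F) {..<v} - gain a {i}"
    using rt by (intro pot_edge subspace_relations relations_mono push_relations) auto
  then have "pot (relations (insert (a, t) F)) {..<v + (arity a - 1)} \<le> int l - int d"
    using regular.IH gain_singleton[OF regular.hyps(3)] unfolding un by simp
  then show ?case unfolding t_def .
next
  case (irregular N d v j F t a v')
  let ?L = "relations F" and ?L' = "relations (insert (a, t) F)"
  define W where "W = {i. i < arity a \<and> t ! i \<in> {..<v}}"
  have un: "{..<v} \<union> set t = {..<v'}" using irregular.hyps by auto
  have st: "(!) t ` {..<arity a} = set t" using irregular.hyps by (auto simp: set_conv_nth)
  have inj: "inj_on ((!) t) {..<arity a}" by (rule inj_on_nth) (use irregular in auto)
  have img: "(!) t ` W = set t \<inter> {..<v}" unfolding W_def st[symmetric] by auto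
  have cW: "card W = card (set t \<inter> {..<v})"
    unfolding img[symmetric] by (rule card_image[symmetric], rule inj_on_subset[OF inj]) (auto simp: W_def)
  show ?case
  proof (cases "set t \<subseteq> {..<v}")
    case False
    have "pot ?L' ({..<v} \<union> set t) \<le> pot ?L {..<v} - gain a W"
      using irregular.hyps
      by (intro pot_edge subspace_relations relations_mono push_relations) (auto simp: W_def)
    moreover have "1 \<le> gain a W"
    proof (rule gain_pos)
      show "W \<subseteq> {..<arity a}" unfolding W_def by auto
      show "2 \<le> card W" using cW irregular.hyps by simp
      have "W \<noteq> {..<arity a}" using False img st by auto
      then have "W \<subset> {..<arity a}" unfolding W_def by auto
      then show "card W < arity a" using psubset_card_mono[of "{..<arity a}" W] by simp
    qed
    ultimately show ?thesis using irregular.IH unfolding un by simp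
  next
    case True
    then have v': "v' = v" using un by (simp add: Un_absorb2)
    have sub: "?L \<subseteq> ?L'" by (intro relations_mono) auto
    moreover have "\<not> push t ` R a \<subseteq> ?L" using irregular.hyps True by auto
    then have "?L \<noteq> ?L'" using push_relations[of a t "insert (a, t) F"] by auto
    moreover have "?L' \<subseteq> supported {..<v}"
      using reach_edges[OF irregular.hyps(1)] True by (intro relations_supported) auto
    ultimately have "nullity ?L {..<v} < nullity ?L' {..<v}"
      by (intro nullity_less subspace_relations) auto
    then have "int K * (int (nullity ?L {..<v}) + 1) \<le> int K * int (nullity ?L' {..<v})"
      by (intro mult_left_mono) auto
    moreover have "1 \<le> int K" using l_less by simp
    ultimately show ?thesis using irregular.IH unfolding v' pot_def by (simp add: distrib_left)
  qed
qed simp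

text \<open>If \<open>Y\<close> splits the old vertices, an old edge crosses it; otherwise the new
  edge does, because it meets \<open>X\<close>.\<close>

lemma crossing_insert:
  assumes IH: "\<And>Y. Y \<subset> X \<Longrightarrow> Y \<noteq> {} \<Longrightarrow> \<exists>(a, t)\<in>F. set t \<inter> Y \<noteq> {} \<and> \<not> set t \<subseteq> Y"
    and F: "\<And>a t. (a, t) \<in> F \<Longrightarrow> set t \<subseteq> X"
    and t: "set t \<inter> X \<noteq> {}" and Y: "Y \<subset> X \<union> set t" "Y \<noteq> {}"
  shows "\<exists>(b, s)\<in>insert (a, t) F. set s \<inter> Y \<noteq> {} \<and> \<not> set s \<subseteq> Y"
proof (cases "Y \<inter> X = {} \<or> X \<subseteq> Y")
  case True
  then have "set t \<inter> Y \<noteq> {} \<and> \<not> set t \<subseteq> Y" using t Y by auto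
  then show ?thesis by auto
next
  case False
  then have "Y \<inter> X \<subset> X" "Y \<inter> X \<noteq> {}" by auto
  then obtain b s where "(b, s) \<in> F" "set s \<inter> (Y \<inter> X) \<noteq> {}" "\<not> set s \<subseteq> Y \<inter> X"
    using IH[of "Y \<inter> X"] by auto
  then show ?thesis using F[of b s] by (intro bexI[of _ "(b, s)"]) auto
qed

lemma reach_connected:
  "reach N d v j F \<Longrightarrow> Y \<subset> {..<v} \<Longrightarrow> Y \<noteq> {} \<Longrightarrow> \<exists>(a, t)\<in>F. set t \<inter> Y \<noteq> {} \<and> \<not> set t \<subseteq> Y"
proof (induction arbitrary: Y rule: reach.induct)
  case start
  have "{..<1::nat} = {0}" by auto
  then show ?case using start by auto
next
  case (advance N d v j F)
  then show ?case by auto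
next
  case (regular N d v j F i a)
  define t where "t = [v..<v + i] @ j # [v + i..<v + (arity a - 1)]"
  note rt = regular_tuple[OF regular.hyps(3,2), folded t_def]
  have "{..<v} \<union> {v..<v + (arity a - 1)} = {..<v + (arity a - 1)}" by (rule ivl_disj_un_one(2)) simp
  then have "Y \<subset> {..<v} \<union> set t" unfolding rt(3) using regular.prems(1) by blast
  moreover have "set t \<inter> {..<v} \<noteq> {}" unfolding rt(3) using regular.hyps(2) by auto
  ultimately show ?case
    unfolding t_def[symmetric] using regular.IH reach_edges[OF regular.hyps(1)] regular.prems(2)
    by (intro crossing_insert[where X = "{..<v}"]) blast+
next
  case (irregular N d v j F t a v')
  have "set t \<inter> {..<v} \<noteq> {}" using irregular.hyps(5) by (metis card.empty not_numeral_le_zero)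
  moreover have "Y \<subset> {..<v} \<union> set t" using irregular.prems(1) irregular.hyps(4) by blast
  ultimately show ?case
    using irregular.IH reach_edges[OF irregular.hyps(1)] irregular.prems(2)
    by (intro crossing_insert[where X = "{..<v}"]) blast+
qed

text \<open>Connectivity lets \<open>Y\<close> grow to the whole structure by swallowing crossing
  edges, and none of them increases the potential by \<open>gain_nonneg\<close>. So the hypothesis
  of \<open>colouring\<close> on all subsets reduces to the potential of the whole
  structure.\<close>

lemma reach_pot_minimal:
  assumes r: "reach N d v j F" and Y: "Y \<subseteq> {..<v}" "Y \<noteq> {}"
  shows "pot (relations F) {..<v} \<le> pot (relations F) Y"
  using Y
proof (induction "v - card Y" arbitrary: Y rule: less_induct)
  case less
  show ?case
  proof (cases "Y = {..<v}")
    case False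
    then obtain a t where t: "(a, t) \<in> F" "set t \<inter> Y \<noteq> {}" "\<not> set t \<subseteq> Y"
      using reach_connected[OF r, of Y] less.prems by auto
    note e = reach_edges[OF r t(1)]
    have finY: "finite Y" using less.prems finite_subset by blast
    define W where "W = {i. i < arity a \<and> t ! i \<in> Y}"
    have sub: "Y \<union> set t \<subseteq> {..<v}" using less.prems e by auto
    have "card Y < card (Y \<union> set t)" using t finY by (intro psubset_card_mono) auto
    moreover have "card (Y \<union> set t) \<le> v" using card_mono[OF _ sub] by simp
    ultimately have IH: "pot (relations F) {..<v} \<le> pot (relations F) (Y \<union> set t)"
      using less.prems sub by (intro less.hyps) auto
    have "pot (relations F) (Y \<union> set t) \<le> pot (relations F) Y - gain a W"
      using e finY push_relations[OF t(1)] W_def by (intro pot_edge subspace_relations) auto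
    moreover have "0 \<le> gain a W"
    proof (rule gain_nonneg)
      show "W \<subseteq> {..<arity a}" unfolding W_def by auto
      show "W \<noteq> {}" using t(2) e unfolding W_def by (auto simp: set_conv_nth)
    qed
    ultimately show ?thesis using IH by simp
  qed simp
qed

end

text \<open>The right-hand side of a system may be nonzero, so relations are imposed on differences
  of solutions. This is enough for counting: it decides which entries are determined by the
  others.\<close>

locale template_solutions = templates +
  fixes Sol :: "bool \<Rightarrow> int list set"
  assumes Sol_distinct: "z \<in> Sol a \<Longrightarrow> length z = arity a \<and> distinct z"
    and Sol_relations: "z \<in> Sol a \<Longrightarrow> z' \<in> Sol a \<Longrightarrow> \<rho> \<in> R a \<Longrightarrow>
      (\<Sum>i<arity a. \<rho> i * (rat_of_int (z ! i) - rat_of_int (z' ! i))) = 0"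
begin

definition realizes :: "int set \<Rightarrow> nat \<Rightarrow> (bool \<times> nat list) set \<Rightarrow> int list \<Rightarrow> bool" where
  "realizes S v F xs \<longleftrightarrow> length xs = v \<and> distinct xs \<and> set xs \<subseteq> S \<and>
     (\<forall>(a, t)\<in>F. map ((!) xs) t \<in> Sol a)"

text \<open>An absorbed solution need not belong to \<open>F\<close>. Recording it would not change
  the potential, and the colouring treats it like a recorded edge, since all that matters there is
  that its relations lie in \<open>relations F\<close>.\<close>

definition absorbed :: "(bool \<times> nat list) set \<Rightarrow> int list \<Rightarrow> bool \<Rightarrow> int list \<Rightarrow> bool" where
  "absorbed F xs a z \<longleftrightarrow>
     (\<exists>t. set t \<subseteq> {..<length xs} \<and> map ((!) xs) t = z \<and> push t ` R a \<subseteq> relations F)"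

definition explored :: "int set \<Rightarrow> (bool \<times> nat list) set \<Rightarrow> int list \<Rightarrow> nat \<Rightarrow> bool" where
  "explored S F xs j \<longleftrightarrow>
     (\<forall>a. \<forall>z\<in>Sol a. set z \<subseteq> S \<longrightarrow> (\<exists>i<j. xs ! i \<in> set z) \<longrightarrow> absorbed F xs a z)"

lemma map_nth_append: "set t \<subseteq> {..<length xs} \<Longrightarrow> map ((!) (xs @ ys)) t = map ((!) xs) t"
  by (auto simp: nth_append)

lemma absorbed_mono:
  assumes "absorbed F xs a z" "F \<subseteq> G"
  shows "absorbed G (xs @ ys) a z"
proof -
  obtain t where t: "set t \<subseteq> {..<length xs}" "map ((!) xs) t = z" "push t ` R a \<subseteq> relations F"
    using assms unfolding absorbed_def by auto
  then have "map ((!) (xs @ ys)) t = z" using map_nth_append[OF t(1)] by simp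
  moreover have "set t \<subseteq> {..<length (xs @ ys)}" using t(1) by auto
  ultimately show ?thesis using t(3) relations_mono[OF assms(2)] unfolding absorbed_def by blast
qed

lemma explored_mono:
  assumes "explored S F xs j" "F \<subseteq> G" "j \<le> length xs"
  shows "explored S G (xs @ ys) j"
  unfolding explored_def
proof (intro allI ballI impI)
  fix a z assume z: "z \<in> Sol a" "set z \<subseteq> S" "\<exists>i<j. (xs @ ys) ! i \<in> set z"
  then have "\<exists>i<j. xs ! i \<in> set z" using assms(3) by (auto simp: nth_append)
  then show "absorbed G (xs @ ys) a z"
    using z assms absorbed_mono unfolding explored_def by blast
qed

lemma realizes_extend:
  assumes "realizes S v F xs" "\<And>a t. (a, t) \<in> F \<Longrightarrow> set t \<subseteq> {..<v}"
    and "distinct (xs @ ys)" "set ys \<subseteq> S" "map ((!) (xs @ ys)) t = z" "z \<in> Sol a" "v' = v + length ys"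
  shows "realizes S v' (insert (a, t) F) (xs @ ys)"
proof -
  have "map ((!) (xs @ ys)) s \<in> Sol b" if "(b, s) \<in> F" for b s
  proof -
    have "map ((!) xs) s \<in> Sol b" "length xs = v" using that assms(1) unfolding realizes_def by auto
    moreover have "map ((!) (xs @ ys)) s = map ((!) xs) s"
      by (rule map_nth_append) (use assms(2)[OF that] calculation in simp)
    ultimately show ?thesis by (simp only:)
  qed
  then show ?thesis using assms unfolding realizes_def by auto
qed

lemma map_nth_upt: "map ((!) (xs @ ys @ zs)) [length xs..<length xs + length ys] = ys"
  by (rule nth_equalityI) (auto simp: nth_append)

text \<open>Look at a solution through the current vertex that is not absorbed. If it meets the
  known vertices only there, it is a regular edge; if it meets more of them, it is irregular; if
  there is none, the vertex is processed.\<close>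

lemma explore_step:
  assumes r: "reach N d v j F" and re: "realizes S v F xs" and ex: "explored S F xs j" and j: "j < v"
  shows "\<exists>d' v' j' F' xs'. reach (Suc N) d' v' j' F' \<and> realizes S v' F' xs' \<and> explored S F' xs' j' \<and> d' \<le> Suc d"
proof (cases "\<forall>a. \<forall>z\<in>Sol a. set z \<subseteq> S \<longrightarrow> xs ! j \<in> set z \<longrightarrow> absorbed F xs a z")
  case True
  have "explored S F xs (Suc j)" using ex True unfolding explored_def by (auto simp: less_Suc_eq)
  then show ?thesis using reach.advance[OF r j] re by (metis le_SucI order_refl)
next
  case False
  then obtain a z where z: "z \<in> Sol a" "set z \<subseteq> S" "xs ! j \<in> set z" "\<not> absorbed F xs a z" by auto
  have zd: "length z = arity a" "distinct z" using Sol_distinct[OF z(1)] by auto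
  have xs: "length xs = v" "distinct xs" "set xs \<subseteq> S" using re unfolding realizes_def by auto
  have F: "set t \<subseteq> {..<v}" if "(b, t) \<in> F" for b t using reach_edges[OF r that] by auto
  have jx: "xs ! j \<in> set xs" using j xs by auto
  show ?thesis
  proof (cases "set z \<inter> set xs = {xs ! j}")
    case True
    obtain z1 z2 where zz: "z = z1 @ xs ! j # z2" using split_list[OF z(3)] by auto
    define t where "t = [v..<v + length z1] @ j # [v + length z1..<v + (arity a - 1)]"
    have i: "length z1 < arity a" using zd zz by auto
    have len: "arity a - 1 = length z1 + length z2" using zd zz by auto
    have "map ((!) (xs @ z1 @ z2)) [v..<v + length z1] = z1" using map_nth_upt[of xs z1 z2] xs by simp
    moreover have "map ((!) (xs @ z1 @ z2)) [v + length z1..<v + (arity a - 1)] = z2"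
      using map_nth_upt[of "xs @ z1" z2 "[]"] xs len by (simp add: add.assoc)
    moreover have "(xs @ z1 @ z2) ! j = xs ! j" using j xs by (simp add: nth_append)
    ultimately have mt: "map ((!) (xs @ z1 @ z2)) t = z" unfolding t_def zz by simp
    have "xs ! j \<notin> set (z1 @ z2)" using zd(2) zz by auto
    moreover have "set (z1 @ z2) \<inter> set xs \<subseteq> {xs ! j}" using True unfolding zz by auto
    ultimately have dj: "set (z1 @ z2) \<inter> set xs = {}" by blast
    have ds: "distinct (xs @ z1 @ z2)" using dj xs zd unfolding zz by auto
    have "realizes S (v + (arity a - 1)) (insert (a, t) F) (xs @ z1 @ z2)"
      by (rule realizes_extend[OF re _ ds _ mt z(1)]) (use F z(2) len in \<open>auto simp: zz\<close>)
    moreover have "explored S (insert (a, t) F) (xs @ z1 @ z2) j"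
      using explored_mono[OF ex, of "insert (a, t) F" "z1 @ z2"] j xs by auto
    moreover have "reach (Suc N) d (v + (arity a - 1)) j (insert (a, t) F)"
      unfolding t_def by (rule reach.regular[OF r j i])
    ultimately show ?thesis by (metis le_SucI order_refl)
  next
    case False
    define ys where "ys = filter (\<lambda>x. x \<notin> set xs) z"
    have ds: "distinct (xs @ ys)" using xs zd unfolding ys_def by auto
    have zsub: "set z \<subseteq> set (xs @ ys)" unfolding ys_def by auto
    define pos where "pos = inv_into {..<length (xs @ ys)} ((!) (xs @ ys))"
    have img: "(!) (xs @ ys) ` {..<length (xs @ ys)} = set (xs @ ys)" by (metis atLeast0LessThan nth_image order_refl take_all)
    have inj: "inj_on ((!) (xs @ ys)) {..<length (xs @ ys)}" by (rule inj_on_nth[OF ds]) auto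
    define t where "t = map pos z"
    have pos: "pos x < length (xs @ ys)" "(xs @ ys) ! pos x = x" if "x \<in> set z" for x
    proof -
      have "x \<in> (!) (xs @ ys) ` {..<length (xs @ ys)}" using that zsub unfolding img by auto
      from inv_into_into[OF this] f_inv_into_f[OF this]
      show "pos x < length (xs @ ys)" "(xs @ ys) ! pos x = x" unfolding pos_def by auto
    qed
    have mt: "map ((!) (xs @ ys)) t = z" unfolding t_def using pos by (simp add: map_idI)
    have td: "distinct t" using mt zd(2) distinct_map by metis
    have tl: "length t = arity a" unfolding t_def using zd by simp
    have tset: "set t \<subseteq> {..<length (xs @ ys)}" unfolding t_def using pos by auto
    have st: "(!) (xs @ ys) ` set t = set z" using mt by (metis list.set_map)
    have cap: "(!) (xs @ ys) ` (set t \<inter> {..<v}) = set z \<inter> set xs"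
    proof
      show "(!) (xs @ ys) ` (set t \<inter> {..<v}) \<subseteq> set z \<inter> set xs"
        using st xs(1) by (auto simp: nth_append)
      show "set z \<inter> set xs \<subseteq> (!) (xs @ ys) ` (set t \<inter> {..<v})"
      proof
        fix x assume x: "x \<in> set z \<inter> set xs"
        then obtain m where m: "m < v" "xs ! m = x" using xs(1) by (auto simp: in_set_conv_nth)
        have "(xs @ ys) ! m = x" using m xs(1) by (simp add: nth_append)
        moreover have "pos x = m"
          using inj pos[of x] x m xs(1) calculation by (auto simp: inj_on_def)
        then have "m \<in> set t" using x unfolding t_def by auto
        ultimately show "x \<in> (!) (xs @ ys) ` (set t \<inter> {..<v})" using m by auto
      qed
    qed
    have ccap: "card (set t \<inter> {..<v}) = card (set z \<inter> set xs)"
      unfolding cap[symmetric] by (rule card_image[symmetric], rule inj_on_subset[OF inj]) (use tset in auto)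
    have c2: "2 \<le> card (set t \<inter> {..<v})"
    proof -
      have "{xs ! j} \<subset> set z \<inter> set xs" using False z(3) jx by auto
      then have "card {xs ! j} < card (set z \<inter> set xs)" by (intro psubset_card_mono) auto
      then show ?thesis unfolding ccap by simp
    qed
    have un: "set t \<union> {..<v} = {..<v + length ys}"
    proof
      show "set t \<union> {..<v} \<subseteq> {..<v + length ys}" using tset xs(1) by auto
      show "{..<v + length ys} \<subseteq> set t \<union> {..<v}"
      proof
        fix m assume m: "m \<in> {..<v + length ys}"
        show "m \<in> set t \<union> {..<v}"
        proof (cases "m < v")
          case nm: False
          then have "(xs @ ys) ! m \<in> set ys" using m xs(1) by (auto simp: nth_append)
          then have mz: "(xs @ ys) ! m \<in> set z" unfolding ys_def by auto
          have "pos ((xs @ ys) ! m) = m"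
            using inj pos[OF mz] m xs(1) by (auto simp: inj_on_def)
          then have "m \<in> set t" using mz unfolding t_def by force
          then show ?thesis by auto
        qed auto
      qed
    qed
    \<comment> \<open>The solution is not absorbed, so its relations are new as soon as all its
      entries are known.\<close>
    have ns: "\<not> push t ` R a \<subseteq> relations F" if "set t \<subseteq> {..<v}"
    proof
      assume p: "push t ` R a \<subseteq> relations F"
      have "map ((!) xs) t = z" using mt map_nth_append[of t xs ys] that xs(1) by simp
      then show False using z(4) p that xs(1) unfolding absorbed_def by auto
    qed
    have "reach (Suc N) (Suc d) (v + length ys) j (insert (a, t) F)"
      by (rule reach.irregular[OF r td tl un c2 ns])
    moreover have "realizes S (v + length ys) (insert (a, t) F) (xs @ ys)"
      by (rule realizes_extend[OF re _ ds _ mt z(1)]) (use F z(2) in \<open>auto simp: ys_def\<close>)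
    moreover have "explored S (insert (a, t) F) (xs @ ys) j"
      using explored_mono[OF ex, of "insert (a, t) F" ys] j xs by auto
    ultimately show ?thesis by blast
  qed
qed

text \<open>A further move is made only while the potential is nonnegative, which by
  \<open>reach_pot\<close> means \<open>d \<le> l\<close>. The bound \<open>Suc l\<close> includes
  the move that makes the potential negative.\<close>

lemma explore:
  assumes "x0 \<in> S"
  shows "\<exists>n d v j F xs. n \<le> N \<and> d \<le> Suc l \<and> reach n d v j F \<and> realizes S v F xs \<and> explored S F xs j \<and>
     (n = N \<or> j = v \<or> pot (relations F) {..<v} < 0)"
proof (induction N)
  case 0
  have "realizes S 1 {} [x0]" unfolding realizes_def using assms by auto
  moreover have "explored S {} [x0] 0" unfolding explored_def by auto
  ultimately show ?case using reach.start by blast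
next
  case (Suc N)
  then obtain n d v j F xs where n: "n \<le> N" "d \<le> Suc l" "reach n d v j F" "realizes S v F xs"
    "explored S F xs j" and alt: "n = N \<or> j = v \<or> pot (relations F) {..<v} < 0" by blast
  show ?case
  proof (cases "j = v \<or> pot (relations F) {..<v} < 0")
    case True
    then show ?thesis using n le_SucI by blast
  next
    case False
    then have "j < v" using reach_bounds[OF n(3)] by auto
    moreover have "d \<le> l" using False reach_pot[OF n(3)] by simp
    moreover have "n = N" using False alt by auto
    ultimately show ?thesis using explore_step[OF n(3-5)] by (metis Suc_le_mono le_trans order_refl)
  qed
qed

lemma realizes_subset: "realizes S v F xs \<Longrightarrow> S \<subseteq> S' \<Longrightarrow> realizes S' v F xs"
  unfolding realizes_def by auto

text \<open>Finished components are peeled off one at a time. Every solution that meets the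
  component \<open>xs\<close> is absorbed and hence lies inside it, so its colouring can be glued to
  one of \<open>S - set xs\<close>. Excluded structures stay excluded in subsets.\<close>

lemma exists_colouring:
  assumes "finite S"
    and nb: "\<And>n d v j F xs. reach n d v j F \<Longrightarrow> d \<le> Suc l \<Longrightarrow> n \<le> N \<Longrightarrow>
      n = N \<or> pot (relations F) {..<v} < 0 \<Longrightarrow> \<not> realizes S v F xs"
  shows "\<exists>clr :: int \<Rightarrow> bool. \<forall>a. \<forall>z\<in>Sol a. set z \<subseteq> S \<longrightarrow> (\<exists>x\<in>set z. \<exists>y\<in>set z. clr x \<noteq> clr y)"
  using assms
proof (induction "card S" arbitrary: S rule: less_induct)
  case less
  show ?case
  proof (cases "S = {}")
    case True
    have "z \<noteq> []" if "z \<in> Sol a" for z a using Sol_distinct[OF that] arity_ge2[of a] by auto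
    then show ?thesis using True by auto
  next
    case False
    then obtain x0 where "x0 \<in> S" by auto
    then obtain n d v j F xs where n: "n \<le> N" "d \<le> Suc l" "reach n d v j F" "realizes S v F xs"
      "explored S F xs j" and alt: "n = N \<or> j = v \<or> pot (relations F) {..<v} < 0"
      using explore[of x0 S N] by blast
    have "\<not> (n = N \<or> pot (relations F) {..<v} < 0)" using less.prems(2)[OF n(3,2,1)] n(4) by blast
    then have j: "j = v" and p: "0 \<le> pot (relations F) {..<v}" using alt by auto
    have xs: "length xs = v" "distinct xs" "set xs \<subseteq> S" using n(4) unfolding realizes_def by auto
    define E where "E = {(a, t). distinct t \<and> length t = arity a \<and> set t \<subseteq> {..<v} \<and> push t ` R a \<subseteq> relations F}"
    have "0 \<le> pot (relations F) Y" if "Y \<subseteq> {..<v}" for Y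
    proof (cases "Y = {}")
      case True then show ?thesis unfolding pot_def by simp
    next
      case False then show ?thesis using reach_pot_minimal[OF n(3) that] p by simp
    qed
    then obtain c1 :: "nat \<Rightarrow> bool" where c1: "\<And>a t. (a, t) \<in> E \<Longrightarrow> \<exists>u\<in>set t. \<exists>w\<in>set t. c1 u \<noteq> c1 w"
      using colouring[OF subspace_relations, of "{..<v}" F E] unfolding E_def by auto
    have "v \<ge> 1" using reach_bounds[OF n(3)] by auto
    then have "xs ! 0 \<in> set xs" using xs(1) by simp
    then have "S - set xs \<subset> S" using xs(3) by blast
    then have "card (S - set xs) < card S" using less.prems(1) by (intro psubset_card_mono)
    moreover have "\<not> realizes (S - set xs) v' F' xs'" if "\<not> realizes S v' F' xs'" for v' F' xs'
      using that realizes_subset by blast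
    ultimately obtain c2 :: "int \<Rightarrow> bool" where
      c2: "\<And>a z. z \<in> Sol a \<Longrightarrow> set z \<subseteq> S - set xs \<Longrightarrow> \<exists>x\<in>set z. \<exists>y\<in>set z. c2 x \<noteq> c2 y"
      using less.hyps[of "S - set xs"] less.prems by (metis finite_Diff)
    define clr where "clr x = (if x \<in> set xs then c1 (inv_into {..<v} ((!) xs) x) else c2 x)" for x
    have inj: "inj_on ((!) xs) {..<v}" by (rule inj_on_nth[OF xs(2)]) (use xs in auto)
    have clr_nth: "clr (xs ! u) = c1 u" if "u < v" for u
      unfolding clr_def using inv_into_f_f[OF inj, of u] that xs(1) by auto
    have "\<exists>x\<in>set z. \<exists>y\<in>set z. clr x \<noteq> clr y" if z: "z \<in> Sol a" "set z \<subseteq> S" for a z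
    proof (cases "set z \<inter> set xs = {}")
      case True
      then obtain x y where "x \<in> set z" "y \<in> set z" "c2 x \<noteq> c2 y" using c2[OF z(1)] z(2) by blast
      moreover have "x \<notin> set xs" "y \<notin> set xs" using calculation True by auto
      ultimately show ?thesis unfolding clr_def by (intro bexI[of _ x] bexI[of _ y]) auto
    next
      case False
      then obtain x where x: "x \<in> set z" "x \<in> set xs" by blast
      then obtain i where "i < v" "xs ! i \<in> set z" using xs(1) by (metis in_set_conv_nth)
      then have "absorbed F xs a z" using n(5) z unfolding explored_def j by blast
      then obtain t where t: "set t \<subseteq> {..<v}" "map ((!) xs) t = z" "push t ` R a \<subseteq> relations F"
        using xs(1) unfolding absorbed_def by auto
      have "distinct (map ((!) xs) t)" "length (map ((!) xs) t) = arity a"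
        unfolding t(2) using Sol_distinct[OF z(1)] by auto
      then have "distinct t" "length t = arity a" unfolding distinct_map length_map by blast+
      then have "(a, t) \<in> E" using t unfolding E_def by auto
      then obtain u w where uw: "u \<in> set t" "w \<in> set t" "c1 u \<noteq> c1 w" using c1 by blast
      then have "u < v" "w < v" using t(1) by blast+
      then have "clr (xs ! u) \<noteq> clr (xs ! w)" using clr_nth uw(3) by simp
      moreover have "xs ! u \<in> set z" "xs ! w \<in> set z" using uw t(2) by auto
      ultimately show ?thesis by blast
    qed
    then show ?thesis by (intro exI[of _ clr] allI ballI impI)
  qed
qed

end

section \<open>Counting solutions\<close>

text \<open>Choose the coordinates from left to right. A coordinate forced by the earlier ones is
  determined, because differences of solutions satisfy the relation; any other has at most
  \<open>n\<close> values. The nullity counts the forced coordinates.\<close>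

lemma card_solutions_le:
  assumes L: "fv.subspace L"
    and "X \<subseteq> {xs. length xs = v \<and> set xs \<subseteq> {1..int n}}"
    and "\<And>xs ys \<rho>. xs \<in> X \<Longrightarrow> ys \<in> X \<Longrightarrow> \<rho> \<in> L \<Longrightarrow> \<rho> \<in> supported {..<v} \<Longrightarrow>
      (\<Sum>i<v. \<rho> i * (rat_of_int (xs ! i) - rat_of_int (ys ! i))) = 0"
  shows "card X \<le> n ^ (v - nullity L {..<v})"
  using assms(2,3)
proof (induction v arbitrary: X)
  case 0
  then have "X \<subseteq> {[]}" by auto
  then have "card X \<le> card {[] :: int list}" by (intro card_mono) auto
  then show ?case by simp
next
  case (Suc v)
  define X' where "X' = butlast ` X"
  have len: "length xs = Suc v" "set xs \<subseteq> {1..int n}" if "xs \<in> X" for xs using that Suc.prems(1) by auto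
  have finX: "finite X"
    by (rule finite_subset[OF Suc.prems(1)]) (use finite_lists_length_eq[of "{1..int n}" "Suc v"] in \<open>simp add: conj_commute\<close>)
  have nth_bl: "butlast xs ! i = xs ! i" if "xs \<in> X" "i < v" for xs i
    using that len nth_butlast[of i xs] by auto
  have IH: "card X' \<le> n ^ (v - nullity L {..<v})"
  proof (rule Suc.IH)
    show "X' \<subseteq> {xs. length xs = v \<and> set xs \<subseteq> {1..int n}}"
    proof
      fix ys assume "ys \<in> X'"
      then obtain xs where "xs \<in> X" "ys = butlast xs" unfolding X'_def by auto
      then show "ys \<in> {xs. length xs = v \<and> set xs \<subseteq> {1..int n}}"
        using len[of xs] by (auto dest: in_set_butlastD)
    qed
    fix xs' ys' \<rho> assume a: "xs' \<in> X'" "ys' \<in> X'" "\<rho> \<in> L" "\<rho> \<in> supported {..<v}"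
    then obtain xs ys where xy: "xs \<in> X" "xs' = butlast xs" "ys \<in> X" "ys' = butlast ys"
      unfolding X'_def by auto
    have "\<rho> \<in> supported {..<Suc v}" using a(4) supported_mono[of "{..<v}" "{..<Suc v}"] by auto
    then have "(\<Sum>i<Suc v. \<rho> i * (rat_of_int (xs ! i) - rat_of_int (ys ! i))) = 0"
      using Suc.prems(2)[OF xy(1,3) a(3)] by blast
    moreover have "\<rho> v = 0" using a(4) unfolding supported_def by auto
    ultimately have "(\<Sum>i<v. \<rho> i * (rat_of_int (xs ! i) - rat_of_int (ys ! i))) = 0" by simp
    then show "(\<Sum>i<v. \<rho> i * (rat_of_int (xs' ! i) - rat_of_int (ys' ! i))) = 0"
      using xy nth_bl by simp
  qed
  have le: "nullity L {..<v} \<le> v" using nullity_le_card[of "{..<v}" L] by simp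
  have step: "nullity L {..<Suc v} = nullity L {..<v} + (if forced L {..<v} v then 1 else 0)"
    using nullity_insert[OF L, of "{..<v}" v] by (simp add: lessThan_Suc)
  show ?case
  proof (cases "forced L {..<v} v")
    case True
    then obtain \<rho> where \<rho>: "\<rho> \<in> L" "\<rho> \<in> supported {..<Suc v}" "\<rho> v \<noteq> 0"
      unfolding forced_def by (auto simp: lessThan_Suc)
    have "inj_on butlast X"
    proof (rule inj_onI)
      fix xs ys assume xy: "xs \<in> X" "ys \<in> X" "butlast xs = butlast ys"
      have "xs ! i = ys ! i" if "i < v" for i using nth_bl[OF xy(1) that] nth_bl[OF xy(2) that] xy(3) by simp
      moreover have "(\<Sum>i<Suc v. \<rho> i * (rat_of_int (xs ! i) - rat_of_int (ys ! i))) = 0"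
        using Suc.prems(2)[OF xy(1,2) \<rho>(1,2)] .
      ultimately have "xs ! v = ys ! v" using \<rho>(3) by simp
      moreover have ne: "xs \<noteq> []" "ys \<noteq> []" using len[OF xy(1)] len[OF xy(2)] by auto
      moreover have "xs ! v = last xs" "ys ! v = last ys"
        using len[OF xy(1)] len[OF xy(2)] ne by (simp_all add: last_conv_nth)
      ultimately show "xs = ys" using xy(3) by (metis append_butlast_last_id)
    qed
    then have "card X = card X'" unfolding X'_def by (simp add: card_image)
    then show ?thesis using IH step True by simp
  next
    case False
    have "X \<subseteq> (\<lambda>(ys, x). ys @ [x]) ` (X' \<times> {1..int n})"
    proof
      fix xs assume x: "xs \<in> X"
      then have "xs \<noteq> []" using len by fastforce
      then have eq: "xs = (\<lambda>(ys, x). ys @ [x]) (butlast xs, last xs)" and "last xs \<in> set xs" by auto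
      moreover have "set xs \<subseteq> {1..int n}" using len[OF x] by blast
      ultimately have "(butlast xs, last xs) \<in> X' \<times> {1..int n}" using x unfolding X'_def by blast
      with eq show "xs \<in> (\<lambda>(ys, x). ys @ [x]) ` (X' \<times> {1..int n})" by (rule image_eqI)
    qed
    moreover have finP: "finite (X' \<times> {1..int n})" using finX unfolding X'_def by auto
    ultimately have "card X \<le> card (X' \<times> {1..int n})"
      using card_mono[of "(\<lambda>(ys, x). ys @ [x]) ` (X' \<times> {1..int n})" X]
        card_image_le[OF finP, of "\<lambda>(ys, x). ys @ [x]"] by force
    also have "\<dots> = card X' * n" by (simp add: card_cartesian_product)
    also have "\<dots> \<le> n ^ (v - nullity L {..<v}) * n" using IH by (intro mult_right_mono) auto
    also have "\<dots> = n ^ (Suc v - nullity L {..<v})" using le by (simp add: Suc_diff_le)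
    finally show ?thesis using step False by simp
  qed
qed

lemma prob_subset_random:
  assumes "0 \<le> q" "q \<le> 1" "U \<subseteq> {1..int n}"
  shows "measure_pmf.prob (random_subset n q) {S. U \<subseteq> S} = q ^ card U"
proof -
  define Q where "Q = Pi_pmf {1..int n} False (\<lambda>_. bernoulli_pmf q)"
  have "measure_pmf.prob (random_subset n q) {S. U \<subseteq> S} =
      measure_pmf.prob Q {f. U \<subseteq> {i \<in> {1..int n}. f i}}"
    unfolding random_subset_def Q_def by (simp add: vimage_def)
  also have "{f. U \<subseteq> {i \<in> {1..int n}. f i}} = Pi {1..int n} (\<lambda>i. if i \<in> U then {True} else UNIV)"
    using assms(3) by (auto simp: Pi_def)
  also have "measure_pmf.prob Q \<dots> =
      (\<Prod>i\<in>{1..int n}. measure_pmf.prob (bernoulli_pmf q) (if i \<in> U then {True} else UNIV))"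
    unfolding Q_def by (rule measure_Pi_pmf_Pi) simp
  also have "\<dots> = (\<Prod>i\<in>{1..int n}. if i \<in> U then q else 1)"
    using assms by (intro prod.cong) (auto simp: measure_pmf_single)
  also have "\<dots> = (\<Prod>i\<in>{1..int n} \<inter> U. q)" by (rule prod.inter_restrict[symmetric]) simp
  also have "\<dots> = q ^ card U" using assms(3) by (simp add: Int_absorb1)
  finally show ?thesis .
qed

lemma set_pmf_random_subset: "S \<in> set_pmf (random_subset n q) \<Longrightarrow> S \<subseteq> {1..int n}"
  unfolding random_subset_def by auto

lemma sum_Un_le:
  fixes g :: "'a \<Rightarrow> real"
  assumes "finite A" "finite B" "\<And>x. 0 \<le> g x"
  shows "sum g (A \<union> B) \<le> sum g A + sum g B"
  using sum.union_inter[OF assms(1,2), of g] sum_nonneg[of "A \<inter> B" g] assms(3) by simp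

text \<open>The expression is decreasing and equals 3/25 at \<open>k = 3\<close>. It bounds the
  choices of a position in a regular edge; two systems at 1/8 each give 1/4.\<close>

lemma mult_fifth_power_le: "3 \<le> k \<Longrightarrow> real k * (1 / 5) ^ (k - 1) \<le> 1 / 8"
proof (induction k rule: dec_induct)
  case (step k)
  have "real (Suc k) * (1 / 5) ^ (Suc k - 1) = (real (Suc k) / 5) * (1 / 5) ^ (k - 1)"
    using step(1) by (cases k) auto
  also have "\<dots> \<le> real k * (1 / 5) ^ (k - 1)" using step(1) by (intro mult_right_mono) auto
  finally show ?case using step by simp
qed (simp add: power2_eq_square)

section \<open>Weighted count of exploration shapes\<close>

context templates
begin

definition states :: "nat \<Rightarrow> nat \<Rightarrow> (nat \<times> nat \<times> (bool \<times> nat list) set) set" where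
  "states N d = {(v, j, F). reach N d v j F}"

text \<open>
  The factor \<open>(1 / 20) ^ v\<close> in the probability of a shape is split into \<open>(1 / 5) ^ v\<close>, which pays for
  the choices of positions in regular edges, and \<open>(1 / 4) ^ v\<close>, which pays for the moves of \<open>j\<close>.
\<close>

definition weight :: "nat \<times> nat \<times> (bool \<times> nat list) set \<Rightarrow> real" where
  "weight = (\<lambda>(v, j, F). (1 / 5) ^ v * (1 / 4) ^ j)"

lemma weight_nonneg: "0 \<le> weight s"
  unfolding weight_def by (auto split: prod.splits)

lemma reach_start: "reach 0 d v j F \<longleftrightarrow> d = 0 \<and> v = 1 \<and> j = 0 \<and> F = {}"
  using reach.start by (auto elim: reach.cases)

text \<open>A crude bound for the labels used within \<open>M\<close> moves. The product form lets
  the final estimate collect powers of \<open>M + 2\<close>.\<close>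

definition label_bound :: "nat \<Rightarrow> nat" where
  "label_bound M = (M + 2) * (arity True + arity False + 1)"

definition advance_state where
  "advance_state = (\<lambda>(v, j, F :: (bool \<times> nat list) set). (v :: nat, Suc j, F))"

definition regular_state where
  "regular_state = (\<lambda>((a, i), (v, j, F)).
     (v + (arity a - 1), j, insert (a, [v..<v + i] @ j # [v + i..<v + (arity a - 1)]) F))"

definition irregular_state where
  "irregular_state = (\<lambda>((a :: bool, t :: nat list, v' :: nat), (v :: nat, j :: nat, F)). (v', j, insert (a, t) F))"

definition irregular_choices :: "nat \<Rightarrow> (bool \<times> nat list \<times> nat) set" where
  "irregular_choices M = (SIGMA a : UNIV. {t. set t \<subseteq> {..<label_bound M} \<and> length t = arity a} \<times> {..<label_bound M})"

text \<open>The inequality between the two vertex counts ensures that an irregular move does not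
  increase the weight, and \<open>d \<noteq> 0\<close> rules out the truncated value of
  \<open>d - 1\<close>.\<close>

definition irregular_pairs where
  "irregular_pairs M N d = {p \<in> irregular_choices M \<times> states N (d - 1).
     d \<noteq> 0 \<and> fst (snd p) \<le> snd (snd (fst p))}"

text \<open>Covering the later states by images of the earlier ones is enough, since only upper
  bounds for sums of weights are needed; the maps need not be injective.\<close>

lemma states_Suc:
  assumes "Suc N \<le> M"
  shows "states (Suc N) d \<subseteq> advance_state ` states N d \<union>
    regular_state ` ((SIGMA a : UNIV. {..<arity a}) \<times> states N d) \<union>
    irregular_state ` irregular_pairs M N d"
proof
  fix s assume "s \<in> states (Suc N) d"
  then obtain v j F where s: "s = (v, j, F)" and r: "reach (Suc N) d v j F" unfolding states_def by auto
  from r show "s \<in> advance_state ` states N d \<union>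
    regular_state ` ((SIGMA a : UNIV. {..<arity a}) \<times> states N d) \<union>
    irregular_state ` irregular_pairs M N d"
  proof (cases rule: reach.cases)
    case (advance j')
    then have "s = advance_state (v, j', F)" "(v, j', F) \<in> states N d"
      unfolding s advance_state_def states_def by auto
    then show ?thesis by blast
  next
    case (regular v' F' i a)
    then have "s = regular_state ((a, i), (v', j, F'))"
      "((a, i), (v', j, F')) \<in> (SIGMA a : UNIV. {..<arity a}) \<times> states N d"
      unfolding s regular_state_def states_def by auto
    then show ?thesis by blast
  next
    case (irregular d' v' F' t a)
    have "v < label_bound M"
    proof -
      have "v \<le> 1 + Suc N * (arity True + arity False)" using reach_bounds[OF r] by blast
      also have "\<dots> \<le> 1 + M * (arity True + arity False)" using assms by (intro add_left_mono mult_right_mono) auto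
      also have "\<dots> < label_bound M" unfolding label_bound_def by (simp add: algebra_simps)
      finally show ?thesis .
    qed
    moreover have un: "set t \<union> {..<v'} = {..<v}" by fact
    then have "set t \<subseteq> {..<v}" by blast
    moreover have "length t = arity a" by fact
    ultimately have "(a, t, v) \<in> irregular_choices M" unfolding irregular_choices_def by auto
    moreover have "v' \<le> v" using un by (metis Un_upper2 lessThan_subset_iff)
    moreover have "reach N d' v' j F'" "d = Suc d'" "F = insert (a, t) F'" by fact+
    ultimately have "((a, t, v), (v', j, F')) \<in> irregular_pairs M N d"
      unfolding irregular_pairs_def states_def by simp
    moreover have "s = irregular_state ((a, t, v), (v', j, F'))"
      unfolding s irregular_state_def \<open>F = insert (a, t) F'\<close> by simp
    ultimately show ?thesis by blast
  qed
qed


lemma finite_irregular_choices: "finite (irregular_choices M)"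
  unfolding irregular_choices_def by (intro finite_SigmaI finite_cartesian_product finite_lists_length_eq) auto

lemma card_irregular_choices: "card (irregular_choices M) \<le> 2 * label_bound M ^ (arity True + arity False + 1)"
proof -
  have k1: "1 \<le> label_bound M" unfolding label_bound_def by simp
  have "card (irregular_choices M) = (\<Sum>a\<in>UNIV. label_bound M ^ arity a * label_bound M)"
    unfolding irregular_choices_def
    by (subst card_SigmaI) (auto simp: card_cartesian_product card_lists_length_eq finite_lists_length_eq)
  also have "\<dots> \<le> (\<Sum>a\<in>(UNIV :: bool set). label_bound M ^ (arity True + arity False + 1))"
  proof (rule sum_mono)
    fix a :: bool
    have "label_bound M ^ (arity a + 1) \<le> label_bound M ^ (arity True + arity False + 1)"
      by (rule power_increasing[OF _ k1]) (cases a; simp)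
    then show "label_bound M ^ arity a * label_bound M \<le> label_bound M ^ (arity True + arity False + 1)" by simp
  qed
  finally show ?thesis by (simp add: UNIV_bool)
qed

lemma finite_states: "finite (states N d)"
proof (induction N arbitrary: d)
  case 0
  have "states 0 d \<subseteq> {(1, 0, {})}" unfolding states_def by (auto simp: reach_start)
  then show ?case using finite_subset by blast
next
  case (Suc N)
  have "finite (irregular_pairs (Suc N) N d)"
    unfolding irregular_pairs_def using Suc finite_irregular_choices by simp
  then show ?case
    by (intro finite_subset[OF states_Suc[OF order_refl]]) (simp add: Suc)
qed

definition total_weight :: "nat \<Rightarrow> nat \<Rightarrow> real" where
  "total_weight N d = (\<Sum>s\<in>states N d. weight s)"

lemma total_weight_nonneg: "0 \<le> total_weight N d"
  unfolding total_weight_def by (intro sum_nonneg weight_nonneg)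

lemma regular_weight_le: "(\<Sum>(a, i)\<in>(SIGMA a : UNIV. {..<arity a}). (1 / 5 :: real) ^ (arity a - 1)) \<le> 1 / 4"
proof -
  have "(\<Sum>(a, i)\<in>(SIGMA a : UNIV. {..<arity a}). (1 / 5 :: real) ^ (arity a - 1)) =
      (\<Sum>a\<in>UNIV. real (arity a) * (1 / 5) ^ (arity a - 1))"
    by (subst sum.Sigma[symmetric]) auto
  also have "\<dots> \<le> (\<Sum>a\<in>(UNIV :: bool set). 1 / 8)"
    by (intro sum_mono mult_fifth_power_le arity_ge3)
  finally show ?thesis by (simp add: UNIV_bool)
qed

text \<open>Advancing \<open>j\<close> contributes a factor 1/4, and all regular moves together
  contribute at most 1/4. An irregular move need not reduce the weight and pays with its number of
  choices, but it uses up one unit of \<open>d\<close>.\<close>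

lemma total_weight_Suc:
  assumes "Suc N \<le> M"
  shows "total_weight (Suc N) d \<le> 1 / 2 * total_weight N d +
    (if d = 0 then 0 else real (card (irregular_choices M)) * total_weight N (d - 1))"
proof -
  let ?A = "advance_state ` states N d"
  let ?Q = "(SIGMA a : UNIV. {..<arity a}) \<times> states N d"
  let ?R = "regular_state ` ?Q"
  let ?I = "irregular_state ` irregular_pairs M N d"
  have fI: "finite (irregular_pairs M N d)"
    unfolding irregular_pairs_def using finite_states finite_irregular_choices by simp
  have fR: "finite ?Q" using finite_states by simp
  have "total_weight (Suc N) d \<le> sum weight (?A \<union> ?R \<union> ?I)"
    unfolding total_weight_def
    using states_Suc[OF assms, of d] finite_states fR fI weight_nonneg by (intro sum_mono2) auto
  also have "\<dots> \<le> sum weight (?A \<union> ?R) + sum weight ?I"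
    using finite_states fR fI weight_nonneg by (intro sum_Un_le) auto
  also have "\<dots> \<le> (sum weight ?A + sum weight ?R) + sum weight ?I"
    using finite_states fR weight_nonneg by (intro add_right_mono sum_Un_le) auto
  also have "sum weight ?A \<le> 1 / 4 * total_weight N d"
  proof -
    have "sum weight ?A \<le> (\<Sum>s\<in>states N d. weight (advance_state s))"
      using sum_image_le[OF finite_states, where g = weight and f = advance_state] weight_nonneg by (simp add: o_def)
    also have "\<dots> = (\<Sum>s\<in>states N d. 1 / 4 * weight s)"
      by (rule sum.cong) (auto simp: weight_def advance_state_def split: prod.splits)
    finally show ?thesis unfolding total_weight_def by (simp add: sum_distrib_left)
  qed
  also have "sum weight ?R \<le> 1 / 4 * total_weight N d"
  proof -
    have "sum weight ?R \<le> (\<Sum>p\<in>?Q. weight (regular_state p))"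
      using sum_image_le[OF fR, where g = weight and f = regular_state] weight_nonneg by (simp add: o_def)
    also have "\<dots> = (\<Sum>p\<in>?Q. (\<lambda>(a, i). (1 / 5) ^ (arity a - 1)) (fst p) * weight (snd p))"
      by (rule sum.cong) (auto simp: weight_def regular_state_def power_add split: prod.splits)
    also have "\<dots> = (\<Sum>q\<in>(SIGMA a : UNIV. {..<arity a}). \<Sum>s\<in>states N d. (\<lambda>(a, i). (1 / 5) ^ (arity a - 1)) q * weight s)"
      by (subst sum.cartesian_product) (auto intro!: sum.cong)
    also have "\<dots> = (\<Sum>(a, i)\<in>(SIGMA a : UNIV. {..<arity a}). (1 / 5) ^ (arity a - 1)) * total_weight N d"
      unfolding total_weight_def by (simp add: sum_product)
    also have "\<dots> \<le> 1 / 4 * total_weight N d"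
      by (intro mult_right_mono regular_weight_le total_weight_nonneg)
    finally show ?thesis .
  qed
  also have "sum weight ?I \<le> (if d = 0 then 0 else real (card (irregular_choices M)) * total_weight N (d - 1))"
  proof (cases "d = 0")
    case True
    then show ?thesis unfolding irregular_pairs_def by simp
  next
    case False
    have "sum weight ?I \<le> (\<Sum>p\<in>irregular_pairs M N d. weight (irregular_state p))"
      using sum_image_le[OF fI, where g = weight and f = irregular_state] weight_nonneg by (simp add: o_def)
    also have "\<dots> \<le> (\<Sum>p\<in>irregular_pairs M N d. weight (snd p))"
    proof (rule sum_mono)
      fix p assume p: "p \<in> irregular_pairs M N d"
      obtain a t v' v j F where pe: "p = ((a, t, v'), (v, j, F))" by (metis surj_pair)
      have "v \<le> v'" using p unfolding pe irregular_pairs_def by simp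
      then have "(1 / 5 :: real) ^ v' \<le> (1 / 5) ^ v" by (intro power_decreasing) auto
      then show "weight (irregular_state p) \<le> weight (snd p)"
        unfolding pe irregular_state_def weight_def by (simp add: mult_right_mono)
    qed
    also have "\<dots> \<le> (\<Sum>p\<in>irregular_choices M \<times> states N (d - 1). weight (snd p))"
      using finite_irregular_choices finite_states weight_nonneg
      by (intro sum_mono2) (auto simp: irregular_pairs_def)
    also have "\<dots> = real (card (irregular_choices M)) * total_weight N (d - 1)"
      unfolding total_weight_def by (simp add: sum.cartesian_product' )
    finally show ?thesis using False by simp
  qed
  finally show ?thesis by simp
qed

text \<open>Pascal's rule solves the recursion: the binomial coefficient places the \<open>d\<close>
  irregular moves, and the 2 in their factor compensates for the 1/2 charged to every move.\<close>

lemma total_weight_le: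
  "N \<le> M \<Longrightarrow> total_weight N d \<le> (1 / 2) ^ N * real (N choose d) * (2 * real (card (irregular_choices M))) ^ d"
proof (induction N arbitrary: d)
  case 0
  have "states 0 d = (if d = 0 then {(1, 0, {})} else {})" unfolding states_def by (auto simp: reach_start)
  then show ?case unfolding total_weight_def weight_def by (auto split: if_splits)
next
  case (Suc N)
  define C where "C = real (card (irregular_choices M))"
  have IH: "total_weight N d' \<le> (1 / 2) ^ N * real (N choose d') * (2 * C) ^ d'" for d'
    using Suc unfolding C_def by simp
  have C0: "0 \<le> C" unfolding C_def by simp
  show ?case
  proof (cases d)
    case 0
    then show ?thesis using total_weight_Suc[OF Suc.prems, of 0] IH[of 0] by simp
  next
    case (Suc e)
    have "total_weight (Suc N) d \<le> 1 / 2 * total_weight N d + C * total_weight N e"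
      using total_weight_Suc[OF \<open>Suc N \<le> M\<close>, of d] Suc unfolding C_def by simp
    also have "\<dots> \<le> 1 / 2 * ((1 / 2) ^ N * real (N choose d) * (2 * C) ^ d) +
        C * ((1 / 2) ^ N * real (N choose e) * (2 * C) ^ e)"
      by (intro add_mono mult_left_mono IH C0) auto
    also have "\<dots> = (1 / 2) ^ Suc N * real (Suc N choose d) * (2 * C) ^ d"
      unfolding Suc by (simp add: algebra_simps)
    finally show ?thesis unfolding C_def .
  qed
qed

end

section \<open>First moment bound for bad explorations\<close>

context template_solutions
begin

text \<open>The functions annihilating the difference of two realizations form a subspace. It
  contains the pushed relations of every edge, since both realizations turn the edge into solutions
  of the same system.\<close>

lemma relations_differences:
  assumes F: "\<And>a t. (a, t) \<in> F \<Longrightarrow> length t = arity a \<and> set t \<subseteq> {..<v}"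
    and xs: "realizes S v F xs" and ys: "realizes S v F ys" and \<rho>: "\<rho> \<in> relations F"
  shows "(\<Sum>i<v. \<rho> i * (rat_of_int (xs ! i) - rat_of_int (ys ! i))) = 0"
proof -
  define D where "D i = rat_of_int (xs ! i) - rat_of_int (ys ! i)" for i
  define Z where "Z = {\<rho>. (\<Sum>i<v. \<rho> i * D i) = 0}"
  have "fv.subspace Z"
    unfolding Z_def by (rule fv.subspaceI)
      (auto simp: algebra_simps sum.distrib sum_distrib_left[symmetric])
  moreover have "push t \<sigma> \<in> Z" if at: "(a, t) \<in> F" and \<sigma>: "\<sigma> \<in> R a" for a t \<sigma>
  proof -
    have len: "length t = arity a" and st: "set t \<subseteq> {..<v}" using F[OF at] by auto
    have "(\<Sum>i<v. push t \<sigma> i * D i) = (\<Sum>i<v. \<Sum>m<arity a. if t ! m = i then \<sigma> m * D i else 0)"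
      unfolding push_def len by (intro sum.cong refl) (auto simp: sum_distrib_right intro!: sum.cong)
    also have "\<dots> = (\<Sum>m<arity a. \<Sum>i<v. if t ! m = i then \<sigma> m * D i else 0)" by (rule sum.swap)
    also have "\<dots> = (\<Sum>m<arity a. \<sigma> m * D (t ! m))"
    proof (rule sum.cong[OF refl])
      fix m assume "m \<in> {..<arity a}"
      then have "t ! m < v" using st len by (metis lessThan_iff nth_mem subsetD)
      then show "(\<Sum>i<v. if t ! m = i then \<sigma> m * D i else 0) = \<sigma> m * D (t ! m)" by simp
    qed
    also have "\<dots> = (\<Sum>m<arity a. \<sigma> m * (rat_of_int (map ((!) xs) t ! m) - rat_of_int (map ((!) ys) t ! m)))"
      unfolding D_def using len by (intro sum.cong) auto
    also have "\<dots> = 0"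
      using xs ys at \<sigma> by (intro Sol_relations[where a = a]) (auto simp: realizes_def)
    finally show ?thesis unfolding Z_def by simp
  qed
  ultimately have "relations F \<subseteq> Z" unfolding relations_def by (intro fv.span_minimal) auto
  then show ?thesis using \<rho> unfolding Z_def D_def by auto
qed

lemma realizes_lists: "{xs. realizes {1..int n} v F xs} \<subseteq> {xs. length xs = v \<and> set xs \<subseteq> {1..int n}}"
  unfolding realizes_def by auto

lemma finite_realizes: "finite {xs. realizes {1..int n} v F xs}"
  using finite_subset[OF realizes_lists] finite_lists_length_eq[of "{1..int n}" v]
  by (simp add: conj_commute)

lemma card_realizes_le:
  assumes "reach N d v j F"
  shows "card {xs. realizes {1..int n} v F xs} \<le> n ^ (v - nullity (relations F) {..<v})"
proof (rule card_solutions_le[OF subspace_relations realizes_lists])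
  fix xs ys \<rho> assume "xs \<in> {xs. realizes {1..int n} v F xs}" "ys \<in> {xs. realizes {1..int n} v F xs}" "\<rho> \<in> relations F"
  then show "(\<Sum>i<v. \<rho> i * (rat_of_int (xs ! i) - rat_of_int (ys ! i))) = 0"
    using relations_differences[of F v "{1..int n}" xs ys \<rho>] reach_edges[OF assms] by auto
qed

text \<open>With \<open>r\<close> the nullity there are at most \<open>n ^ (v - r)\<close>
  realizations, each present with probability \<open>q ^ v\<close>. The exponent of \<open>n\<close>
  is \<open>v - r - v * (K - l) / K\<close>, which is the potential divided by
  \<open>K\<close>.\<close>

lemma prob_state_le:
  assumes r: "reach N d v j F" and n: "1 \<le> n" and q: "0 \<le> q" "q \<le> 1"
    "q \<le> 1 / 20 * real n powr (- ((real K - real l) / real K))"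
  shows "measure_pmf.prob (random_subset n q) {S. \<exists>xs. realizes {1..int n} v F xs \<and> set xs \<subseteq> S}
    \<le> weight (v, j, F) * real n powr (of_int (pot (relations F) {..<v}) / real K)"
proof -
  define X where "X = {xs. realizes {1..int n} v F xs}"
  define r where "r = nullity (relations F) {..<v}"
  have rv: "r \<le> v" unfolding r_def using nullity_le_card[of "{..<v}"] by simp
  have jv: "j \<le> v" using reach_bounds[OF assms(1)] by auto
  have K: "0 < real K" using l_less by simp
  have "{S. \<exists>xs. realizes {1..int n} v F xs \<and> set xs \<subseteq> S} = (\<Union>xs\<in>X. {S. set xs \<subseteq> S})"
    unfolding X_def by auto
  then have "measure_pmf.prob (random_subset n q) {S. \<exists>xs. realizes {1..int n} v F xs \<and> set xs \<subseteq> S}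
      \<le> (\<Sum>xs\<in>X. measure_pmf.prob (random_subset n q) {S. set xs \<subseteq> S})"
    using measure_UNION_le[of X "\<lambda>xs. {S. set xs \<subseteq> S}" "measure_pmf (random_subset n q)"] finite_realizes
    unfolding X_def by simp
  also have "\<dots> = (\<Sum>xs\<in>X. q ^ v)"
  proof (rule sum.cong[OF refl])
    fix xs assume "xs \<in> X"
    then have "set xs \<subseteq> {1..int n}" "card (set xs) = v"
      unfolding X_def realizes_def by (auto simp: distinct_card)
    then show "measure_pmf.prob (random_subset n q) {S. set xs \<subseteq> S} = q ^ v"
      using prob_subset_random[OF q(1,2), of "set xs" n] by simp
  qed
  also have "\<dots> = real (card X) * q ^ v" by simp
  also have "\<dots> \<le> real n ^ (v - r) * (1 / 20 * real n powr (- ((real K - real l) / real K))) ^ v"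
  proof (intro mult_mono power_mono q)
    show "real (card X) \<le> real n ^ (v - r)"
      using card_realizes_le[OF assms(1), of n] unfolding X_def r_def by (metis of_nat_le_iff of_nat_power)
  qed (use q in auto)
  also have "\<dots> = (1 / 20) ^ v * (real n powr (real v - real r) * real n powr (- ((real K - real l) / real K) * real v))"
  proof -
    have "real n ^ (v - r) = real n powr (real v - real r)"
      using n rv by (simp add: powr_realpow[symmetric] of_nat_diff)
    moreover have "(real n powr (- ((real K - real l) / real K))) ^ v = real n powr (- ((real K - real l) / real K) * real v)"
      using n by (simp add: powr_powr flip: powr_realpow)
    ultimately show ?thesis by (simp only: power_mult_distrib mult_ac)
  qed
  also have "real n powr (real v - real r) * real n powr (- ((real K - real l) / real K) * real v) =
      real n powr (of_int (pot (relations F) {..<v}) / real K)"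
  proof -
    have "real v - real r + - ((real K - real l) / real K) * real v = of_int (pot (relations F) {..<v}) / real K"
      unfolding pot_def r_def[symmetric] using K by (simp add: field_simps)
    then show ?thesis by (simp add: powr_add[symmetric])
  qed
  also have "(1 / 20 :: real) ^ v = (1 / 5) ^ v * (1 / 4) ^ v" by (simp flip: power_mult_distrib)
  also have "(1 / 5 :: real) ^ v * (1 / 4) ^ v \<le> weight (v, j, F)"
    unfolding weight_def using jv by (auto intro!: mult_left_mono power_decreasing)
  finally show ?thesis by (simp add: mult_right_mono)
qed

definition colourable :: "int set \<Rightarrow> bool" where
  "colourable S \<longleftrightarrow> (\<exists>clr :: int \<Rightarrow> bool. \<forall>a. \<forall>z\<in>Sol a. set z \<subseteq> S \<longrightarrow> (\<exists>x\<in>set z. \<exists>y\<in>set z. clr x \<noteq> clr y))"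

text \<open>Union bound over the structures excluded in \<open>exists_colouring\<close>. A negative
  potential is an integer, hence at most -1 and worth \<open>n powr (- 1 / K)\<close>. At length
  \<open>M\<close> only the bound \<open>l < K\<close> on the potential is available, which costs a
  factor \<open>n\<close>.\<close>

lemma prob_not_colourable_le:
  assumes n: "1 \<le> n" and q: "0 \<le> q" "q \<le> 1" "q \<le> 1 / 20 * real n powr (- ((real K - real l) / real K))"
  shows "measure_pmf.prob (random_subset n q) {S. \<not> colourable S} \<le>
    (\<Sum>d\<le>Suc l. \<Sum>N\<le>M. total_weight N d * (real n powr (- 1 / real K) + (if N = M then real n else 0)))"
proof -
  define bad where "bad N s \<longleftrightarrow> N = M \<or> (case s of (v, j, F) \<Rightarrow> pot (relations F) {..<v} < 0)"
    for N and s :: "nat \<times> nat \<times> (bool \<times> nat list) set"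
  define Ev where "Ev s = (case s of (v, j, F) \<Rightarrow> {S. \<exists>xs. realizes {1..int n} v F xs \<and> set xs \<subseteq> S})"
    for s :: "nat \<times> nat \<times> (bool \<times> nat list) set"
  define I where "I = (SIGMA d : {..Suc l}. SIGMA N : {..M}. {s \<in> states N d. bad N s})"
  define h where "h N = real n powr (- 1 / real K) + (if N = M then real n else 0)" for N
  have K: "0 < real K" using l_less by simp
  have finI: "finite I" unfolding I_def using finite_states by (intro finite_SigmaI) auto
  have sub: "{S. \<not> colourable S} \<inter> set_pmf (random_subset n q) \<subseteq> (\<Union>i\<in>I. Ev (snd (snd i)))"
  proof
    fix S assume S: "S \<in> {S. \<not> colourable S} \<inter> set_pmf (random_subset n q)"
    then have S1: "S \<subseteq> {1..int n}" using set_pmf_random_subset by blast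
    then have fin: "finite S" by (rule finite_subset) simp
    have nc: "\<not> colourable S" using S by blast
    have "\<not> (\<forall>N d v j F xs. reach N d v j F \<longrightarrow> d \<le> Suc l \<longrightarrow> N \<le> M \<longrightarrow>
        N = M \<or> pot (relations F) {..<v} < 0 \<longrightarrow> \<not> realizes S v F xs)"
    proof
      assume H: "\<forall>N d v j F xs. reach N d v j F \<longrightarrow> d \<le> Suc l \<longrightarrow> N \<le> M \<longrightarrow>
        N = M \<or> pot (relations F) {..<v} < 0 \<longrightarrow> \<not> realizes S v F xs"
      have "colourable S" unfolding colourable_def
        by (rule exists_colouring[where N = M, OF fin]) (rule H[rule_format])
      then show False using nc by blast
    qed
    then obtain N d v j F xs where st: "reach N d v j F" "d \<le> Suc l" "N \<le> M"
      "N = M \<or> pot (relations F) {..<v} < 0" "realizes S v F xs"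
      by blast
    have "(d, N, (v, j, F)) \<in> I" unfolding I_def bad_def states_def using st by auto
    moreover have "S \<in> Ev (v, j, F)"
      unfolding Ev_def using realizes_subset[OF st(5) S1] st(5) by (auto simp: realizes_def)
    ultimately show "S \<in> (\<Union>i\<in>I. Ev (snd (snd i)))" by (intro UN_I) auto
  qed
  have "measure_pmf.prob (random_subset n q) {S. \<not> colourable S} =
      measure_pmf.prob (random_subset n q) ({S. \<not> colourable S} \<inter> set_pmf (random_subset n q))"
    by (rule measure_Int_set_pmf[symmetric])
  also have "\<dots> \<le> measure_pmf.prob (random_subset n q) (\<Union>i\<in>I. Ev (snd (snd i)))"
    using sub by (intro measure_pmf.finite_measure_mono) auto
  also have "\<dots> \<le> (\<Sum>i\<in>I. measure_pmf.prob (random_subset n q) (Ev (snd (snd i))))"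
    using finI by (intro measure_UNION_le) auto
  also have "\<dots> \<le> (\<Sum>i\<in>I. weight (snd (snd i)) * h (fst (snd i)))"
  proof (rule sum_mono)
    fix i assume i: "i \<in> I"
    obtain d N v j F where ie: "i = (d, N, (v, j, F))" by (metis surj_pair)
    have r: "reach N d v j F" and b: "N = M \<or> pot (relations F) {..<v} < 0"
      using i unfolding ie I_def states_def bad_def by auto
    have "measure_pmf.prob (random_subset n q) (Ev (v, j, F)) \<le>
        weight (v, j, F) * real n powr (of_int (pot (relations F) {..<v}) / real K)"
      unfolding Ev_def using prob_state_le[OF r n q] by simp
    also have "real n powr (of_int (pot (relations F) {..<v}) / real K) \<le> h N"
    proof (cases "pot (relations F) {..<v} < 0")
      case True
      then have "real_of_int (pot (relations F) {..<v}) \<le> - 1" by linarith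
      then have "real n powr (of_int (pot (relations F) {..<v}) / real K) \<le> real n powr (- 1 / real K)"
        using n K by (intro powr_mono divide_right_mono) auto
      also have "\<dots> \<le> h N" unfolding h_def by simp
      finally show ?thesis .
    next
      case False
      have "pot (relations F) {..<v} \<le> int K" using reach_pot[OF r] l_less by simp
      then have "real_of_int (pot (relations F) {..<v}) \<le> real K" by linarith
      then have "real n powr (of_int (pot (relations F) {..<v}) / real K) \<le> real n powr 1"
        using n K by (intro powr_mono) auto
      also have "\<dots> \<le> h N" using False b n unfolding h_def by simp
      finally show ?thesis .
    qed
    finally show "measure_pmf.prob (random_subset n q) (Ev (snd (snd i))) \<le> weight (snd (snd i)) * h (fst (snd i))"
      unfolding ie using weight_nonneg by (simp add: mult_left_mono)
  qed
  also have "\<dots> = (\<Sum>d\<le>Suc l. \<Sum>N\<le>M. \<Sum>s\<in>{s \<in> states N d. bad N s}. weight s * h N)"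
  proof -
    have "(\<Sum>d\<le>Suc l. \<Sum>N\<le>M. \<Sum>s\<in>{s \<in> states N d. bad N s}. weight s * h N) =
        (\<Sum>d\<le>Suc l. \<Sum>(N, s)\<in>(SIGMA N : {..M}. {s \<in> states N d. bad N s}). weight s * h N)"
      using finite_states by (intro sum.cong[OF refl] sum.Sigma) auto
    also have "\<dots> = (\<Sum>(d, (N, s))\<in>I. weight s * h N)"
      unfolding I_def using finite_states by (intro sum.Sigma) (auto intro!: finite_SigmaI)
    finally show ?thesis by (simp add: split_def)
  qed
  also have "\<dots> \<le> (\<Sum>d\<le>Suc l. \<Sum>N\<le>M. \<Sum>s\<in>states N d. weight s * h N)"
    using finite_states weight_nonneg by (intro sum_mono sum_mono2) (auto simp: h_def)
  also have "\<dots> = (\<Sum>d\<le>Suc l. \<Sum>N\<le>M. total_weight N d * h N)"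
    unfolding total_weight_def by (simp add: sum_distrib_right)
  finally show ?thesis unfolding h_def .
qed

text \<open>The factor \<open>(1 / 2) ^ N\<close> is given away for \<open>N < M\<close>; at
  \<open>N = M\<close> it pays for the extra \<open>n\<close>. What remains is polynomial in
  \<open>M\<close>, times \<open>u\<close>.\<close>

lemma sum_total_weight_le:
  fixes M :: nat and n :: real
  defines "B \<equiv> 4 * real (label_bound M) ^ (arity True + arity False + 1)"
  assumes "0 \<le> u" "0 \<le> n" "n * (1 / 2) ^ M \<le> u"
  shows "(\<Sum>d\<le>Suc l. \<Sum>N\<le>M. total_weight N d * (u + (if N = M then n else 0)))
    \<le> real (l + 2) * (real M + 2) ^ Suc l * B ^ Suc l * (real M + 2) * u"
proof -
  have B1: "1 \<le> B"
  proof -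
    have "1 \<le> real (label_bound M)" unfolding label_bound_def by simp
    then have "1 \<le> real (label_bound M) ^ (arity True + arity False + 1)" by (rule one_le_power)
    then show ?thesis unfolding B_def by linarith
  qed
  define D where "D = (real M + 2) ^ Suc l * B ^ Suc l"
  have D0: "0 \<le> D" unfolding D_def using B1 by simp
  have w: "total_weight N d \<le> (1 / 2) ^ N * D" if "N \<le> M" "d \<le> Suc l" for N d
  proof -
    have "2 * real (card (irregular_choices M)) \<le> B"
      using card_irregular_choices[of M] unfolding B_def by (simp flip: of_nat_power of_nat_mult)
    then have "(2 * real (card (irregular_choices M))) ^ d \<le> B ^ d" by (intro power_mono) auto
    also have "\<dots> \<le> B ^ Suc l" using B1 that by (intro power_increasing) auto
    finally have 1: "(2 * real (card (irregular_choices M))) ^ d \<le> B ^ Suc l" .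
    have "real (N choose d) \<le> real N ^ d"
      using binomial_le_pow2[of N d] by (metis binomial_le_pow of_nat_le_iff of_nat_power le_refl binomial_eq_0 not_le zero_le)
    also have "\<dots> \<le> (real M + 2) ^ d" using that by (intro power_mono) auto
    also have "\<dots> \<le> (real M + 2) ^ Suc l" using that by (intro power_increasing) auto
    finally have 2: "real (N choose d) \<le> (real M + 2) ^ Suc l" .
    have "total_weight N d \<le> (1 / 2) ^ N * real (N choose d) * (2 * real (card (irregular_choices M))) ^ d"
      using total_weight_le that by blast
    also have "\<dots> \<le> (1 / 2) ^ N * (real M + 2) ^ Suc l * B ^ Suc l"
      using 1 2 by (intro mult_mono) auto
    finally show ?thesis unfolding D_def by (simp add: mult.assoc)
  qed
  have "(\<Sum>N\<le>M. total_weight N d * (u + (if N = M then n else 0))) \<le> D * (real M + 2) * u"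
    if d: "d \<le> Suc l" for d
  proof -
    have "(\<Sum>N\<le>M. total_weight N d * (u + (if N = M then n else 0))) \<le>
        (\<Sum>N\<le>M. ((1 / 2) ^ N * D) * (u + (if N = M then n else 0)))"
      using w d assms(2,3) by (intro sum_mono mult_right_mono) auto
    also have "\<dots> \<le> (\<Sum>N\<le>M. D * u + (if N = M then D * u else 0))"
    proof (rule sum_mono)
      fix N
      have "(1 / 2) ^ N * D * u \<le> 1 * D * u"
        using D0 assms(2) by (intro mult_right_mono) (auto simp: power_le_one)
      moreover have "(1 / 2) ^ M * D * n \<le> D * u"
        using mult_left_mono[OF assms(4) D0] by (simp add: mult_ac)
      ultimately show "((1 / 2) ^ N * D) * (u + (if N = M then n else 0)) \<le> D * u + (if N = M then D * u else 0)"
        by (auto simp: distrib_left)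
    qed
    also have "\<dots> = D * (real M + 2) * u" by (simp add: sum.distrib algebra_simps)
    finally show ?thesis .
  qed
  then have "(\<Sum>d\<le>Suc l. \<Sum>N\<le>M. total_weight N d * (u + (if N = M then n else 0))) \<le>
      (\<Sum>d\<le>Suc l. D * (real M + 2) * u)" by (intro sum_mono) auto
  also have "\<dots> = real (l + 2) * (D * (real M + 2) * u)" by simp
  finally show ?thesis unfolding D_def by (simp add: mult_ac)
qed

lemma polylog_tendsto:
  fixes \<epsilon> :: real
  assumes "0 < \<epsilon>"
  shows "(\<lambda>n. (2 * log 2 (real n) + 3) ^ e * real n powr (- \<epsilon>)) \<longlonglongrightarrow> 0"
proof (cases "e = 0")
  case True
  have "(\<lambda>n. real n powr (- \<epsilon>)) \<longlonglongrightarrow> 0" using assms by real_asymp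
  then show ?thesis using True by simp
next
  case False
  \<comment> \<open>The decay is spread evenly over the \<open>e\<close> factors, each of which then
    tends to 0.\<close>
  define \<delta> where "\<delta> = \<epsilon> / real e"
  have \<delta>: "0 < \<delta>" unfolding \<delta>_def using assms False by simp
  have "(\<lambda>n. (2 * log 2 (real n) + 3) * real n powr (- \<delta>)) \<longlonglongrightarrow> 0"
    using \<delta> by real_asymp
  then have "(\<lambda>n. ((2 * log 2 (real n) + 3) * real n powr (- \<delta>)) ^ e) \<longlonglongrightarrow> 0 ^ e" by (rule tendsto_power)
  moreover have "((2 * log 2 (real n) + 3) * real n powr (- \<delta>)) ^ e = (2 * log 2 (real n) + 3) ^ e * real n powr (- \<epsilon>)"
    for n
  proof (cases "n = 0")
    case True then show ?thesis using False by simp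
  next
    case nz: False
    have "(real n powr (- \<delta>)) ^ e = real n powr (- \<epsilon>)"
      using nz False by (simp add: \<delta>_def powr_powr flip: powr_realpow)
    then show ?thesis by (simp add: power_mult_distrib)
  qed
  moreover have "(0 :: real) ^ e = 0" using False by simp
  ultimately show ?thesis by (simp only:)
qed

lemma prob_not_colourable_tendsto:
  assumes p: "\<And>n. 1 \<le> n \<Longrightarrow> 0 \<le> p n \<and> p n \<le> 1 \<and>
    p n \<le> 1 / 20 * real n powr (- ((real K - real l) / real K))"
  shows "(\<lambda>n. measure_pmf.prob (random_subset n (p n)) {S. \<not> colourable S}) \<longlonglongrightarrow> 0"
proof -
  define \<kappa> where "\<kappa> = arity True + arity False + 1"
  \<comment> \<open>The exponents of \<open>M + 2\<close> come from the binomial coefficient, from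
    the labels in the irregular choices, and from the sum over \<open>N\<close>.\<close>
  define e where "e = Suc l + \<kappa> * Suc l + 1"
  define A where "A = real (l + 2) * (4 * real \<kappa> ^ \<kappa>) ^ Suc l"
  \<comment> \<open>With this length \<open>(1 / 2) ^ M \<le> n powr (- 2)\<close>, so even after
    multiplication by \<open>n\<close> the bound \<open>n powr (- 1 / K)\<close> holds.\<close>
  define M where "M n = nat \<lceil>2 * log 2 (real n)\<rceil>" for n :: nat
  have K: "0 < real K" "1 \<le> real K" using l_less by auto
  have bound: "measure_pmf.prob (random_subset n (p n)) {S. \<not> colourable S} \<le>
      A * ((2 * log 2 (real n) + 3) ^ e * real n powr (- (1 / real K)))" if n: "1 \<le> n" for n
  proof -
    define u where "u = real n powr (- 1 / real K)"
    have u0: "0 \<le> u" unfolding u_def by simp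
    have log0: "0 \<le> log 2 (real n)" using n by simp
    have M1: "2 * log 2 (real n) \<le> real (M n)" unfolding M_def using log0 by linarith
    have M2: "real (M n) + 2 \<le> 2 * log 2 (real n) + 3" unfolding M_def using log0 by linarith
    have "real n * (1 / 2) ^ M n \<le> u"
    proof -
      have "(1 / 2 :: real) ^ M n = 2 powr (- real (M n))"
        by (simp add: powr_minus powr_realpow power_one_over field_simps)
      also have "\<dots> \<le> 2 powr (- (2 * log 2 (real n)))" using M1 by (intro powr_mono) auto
      also have "\<dots> = (2 powr log 2 (real n)) powr (- 2)" by (simp add: powr_powr mult.commute)
      also have "\<dots> = real n powr (- 2)" using n by simp
      finally have "real n * (1 / 2) ^ M n \<le> real n powr 1 * real n powr (- 2)"
        using n by (simp add: mult_left_mono)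
      also have "\<dots> = real n powr (1 + - 2)" by (rule powr_add[symmetric])
      also have "\<dots> = real n powr (- 1)" by simp
      also have "\<dots> \<le> u" unfolding u_def using n K by (intro powr_mono) auto
      finally show ?thesis .
    qed
    note s = sum_total_weight_le[OF u0 _ this]
    have "measure_pmf.prob (random_subset n (p n)) {S. \<not> colourable S} \<le>
       real (l + 2) * (real (M n) + 2) ^ Suc l * (4 * real (label_bound (M n)) ^ \<kappa>) ^ Suc l * (real (M n) + 2) * u"
      using prob_not_colourable_le[OF n, of "p n" "M n"] p[OF n] s
      unfolding u_def \<kappa>_def by simp
    also have "real (label_bound (M n)) = (real (M n) + 2) * real \<kappa>" unfolding label_bound_def \<kappa>_def by (simp add: algebra_simps)
    also have "real (l + 2) * (real (M n) + 2) ^ Suc l * (4 * ((real (M n) + 2) * real \<kappa>) ^ \<kappa>) ^ Suc l * (real (M n) + 2) * u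
       = A * ((real (M n) + 2) ^ e * u)"
    proof -
      have "(4 * ((real (M n) + 2) * real \<kappa>) ^ \<kappa>) ^ Suc l = (real (M n) + 2) ^ (\<kappa> * Suc l) * (4 * real \<kappa> ^ \<kappa>) ^ Suc l"
        unfolding power_mult by (simp only: power_mult_distrib mult_ac)
      moreover have "(real (M n) + 2) ^ e = (real (M n) + 2) ^ Suc l * (real (M n) + 2) ^ (\<kappa> * Suc l) * (real (M n) + 2)"
        unfolding e_def by (simp only: power_add power_one_right)
      ultimately show ?thesis unfolding A_def by (simp only: mult_ac)
    qed
    also have "\<dots> \<le> A * ((2 * log 2 (real n) + 3) ^ e * u)"
    proof -
      have "0 \<le> A" unfolding A_def by simp
      then show ?thesis using M2 u0 by (intro mult_left_mono mult_right_mono power_mono) auto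
    qed
    finally show ?thesis unfolding u_def by simp
  qed
  have "(\<lambda>n. A * ((2 * log 2 (real n) + 3) ^ e * real n powr (- (1 / real K)))) \<longlonglongrightarrow> 0"
    using tendsto_mult_right_zero[OF polylog_tendsto[of "1 / real K" e]] K by simp
  then show ?thesis
  proof (rule Lim_null_comparison[rotated])
    show "\<forall>\<^sub>F n in sequentially. norm (measure_pmf.prob (random_subset n (p n)) {S. \<not> colourable S})
        \<le> A * ((2 * log 2 (real n) + 3) ^ e * real n powr (- (1 / real K)))"
      using eventually_ge_at_top[of 1] by eventually_elim (use bound in simp)
  qed
qed

end

section \<open>Ranks of matrices\<close>

text \<open>A linear functional that vanishes on \<open>B\<close> but not at \<open>x\<close>,
  written as a dot product. Its coefficients \<open>y\<close> will serve as multipliers of the rows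
  of a matrix.\<close>

lemma separating_functional:
  assumes B: "B \<subseteq> supported {..<m}" and x: "x \<in> supported {..<m}" "x \<notin> fv.span B"
  obtains y :: "nat \<Rightarrow> rat" where "\<And>b. b \<in> B \<Longrightarrow> (\<Sum>i<m. y i * b i) = 0" "(\<Sum>i<m. y i * x i) \<noteq> 0"
proof -
  interpret r: vector_space "(*) :: rat \<Rightarrow> rat \<Rightarrow> rat"
    by unfold_locales (simp_all add: distrib_left distrib_right)
  interpret vp: vector_space_pair "\<lambda>(c::rat) (f::nat \<Rightarrow> rat) i. c * f i" "(*) :: rat \<Rightarrow> rat \<Rightarrow> rat"
    by unfold_locales
  obtain B0 where B0: "B0 \<subseteq> B" "fv.independent B0" "B \<subseteq> fv.span B0"
    using fv.maximal_independent_subset[of B] by blast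
  have xB0: "x \<notin> fv.span B0" using x(2) fv.span_mono[OF B0(1)] by blast
  then have ind: "fv.independent (insert x B0)" using B0(2) fv.independent_insert by auto
  obtain g where g: "Vector_Spaces.linear (\<lambda>(c::rat) (f::nat \<Rightarrow> rat) i. c * f i) (*) g"
    "\<forall>b\<in>insert x B0. g b = (if b = x then 1 else 0)"
    using vp.linear_independent_extend[OF ind, of "\<lambda>b. if b = x then 1 else 0"] by blast
  define e :: "nat \<Rightarrow> nat \<Rightarrow> rat" where "e i = (\<lambda>j. if j = i then 1 else 0)" for i
  have gexp: "g f = (\<Sum>i<m. g (e i) * f i)" if "f \<in> supported {..<m}" for f
  proof -
    have eq: "f = (\<Sum>i<m. (\<lambda>j. f i * e i j))"
    proof
      fix j
      have "(\<Sum>i<m. (\<lambda>j. f i * e i j)) j = (\<Sum>i<m. f i * e i j)" by (induction m) auto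
      also have "\<dots> = (\<Sum>i<m. if i = j then f j else 0)" by (rule sum.cong) (auto simp: e_def)
      also have "\<dots> = f j" using that by (auto simp: supported_def)
      finally show "f j = (\<Sum>i<m. (\<lambda>j. f i * e i j)) j" by simp
    qed
    have "g f = g (\<Sum>i<m. (\<lambda>j. f i * e i j))" using eq by (rule arg_cong)
    also have "\<dots> = (\<Sum>i<m. g (\<lambda>j. f i * e i j))" using vp.linear_sum[OF g(1)] by blast
    also have "\<dots> = (\<Sum>i<m. f i * g (e i))" by (intro sum.cong refl vp.linear_scale[OF g(1)])
    finally show ?thesis by (simp add: mult.commute)
  qed
  show thesis
  proof (rule that[of "\<lambda>i. g (e i)"])
    fix b assume b: "b \<in> B"
    have "g c = 0" if "c \<in> B0" for c
    proof -
      have "c \<noteq> x" using that xB0 fv.span_base by blast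
      then show ?thesis using g(2) that by auto
    qed
    then have "g b = 0" using vp.linear_eq_0_on_span[OF g(1), of B0 b] b B0(3) by blast
    then show "(\<Sum>i<m. g (e i) * b i) = 0" using gexp[of b] b B by auto
  next
    show "(\<Sum>i<m. g (e i) * x i) \<noteq> 0" using gexp[OF x(1)] g(2) by simp
  qed
qed

lemma dim_insert_finite:
  assumes "finite A"
  shows "fv.dim (insert x A) = fv.dim A + (if x \<in> fv.span A then 0 else 1)"
proof -
  obtain B where B: "B \<subseteq> A" "fv.independent B" "A \<subseteq> fv.span B"
    using fv.maximal_independent_subset[of A] by blast
  have sp: "fv.span B = fv.span A" using B fv.span_mono[OF B(1)] fv.span_minimal[OF B(3) fv.subspace_span] by blast
  have dB: "card B = fv.dim A" using fv.basis_card_eq_dim[OF B(1,3,2)] .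
  show ?thesis
  proof (cases "x \<in> fv.span A")
    case True
    then have "card B = fv.dim (insert x A)"
      using B sp by (intro fv.basis_card_eq_dim) auto
    then show ?thesis using True dB by simp
  next
    case False
    then have "x \<notin> B" using sp fv.span_base by blast
    have "card (insert x B) = fv.dim (insert x A)"
    proof (rule fv.basis_card_eq_dim)
      show "insert x B \<subseteq> insert x A" using B by auto
      show "insert x A \<subseteq> fv.span (insert x B)"
        using B(3) fv.span_mono[of B "insert x B"] fv.span_base[of x "insert x B"] by blast
      show "fv.independent (insert x B)" using B(2) False sp fv.independent_insert by auto
    qed
    moreover have "finite B" using B assms finite_subset by blast
    ultimately show ?thesis using False dB \<open>x \<notin> B\<close> by simp
  qed
qed

text \<open>Padding with zeros puts vectors of every dimension into one function space, so that
  ranks and nullities become dimensions in the same space.\<close>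

definition fun_of_vec :: "nat \<Rightarrow> rat vec \<Rightarrow> nat \<Rightarrow> rat" where
  "fun_of_vec m v = (\<lambda>i. if i < m then v $ i else 0)"

lemma inj_on_fun_of_vec: "inj_on (fun_of_vec m) (carrier_vec m)"
proof (rule inj_onI)
  fix v w assume vw: "v \<in> carrier_vec m" "w \<in> carrier_vec m" "fun_of_vec m v = fun_of_vec m w"
  show "v = w"
  proof (rule eq_vecI)
    show "dim_vec v = dim_vec w" using vw by simp
    fix i assume "i < dim_vec w"
    moreover have "fun_of_vec m v i = fun_of_vec m w i" using vw(3) by (rule fun_cong)
    ultimately show "v $ i = w $ i" using vw(2) by (simp add: fun_of_vec_def)
  qed
qed

lemma lin_dep_iff_dependent:
  fixes S :: "rat vec set"
  assumes fin: "finite S" and S: "S \<subseteq> carrier_vec m"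
  shows "module.lin_dep class_ring (module_vec TYPE(rat) m) S \<longleftrightarrow> fv.dependent (fun_of_vec m ` S)"
proof -
  interpret V: vec_space "TYPE(rat)" m .
  have inj: "inj_on (fun_of_vec m) S" using inj_on_fun_of_vec S by (rule inj_on_subset)
  have lc: "V.lincomb a S = 0\<^sub>v m \<longleftrightarrow> (\<Sum>v\<in>S. (\<lambda>i. a v * fun_of_vec m v i)) = 0" for a
  proof -
    have car: "V.lincomb a S \<in> carrier_vec m" using S V.lincomb_closed[of S a] by auto
    have pt: "(\<Sum>v\<in>S. (\<lambda>i. a v * fun_of_vec m v i)) j = (\<Sum>v\<in>S. a v * fun_of_vec m v j)" for j
      using fin by (induction S rule: finite_induct) auto
    have "V.lincomb a S = 0\<^sub>v m \<longleftrightarrow> (\<forall>j<m. (\<Sum>v\<in>S. a v * v $ j) = 0)"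
    proof
      assume "V.lincomb a S = 0\<^sub>v m"
      then show "\<forall>j<m. (\<Sum>v\<in>S. a v * v $ j) = 0" using V.lincomb_index[OF _ S, of _ a] by auto
    next
      assume "\<forall>j<m. (\<Sum>v\<in>S. a v * v $ j) = 0"
      then show "V.lincomb a S = 0\<^sub>v m"
        using V.lincomb_index[OF _ S, of _ a] car by (intro eq_vecI) auto
    qed
    also have "\<dots> \<longleftrightarrow> (\<forall>j. (\<Sum>v\<in>S. a v * fun_of_vec m v j) = 0)"
    proof -
      have "(\<Sum>v\<in>S. a v * fun_of_vec m v j) = (if j < m then \<Sum>v\<in>S. a v * v $ j else 0)" for j
        unfolding fun_of_vec_def by (cases "j < m") simp_all
      then show ?thesis by simp
    qed
    also have "\<dots> \<longleftrightarrow> (\<Sum>v\<in>S. (\<lambda>i. a v * fun_of_vec m v i)) = 0"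
      by (auto simp: fun_eq_iff pt)
    finally show ?thesis .
  qed
  show ?thesis
  proof
    assume "V.lin_dep S"
    then obtain a v where a: "V.lincomb a S = 0\<^sub>v m" "v \<in> S" "a v \<noteq> 0"
      using V.finite_lin_dep[OF fin _] S by auto
    define u where "u = a \<circ> inv_into S (fun_of_vec m)"
    have u: "u (fun_of_vec m w) = a w" if "w \<in> S" for w
      unfolding u_def using inv_into_f_f[OF inj that] by simp
    have "(\<Sum>f\<in>fun_of_vec m ` S. (\<lambda>i. u f * f i)) = (\<Sum>v\<in>S. (\<lambda>i. a v * fun_of_vec m v i))"
      by (subst sum.reindex[OF inj]) (auto intro!: sum.cong simp: u)
    then have "(\<Sum>f\<in>fun_of_vec m ` S. (\<lambda>i. u f * f i)) = 0" using a lc by simp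
    moreover have "\<exists>f\<in>fun_of_vec m ` S. u f \<noteq> 0" using a u by auto
    ultimately show "fv.dependent (fun_of_vec m ` S)"
      using fv.dependent_finite[of "fun_of_vec m ` S"] fin by blast
  next
    assume "fv.dependent (fun_of_vec m ` S)"
    then obtain u where u: "\<exists>f\<in>fun_of_vec m ` S. u f \<noteq> 0"
      "(\<Sum>f\<in>fun_of_vec m ` S. (\<lambda>i. u f * f i)) = 0"
      using fv.dependent_finite[of "fun_of_vec m ` S"] fin by blast
    define a where "a v = u (fun_of_vec m v)" for v
    have "(\<Sum>v\<in>S. (\<lambda>i. a v * fun_of_vec m v i)) = 0"
      using u(2) unfolding a_def by (subst (asm) sum.reindex[OF inj]) (simp add: o_def)
    then have "V.lincomb a S = 0\<^sub>v m" using lc by blast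
    moreover obtain v where "v \<in> S" "a v \<noteq> 0" using u(1) unfolding a_def by auto
    ultimately show "V.lin_dep S" unfolding V.lin_dep_def using fin
      by (intro exI[of _ S] exI[of _ a] exI[of _ v]) auto
  qed
qed

text \<open>A maximal independent set of columns has as many elements as the rank, and after padding
  it is a basis of the span of the columns.\<close>

lemma rank_eq_dim:
  fixes A :: "rat mat"
  assumes A: "A \<in> carrier_mat m nc"
  shows "vec_space.rank m A = fv.dim (fun_of_vec m ` set (cols A))"
proof -
  interpret V: vec_space "TYPE(rat)" m .
  have C: "set (cols A) \<subseteq> carrier_vec m" using A cols_dim by blast
  have "V.lin_indpt {}" using lin_dep_iff_dependent[of "{}" m] fv.independent_empty by simp
  then obtain S where S: "maximal S (\<lambda>T. T \<subseteq> set (cols A) \<and> V.lin_indpt T)"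
    using maximal_exists_superset[of "set (cols A)" "\<lambda>T. T \<subseteq> set (cols A) \<and> V.lin_indpt T" "{}"] by auto
  have SC: "S \<subseteq> set (cols A)" "V.lin_indpt S" using S unfolding maximal_def by auto
  have finS: "finite S" using SC(1) finite_subset by blast
  have Scar: "S \<subseteq> carrier_vec m" using SC(1) C by blast
  have ind: "fv.independent (fun_of_vec m ` S)"
    using SC(2) lin_dep_iff_dependent[OF finS Scar] by simp
  have "fun_of_vec m c \<in> fv.span (fun_of_vec m ` S)" if c: "c \<in> set (cols A)" for c
  proof (rule ccontr)
    assume n: "fun_of_vec m c \<notin> fv.span (fun_of_vec m ` S)"
    then have "fv.independent (fun_of_vec m ` insert c S)"
      using ind fv.independent_insert by auto
    then have "V.lin_indpt (insert c S)"
      using lin_dep_iff_dependent[of "insert c S" m] finS Scar c C by auto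
    then have "c \<in> S" using S SC c unfolding maximal_def by auto
    then have "fun_of_vec m c \<in> fv.span (fun_of_vec m ` S)" by (intro fv.span_base imageI)
    then show False using n by contradiction
  qed
  then have "card (fun_of_vec m ` S) = fv.dim (fun_of_vec m ` set (cols A))"
    using SC ind by (intro fv.basis_card_eq_dim) auto
  moreover have "card (fun_of_vec m ` S) = card S"
    using inj_on_fun_of_vec Scar by (intro card_image) (rule inj_on_subset)
  ultimately show ?thesis using V.rank_card_indpt[OF A S] by simp
qed

definition column :: "int mat \<Rightarrow> nat \<Rightarrow> nat \<Rightarrow> rat" where
  "column M j = (\<lambda>i. if i < dim_row M then rat_of_int (M $$ (i, j)) else 0)"

lemma column_supported: "column M j \<in> supported {..<dim_row M}"
  unfolding column_def supported_def by auto

lemma mrank_eq_dim: "mrank M = fv.dim (column M ` {..<dim_col M})"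
proof -
  define A where "A = map_mat rat_of_int M"
  have A: "A \<in> carrier_mat (dim_row M) (dim_col M)" unfolding A_def by simp
  have "fun_of_vec (dim_row M) (col A j) = column M j" if "j < dim_col M" for j
    using that unfolding A_def column_def fun_of_vec_def by (auto simp: fun_eq_iff)
  then have "fun_of_vec (dim_row M) ` set (cols A) = column M ` {..<dim_col M}"
    using A unfolding cols_def by (auto simp: image_image)
  then show ?thesis unfolding mrank_def using rank_eq_dim[OF A] unfolding A_def by simp
qed

lemma mrank_restrict_cols:
  assumes J: "J \<subseteq> {..<dim_col M}"
  shows "mrank (restrict_cols M J) = fv.dim (column M ` J)"
proof -
  let ?N = "restrict_cols M J"
  have JJ: "{j. j < dim_col M \<and> j \<in> J} = J" using J by auto
  have dr: "dim_row ?N = dim_row M" and dc: "dim_col ?N = card J"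
    unfolding restrict_cols_def using JJ by (simp_all add: dim_submatrix)
  have finJ: "finite J" using J finite_subset by blast
  have col: "column ?N j = column M (pick J j)" if "j < card J" for j
    unfolding column_def dr using that JJ
    by (auto simp: fun_eq_iff restrict_cols_def submatrix_index pick_UNIV)
  have "pick J ` {..<card J} = J"
  proof
    show "pick J ` {..<card J} \<subseteq> J" using pick_in_set_le by auto
    show "J \<subseteq> pick J ` {..<card J}"
    proof
      fix j assume j: "j \<in> J"
      have "card {a \<in> J. a < j} < card J" using j finJ by (intro psubset_card_mono) auto
      then show "j \<in> pick J ` {..<card J}" by (intro image_eqI[where x = "card {a \<in> J. a < j}"]) (simp_all add: pick_card_in_set[OF j])
    qed
  qed
  then have "column ?N ` {..<card J} = column M ` J" using col by (metis (no_types, lifting) image_cong image_image lessThan_iff)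
  then show ?thesis unfolding mrank_eq_dim dc by simp
qed

section \<open>Row spaces and ranks of column restrictions\<close>

definition row_space :: "int mat \<Rightarrow> (nat \<Rightarrow> rat) set" where
  "row_space M = {\<lambda>j. if j < dim_col M then \<Sum>i<dim_row M. y i * column M j i else 0 | y. True}"

lemma subspace_row_space: "fv.subspace (row_space M)"
proof (rule fv.subspaceI)
  show "0 \<in> row_space M" unfolding row_space_def by (auto intro!: exI[of _ "\<lambda>_. 0"])
  fix x y assume x: "x \<in> row_space M"
  then obtain u where u: "x = (\<lambda>j. if j < dim_col M then \<Sum>i<dim_row M. u i * column M j i else 0)"
    unfolding row_space_def by auto
  show "(\<lambda>i. c * x i) \<in> row_space M" for c
    unfolding row_space_def u
    by (rule CollectI, rule exI[of _ "\<lambda>i. c * u i"]) (auto simp: fun_eq_iff sum_distrib_left mult.assoc)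
  assume "y \<in> row_space M"
  then obtain w where w: "y = (\<lambda>j. if j < dim_col M then \<Sum>i<dim_row M. w i * column M j i else 0)"
    unfolding row_space_def by auto
  show "x + y \<in> row_space M"
    unfolding row_space_def u w
    by (rule CollectI, rule exI[of _ "\<lambda>i. u i + w i"]) (auto simp: fun_eq_iff sum.distrib distrib_right)
qed

text \<open>Duality: a combination of rows is a functional on the columns. One that vanishes at the
  columns outside \<open>insert w W\<close> but not at column \<open>w\<close> exists exactly if the
  latter is outside their span.\<close>

lemma forced_row_space:
  assumes W: "W \<subseteq> {..<dim_col M}" and w: "w < dim_col M"
  shows "forced (row_space M) W w \<longleftrightarrow>
    column M w \<notin> fv.span (column M ` ({..<dim_col M} - insert w W))"
proof
  let ?C = "column M ` ({..<dim_col M} - insert w W)"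
  assume "forced (row_space M) W w"
  then obtain y where y: "(\<lambda>j. if j < dim_col M then \<Sum>i<dim_row M. y i * column M j i else 0) \<in> supported (insert w W)"
    "(\<Sum>i<dim_row M. y i * column M w i) \<noteq> 0"
    using w unfolding forced_def row_space_def by auto
  have "fv.subspace {f. (\<Sum>i<dim_row M. y i * f i) = 0}"
    by (rule fv.subspaceI) (auto simp: algebra_simps sum.distrib sum_distrib_left[symmetric])
  moreover have "?C \<subseteq> {f. (\<Sum>i<dim_row M. y i * f i) = 0}"
    using y(1) unfolding supported_def by (auto split: if_splits)
  ultimately have "fv.span ?C \<subseteq> {f. (\<Sum>i<dim_row M. y i * f i) = 0}" by (rule fv.span_minimal[rotated])
  then show "column M w \<notin> fv.span ?C" using y(2) by auto
next
  let ?C = "column M ` ({..<dim_col M} - insert w W)"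
  assume "column M w \<notin> fv.span ?C"
  moreover have "?C \<subseteq> supported {..<dim_row M}" using column_supported by auto
  ultimately obtain y where y: "\<And>b. b \<in> ?C \<Longrightarrow> (\<Sum>i<dim_row M. y i * b i) = 0"
    "(\<Sum>i<dim_row M. y i * column M w i) \<noteq> 0"
    using separating_functional[OF _ column_supported] by blast
  define \<rho> where "\<rho> = (\<lambda>j. if j < dim_col M then \<Sum>i<dim_row M. y i * column M j i else 0)"
  have "\<rho> \<in> row_space M" unfolding \<rho>_def row_space_def by auto
  moreover have "\<rho> \<in> supported (insert w W)" using y(1) unfolding \<rho>_def supported_def by auto
  moreover have "\<rho> w \<noteq> 0" using y(2) w unfolding \<rho>_def by simp
  ultimately show "forced (row_space M) W w" unfolding forced_def by auto
qed

text \<open>Delete the columns of \<open>W\<close> one by one. Deleting \<open>w\<close> lowers the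
  rank exactly if column \<open>w\<close> is outside the span of the remaining ones, that is, if
  \<open>w\<close> is forced by the columns deleted before. This turns the ranks in both parameters
  into nullities.\<close>

lemma nullity_row_space:
  assumes "W \<subseteq> {..<dim_col M}"
  shows "nullity (row_space M) W + mrank (restrict_cols M ({..<dim_col M} - W)) = mrank M"
proof -
  have "finite W" using assms finite_subset by blast
  then have "nullity (row_space M) W + fv.dim (column M ` ({..<dim_col M} - W)) = fv.dim (column M ` {..<dim_col M})"
    using assms
  proof (induction W rule: finite_induct)
    case (insert w W)
    have "{..<dim_col M} - W = insert w ({..<dim_col M} - insert w W)" using insert by auto
    then have "column M ` ({..<dim_col M} - W) = insert (column M w) (column M ` ({..<dim_col M} - insert w W))"
      by auto
    then have "fv.dim (column M ` ({..<dim_col M} - W)) = fv.dim (column M ` ({..<dim_col M} - insert w W))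
       + (if forced (row_space M) W w then 1 else 0)"
      using dim_insert_finite[of "column M ` ({..<dim_col M} - insert w W)" "column M w"]
        forced_row_space[of W M w] insert by auto
    then show ?case using nullity_insert[OF subspace_row_space, of W w M] insert by auto
  qed simp
  then show ?thesis using mrank_restrict_cols[of "{..<dim_col M} - W" M] mrank_eq_dim[of M] by simp
qed

section \<open>The random Rado problem\<close>

lemma row_space_mult_vec:
  assumes "dim_vec x = dim_col M"
  shows "(\<Sum>j<dim_col M. (\<Sum>i<dim_row M. y i * column M j i) * rat_of_int (x $ j)) =
    (\<Sum>i<dim_row M. y i * rat_of_int ((M *\<^sub>v x) $ i))"
proof -
  have "rat_of_int ((M *\<^sub>v x) $ i) = (\<Sum>j<dim_col M. column M j i * rat_of_int (x $ j))"
    if "i < dim_row M" for i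
    using that assms by (simp add: scalar_prod_def column_def lessThan_atLeast0)
  then have "(\<Sum>i<dim_row M. y i * rat_of_int ((M *\<^sub>v x) $ i)) =
      (\<Sum>i<dim_row M. \<Sum>j<dim_col M. y i * column M j i * rat_of_int (x $ j))"
    by (simp add: sum_distrib_left mult.assoc)
  also have "\<dots> = (\<Sum>j<dim_col M. \<Sum>i<dim_row M. y i * column M j i * rat_of_int (x $ j))"
    by (rule sum.swap)
  finally show ?thesis by (simp add: sum_distrib_right)
qed

lemma row_space_solutions:
  assumes "\<rho> \<in> row_space M" "dim_vec x = dim_col M" "dim_vec x' = dim_col M" "M *\<^sub>v x = M *\<^sub>v x'"
  shows "(\<Sum>j<dim_col M. \<rho> j * (rat_of_int (x $ j) - rat_of_int (x' $ j))) = 0"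
proof -
  obtain y where \<rho>: "\<rho> = (\<lambda>j. if j < dim_col M then \<Sum>i<dim_row M. y i * column M j i else 0)"
    using assms(1) unfolding row_space_def by auto
  have "(\<Sum>j<dim_col M. \<rho> j * rat_of_int (z $ j)) = (\<Sum>i<dim_row M. y i * rat_of_int ((M *\<^sub>v z) $ i))"
    if "dim_vec z = dim_col M" for z
    unfolding row_space_mult_vec[OF that, symmetric] \<rho> by (intro sum.cong) auto
  from this[OF assms(2)] this[OF assms(3)] show ?thesis
    unfolding assms(4) right_diff_distrib sum_subtractf by simp
qed

text \<open>Row \<open>i0\<close> is scaled by its nonzero coefficient and the other rows, which
  stay unchanged, are added to it with theirs.\<close>

lemma row_operations_combination:
  assumes i0: "i0 < dim_row M" "y i0 \<noteq> 0"
  shows "\<exists>N. row_operation\<^sup>*\<^sup>* (map_mat rat_of_int M) N \<and> dim_row N = dim_row M \<and> dim_col N = dim_col M \<and>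
    (\<forall>j<dim_col M. N $$ (i0, j) = (\<Sum>i<dim_row M. y i * column M j i))"
proof -
  let ?A = "map_mat rat_of_int M"
  have "\<exists>N. row_operation\<^sup>*\<^sup>* ?A N \<and> dim_row N = dim_row M \<and> dim_col N = dim_col M \<and>
    (\<forall>j<dim_col M. N $$ (i0, j) = (\<Sum>i\<in>insert i0 I. y i * column M j i) \<and>
       (\<forall>i<dim_row M. i \<noteq> i0 \<longrightarrow> N $$ (i, j) = column M j i))"
    if "finite I" "I \<subseteq> {..<dim_row M} - {i0}" for I
    using that
  proof (induction I rule: finite_induct)
    case empty
    have "row_operation ?A (multrow i0 (y i0) ?A)" using i0 by (intro row_operation.scale) auto
    then show ?case using i0 by (intro exI[of _ "multrow i0 (y i0) ?A"]) (auto simp: column_def)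
  next
    case (insert k I)
    then obtain N where N: "row_operation\<^sup>*\<^sup>* ?A N" "dim_row N = dim_row M" "dim_col N = dim_col M"
      "\<And>j. j < dim_col M \<Longrightarrow> N $$ (i0, j) = (\<Sum>i\<in>insert i0 I. y i * column M j i)"
      "\<And>i j. j < dim_col M \<Longrightarrow> i < dim_row M \<Longrightarrow> i \<noteq> i0 \<Longrightarrow> N $$ (i, j) = column M j i" by auto
    have k: "k < dim_row M" "k \<noteq> i0" "k \<notin> insert i0 I" using insert by auto
    have "row_operation N (addrow (y k) i0 k N)" using i0 k N by (intro row_operation.add) auto
    then have "row_operation\<^sup>*\<^sup>* ?A (addrow (y k) i0 k N)" using N(1) by (rule rtranclp.rtrancl_into_rtrancl[rotated])
    moreover have "(\<Sum>i\<in>insert i0 (insert k I). y i * column M j i) =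
        y k * column M j k + (\<Sum>i\<in>insert i0 I. y i * column M j i)" for j
      using k insert.hyps by (subst insert_commute) (simp add: sum.insert)
    ultimately show ?case using N i0 k
      by (intro exI[of _ "addrow (y k) i0 k N"]) auto
  qed
  from this[of "{..<dim_row M} - {i0}"] obtain N where N: "row_operation\<^sup>*\<^sup>* ?A N" "dim_row N = dim_row M"
    "dim_col N = dim_col M" "\<forall>j<dim_col M. N $$ (i0, j) = (\<Sum>i\<in>insert i0 ({..<dim_row M} - {i0}). y i * column M j i)"
    by blast
  moreover have "insert i0 ({..<dim_row M} - {i0}) = {..<dim_row M}" using i0 by auto
  ultimately show ?thesis by (intro exI[of _ N]) simp
qed

text \<open>A nonzero relation on two unknowns annihilates a positive solution, so both its
  coefficients are nonzero. Row operations then produce it as a row with exactly two entries,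
  against \<open>property_star\<close>.\<close>

lemma nullity_pair:
  assumes irr: "irredundant M" and star: "property_star M"
    and w: "w1 < dim_col M" "w2 < dim_col M" "w1 \<noteq> w2"
  shows "nullity (row_space M) {w1, w2} = 0"
proof (rule ccontr)
  assume n: "nullity (row_space M) {w1, w2} \<noteq> 0"
  obtain B where B: "B \<subseteq> row_space M \<inter> supported {w1, w2}" "fv.independent B"
    "row_space M \<inter> supported {w1, w2} \<subseteq> fv.span B" "finite B" "card B = nullity (row_space M) {w1, w2}"
    using nullity_basis[of "{w1, w2}" "row_space M"] by blast
  then have "B \<noteq> {}" using n by auto
  then obtain \<rho> where "\<rho> \<in> B" by blast
  then have \<rho>0: "\<rho> \<noteq> 0" and \<rho>: "\<rho> \<in> row_space M" "\<rho> \<in> supported {w1, w2}"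
    using B fv.dependent_zero by auto
  obtain y where y: "\<rho> = (\<lambda>j. if j < dim_col M then \<Sum>i<dim_row M. y i * column M j i else 0)"
    using \<rho>(1) unfolding row_space_def by auto
  obtain x where x: "dim_vec x = dim_col M" "M *\<^sub>v x = 0\<^sub>v (dim_row M)" "set\<^sub>v x \<subseteq> {0<..}"
    using irr unfolding irredundant_def distinct_solution_def by auto
  have xpos: "0 < x $ j" if "j < dim_col M" for j
    using x that vec_setI[of x j] by auto
  have "(\<Sum>j<dim_col M. \<rho> j * rat_of_int (x $ j)) = (\<Sum>i<dim_row M. y i * rat_of_int ((M *\<^sub>v x) $ i))"
    unfolding row_space_mult_vec[OF x(1), symmetric] y by (intro sum.cong) auto
  also have "\<dots> = 0" unfolding x(2) by simp
  also have "(\<Sum>j<dim_col M. \<rho> j * rat_of_int (x $ j)) = (\<Sum>j\<in>{w1, w2}. \<rho> j * rat_of_int (x $ j))"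
    using \<rho>(2) w by (intro sum.mono_neutral_right) (auto simp: supported_def)
  finally have s: "\<rho> w1 * rat_of_int (x $ w1) + \<rho> w2 * rat_of_int (x $ w2) = 0" using w by simp
  have nz: "\<rho> w1 \<noteq> 0 \<and> \<rho> w2 \<noteq> 0"
  proof (rule ccontr)
    assume "\<not> ?thesis"
    then have "\<rho> w1 = 0 \<and> \<rho> w2 = 0" using s xpos[OF w(1)] xpos[OF w(2)] by auto
    then have "\<rho> v = 0" for v using \<rho>(2) unfolding supported_def by (cases "v \<in> {w1, w2}") auto
    then show False using \<rho>0 by (auto simp: fun_eq_iff)
  qed
  have "\<exists>i0<dim_row M. y i0 \<noteq> 0"
  proof (rule ccontr)
    assume "\<not> ?thesis"
    then have "\<rho> w1 = 0" unfolding y by simp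
    then show False using nz by simp
  qed
  then obtain i0 where i0: "i0 < dim_row M" "y i0 \<noteq> 0" by blast
  obtain N where N: "row_operation\<^sup>*\<^sup>* (map_mat rat_of_int M) N" "dim_row N = dim_row M" "dim_col N = dim_col M"
    "\<forall>j<dim_col M. N $$ (i0, j) = (\<Sum>i<dim_row M. y i * column M j i)"
    using row_operations_combination[of i0 M y, OF i0] by blast
  have "N $$ (i0, j) = \<rho> j" if "j < dim_col M" for j using N(4) that unfolding y by simp
  then have "{j. j < dim_col N \<and> N $$ (i0, j) \<noteq> 0} = {w1, w2}"
    using nz w \<rho>(2) unfolding N(3) supported_def by auto
  then have "card {j. j < dim_col N \<and> N $$ (i0, j) \<noteq> 0} = 2" using w by simp
  then show False using star N i0 unfolding property_star_def by auto
qed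

text \<open>A pair in \<open>W\<close> has nullity 0 and every further unknown adds at most one.
  This makes the denominators of both parameters positive.\<close>

lemma nullity_row_space_le:
  assumes "irredundant M" "property_star M" "W \<subseteq> {..<dim_col M}" "2 \<le> card W"
  shows "nullity (row_space M) W + 2 \<le> card W"
proof -
  have fin: "finite W" using assms(3) finite_subset by blast
  obtain w1 w2 where w: "w1 \<in> W" "w2 \<in> W" "w1 \<noteq> w2"
    using assms(4) card_le_Suc0_iff_eq[OF fin] by force
  have "nullity (row_space M) ({w1, w2} \<union> (W - {w1, w2})) \<le> nullity (row_space M) {w1, w2} + card (W - {w1, w2})"
    using fin by (intro nullity_diff_le subspace_row_space) auto
  moreover have "{w1, w2} \<union> (W - {w1, w2}) = W" using w by auto
  moreover have "nullity (row_space M) {w1, w2} = 0" using nullity_pair[OF assms(1,2)] w assms(3) by blast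
  moreover have "card (W - {w1, w2}) + 2 = card W"
    using w fin card_Diff_subset[of "{w1, w2}" W] assms(4) by simp
  ultimately show ?thesis by simp
qed

section \<open>The values of both parameters\<close>

lemma mrank_diff_eq:
  assumes "W \<subseteq> {..<dim_col M}"
  shows "real (mrank (restrict_cols M ({..<dim_col M} - W))) - real (mrank M) = - real (nullity (row_space M) W)"
  using nullity_row_space[OF assms] by linarith

lemma finite_image_subsets: "finite {f W | W :: nat set. W \<subseteq> {..<n} \<and> P W}"
proof -
  have "{f W | W. W \<subseteq> {..<n} \<and> P W} \<subseteq> f ` Pow {..<n}" by auto
  then show ?thesis using finite_subset by blast
qed

text \<open>Clearing denominators in \<open>(w - 1) / (w - 1 - r) \<le> K / (K - l)\<close> gives
  \<open>r * K \<le> l * (w - 1)\<close>, and equality corresponds to equality. The maximum thus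
  becomes a bound on nullities that some set attains.\<close>

lemma m_param_bound:
  assumes M: "irredundant M" "property_star M" and l: "0 < l" "l < K"
    and m: "m_param M = real K / (real K - real l)" and q: "2 \<le> dim_col M"
  shows "\<And>W. W \<subseteq> {..<dim_col M} \<Longrightarrow> 2 \<le> card W \<Longrightarrow> nullity (row_space M) W * K \<le> l * (card W - 1)"
    and "\<exists>W \<subseteq> {..<dim_col M}. 2 \<le> card W \<and> nullity (row_space M) W * K = l * (card W - 1)"
proof -
  define ratio where "ratio W = (real (card W) - 1) /
       (real (card W) - 1 + real (mrank (restrict_cols M ({..<dim_col M} - W))) - real (mrank M))" for W
  define Q where "Q = {ratio W | W. W \<subseteq> {..<dim_col M} \<and> 2 \<le> card W}"
  have finQ: "finite Q" unfolding Q_def by (rule finite_image_subsets)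
  have neQ: "Q \<noteq> {}" using q unfolding Q_def by (auto intro!: exI[of _ "{..<dim_col M}"])
  have mQ: "Max Q = real K / (real K - real l)" using m unfolding m_param_def Q_def ratio_def by simp
  have ratio_eq: "ratio W = (real (card W) - 1) / (real (card W) - 1 - real (nullity (row_space M) W))"
    and den: "0 < real (card W) - 1 - real (nullity (row_space M) W)"
    if "W \<subseteq> {..<dim_col M}" "2 \<le> card W" for W
    using mrank_diff_eq[OF that(1)] nullity_row_space_le[OF M that] unfolding ratio_def
    by (simp_all add: add_diff_eq[symmetric])
  have Kl: "0 < real K - real l" using l by simp
  show "nullity (row_space M) W * K \<le> l * (card W - 1)" if W: "W \<subseteq> {..<dim_col M}" "2 \<le> card W" for W
  proof -
    have "ratio W \<le> real K / (real K - real l)" using Max_ge[OF finQ, of "ratio W"] W mQ unfolding Q_def by auto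
    then have "(real (card W) - 1) * (real K - real l) \<le> real K * (real (card W) - 1 - real (nullity (row_space M) W))"
      unfolding ratio_eq[OF W] using den[OF W] Kl by (simp add: divide_simps)
    then have "real (nullity (row_space M) W) * real K \<le> real l * (real (card W) - 1)" by (simp add: algebra_simps)
    then have "real (nullity (row_space M) W * K) \<le> real (l * (card W - 1))" using W by (simp add: of_nat_diff)
    then show ?thesis by (simp only: of_nat_le_iff)
  qed
  have "real K / (real K - real l) \<in> Q" using Max_in[OF finQ neQ] mQ by simp
  then obtain W where W: "W \<subseteq> {..<dim_col M}" "2 \<le> card W" "ratio W = real K / (real K - real l)"
    unfolding Q_def by auto
  then have "(real (card W) - 1) * (real K - real l) = real K * (real (card W) - 1 - real (nullity (row_space M) W))"
    using ratio_eq[OF W(1,2)] den[OF W(1,2)] Kl by (simp add: divide_simps)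
  then have "real (nullity (row_space M) W) * real K = real l * (real (card W) - 1)" by (simp add: algebra_simps)
  then have "real (nullity (row_space M) W * K) = real (l * (card W - 1))" using W by (simp add: of_nat_diff)
  then have "nullity (row_space M) W * K = l * (card W - 1)" by (simp only: of_nat_eq_iff)
  then show "\<exists>W \<subseteq> {..<dim_col M}. 2 \<le> card W \<and> nullity (row_space M) W * K = l * (card W - 1)"
    using W by blast
qed

text \<open>With \<open>(K - l) / K\<close> for the reciprocal of \<open>m_param N\<close>, clearing
  denominators leads to the same inequality \<open>r * K \<le> l * (w - 1)\<close>, so both maxima
  are attained by the same sets and have the same value.\<close>

lemma m_param2_eq:
  assumes M: "irredundant M" "property_star M" and l: "0 < l" "l < K"
    and m: "m_param M = real K / (real K - real l)" "m_param N = real K / (real K - real l)"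
    and q: "2 \<le> dim_col M"
  shows "m_param2 M N = real K / (real K - real l)"
proof -
  have Kl: "0 < real K - real l" "0 < real K" using l by auto
  define ratio where "ratio W = real (card W) /
       (real (card W) - 1 + real (mrank (restrict_cols M ({..<dim_col M} - W))) - real (mrank M) + 1 / m_param N)" for W
  have ratio_eq: "ratio W = real (card W) / (real (card W) - 1 - real (nullity (row_space M) W) + (real K - real l) / real K)"
    if "W \<subseteq> {..<dim_col M}" for W
    using mrank_diff_eq[OF that] unfolding ratio_def m(2) by (simp add: add_diff_eq[symmetric])
  have den: "0 < real (card W) - 1 - real (nullity (row_space M) W) + (real K - real l) / real K"
    if "W \<subseteq> {..<dim_col M}" "2 \<le> card W" for W
  proof -
    have "0 < (real K - real l) / real K" using Kl by simp
    moreover have "0 \<le> real (card W) - 1 - real (nullity (row_space M) W)"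
      using nullity_row_space_le[OF M that] by linarith
    ultimately show ?thesis by linarith
  qed
  have cross: "real (card W) * (real K - real l) - real K * (real (card W) - 1 - real (nullity (row_space M) W) + (real K - real l) / real K)
      = real (nullity (row_space M) W) * real K - real l * (real (card W) - 1)" for W
    using Kl by (simp add: field_simps)
  have nat_real: "real (l * (card W - 1)) = real l * (real (card W) - 1)" if "2 \<le> card W" for W :: "nat set"
    using that by (simp add: of_nat_diff)
  have "Max {ratio W | W. W \<subseteq> {..<dim_col M} \<and> 2 \<le> card W} = real K / (real K - real l)"
  proof (rule Max_eqI)
    show "finite {ratio W | W. W \<subseteq> {..<dim_col M} \<and> 2 \<le> card W}" by (rule finite_image_subsets)
    fix r assume "r \<in> {ratio W | W. W \<subseteq> {..<dim_col M} \<and> 2 \<le> card W}"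
    then obtain W where W: "W \<subseteq> {..<dim_col M}" "2 \<le> card W" "r = ratio W" by auto
    have "real (nullity (row_space M) W * K) \<le> real (l * (card W - 1))"
      using m_param_bound(1)[OF M l m(1) q W(1,2)] by (simp only: of_nat_le_iff)
    then have "real (nullity (row_space M) W) * real K \<le> real l * (real (card W) - 1)"
      unfolding nat_real[OF W(2)] by simp
    then have "real (card W) * (real K - real l) \<le> real K * (real (card W) - 1 - real (nullity (row_space M) W) + (real K - real l) / real K)"
      using cross[of W] by linarith
    then show "r \<le> real K / (real K - real l)"
      unfolding W(3) ratio_eq[OF W(1)] using den[OF W(1,2)] Kl(1) by (simp only: divide_le_eq le_divide_eq if_True mult.commute times_divide_eq_right)
  next
    obtain W where W: "W \<subseteq> {..<dim_col M}" "2 \<le> card W" "nullity (row_space M) W * K = l * (card W - 1)"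
      using m_param_bound(2)[OF M l m(1) q] by blast
    have "real (nullity (row_space M) W * K) = real (l * (card W - 1))" using W(3) by (simp only:)
    then have "real (nullity (row_space M) W) * real K = real l * (real (card W) - 1)"
      unfolding nat_real[OF W(2)] by simp
    then have "real (card W) * (real K - real l) = real K * (real (card W) - 1 - real (nullity (row_space M) W) + (real K - real l) / real K)"
      using cross[of W] by linarith
    then have e: "ratio W = real K / (real K - real l)"
      unfolding ratio_eq[OF W(1)] using den[OF W(1,2)] Kl(1) by (subst frac_eq_eq) auto
    show "real K / (real K - real l) \<in> {ratio W | W. W \<subseteq> {..<dim_col M} \<and> 2 \<le> card W}"
      unfolding e[symmetric] using W(1,2) by blast
  qed
  then show ?thesis unfolding m_param2_def ratio_def .
qed

text \<open>The full column set gives this value, since no columns remain and their rank is 0.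
  Strict balance bounds all other quotients by it.\<close>

lemma m_param_core:
  assumes C: "C \<in> carrier_mat l k" "full_rank C" "strictly_balanced C" and k: "k \<ge> l + 2"
  shows "m_param C = (real k - 1) / (real k - 1 - real l)"
proof -
  have dc: "dim_col C = k" "dim_row C = l" "mrank C = l" using C unfolding full_rank_def by auto
  define ratio where "ratio W = (real (card W) - 1) /
       (real (card W) - 1 + real (mrank (restrict_cols C ({..<k} - W))) - real l)" for W
  have full: "ratio {..<k} = (real k - 1) / (real k - 1 - real l)"
    unfolding ratio_def using mrank_restrict_cols_empty[of C] by simp
  have "Max {ratio W | W. W \<subseteq> {..<k} \<and> 2 \<le> card W} = (real k - 1) / (real k - 1 - real l)"
  proof (rule Max_eqI)
    show "finite {ratio W | W. W \<subseteq> {..<k} \<and> 2 \<le> card W}" by (rule finite_image_subsets)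
    fix r assume "r \<in> {ratio W | W. W \<subseteq> {..<k} \<and> 2 \<le> card W}"
    then obtain W where W: "W \<subseteq> {..<k}" "2 \<le> card W" "r = ratio W" by auto
    show "r \<le> (real k - 1) / (real k - 1 - real l)"
    proof (cases "card W < k")
      case True
      then have "ratio W < (real k - 1) / (real k - 1 - real l)"
        using C(3) W unfolding strictly_balanced_def dc ratio_def by blast
      then show ?thesis using W by simp
    next
      case False
      then have "W = {..<k}" using W(1) card_subset_eq[of "{..<k}" W] card_mono[of "{..<k}" W] by simp
      then show ?thesis using W full by simp
    qed
  next
    show "(real k - 1) / (real k - 1 - real l) \<in> {ratio W | W. W \<subseteq> {..<k} \<and> 2 \<le> card W}"
      using full k by (intro CollectI exI[of _ "{..<k}"]) auto
  qed
  then show ?thesis unfolding m_param_def dc ratio_def .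
qed

section \<open>Renaming the selected unknowns\<close>

definition pull :: "nat list \<Rightarrow> (nat \<Rightarrow> rat) \<Rightarrow> nat \<Rightarrow> rat" where
  "pull ws \<rho> = (\<lambda>i. if i < length ws then \<rho> (ws ! i) else 0)"

lemma subspace_pull:
  assumes "fv.subspace L"
  shows "fv.subspace (pull ws ` L)"
proof (rule fv.subspaceI)
  show "0 \<in> pull ws ` L"
    using fv.subspace_0[OF assms] by (intro image_eqI[of _ _ 0]) (auto simp: pull_def fun_eq_iff)
  fix x y assume "x \<in> pull ws ` L"
  then obtain u where u: "u \<in> L" "x = pull ws u" by auto
  show "(\<lambda>i. c * x i) \<in> pull ws ` L" for c
    using fv.subspace_scale[OF assms u(1), of c] u(2) by (intro image_eqI) (auto simp: pull_def fun_eq_iff)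
  assume "y \<in> pull ws ` L"
  then obtain v where v: "v \<in> L" "y = pull ws v" by auto
  show "x + y \<in> pull ws ` L"
    using fv.subspace_add[OF assms u(1) v(1)] u(2) v(2) by (intro image_eqI) (auto simp: pull_def fun_eq_iff)
qed

text \<open>Restricting to relations supported in \<open>set ws\<close> before pulling back means
  that no nonzero coefficient is dropped, so the renaming loses no information.\<close>

lemma forced_pull:
  assumes ws: "distinct ws" and Y: "Y \<subseteq> {..<length ws}" "y < length ws"
  shows "forced (pull ws ` (L \<inter> supported (set ws))) Y y \<longleftrightarrow> forced L ((!) ws ` Y) (ws ! y)"
proof
  assume "forced (pull ws ` (L \<inter> supported (set ws))) Y y"
  then obtain \<rho> where \<rho>: "\<rho> \<in> L" "\<rho> \<in> supported (set ws)" "pull ws \<rho> \<in> supported (insert y Y)" "pull ws \<rho> y \<noteq> 0"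
    unfolding forced_def by auto
  have "\<rho> v = 0" if v: "v \<notin> insert (ws ! y) ((!) ws ` Y)" for v
  proof (cases "v \<in> set ws")
    case True
    then obtain i where i: "i < length ws" "v = ws ! i" by (metis in_set_conv_nth)
    then have "i \<notin> insert y Y" using v by auto
    then have "pull ws \<rho> i = 0" using \<rho>(3) unfolding supported_def by blast
    then show ?thesis using i unfolding pull_def by simp
  next
    case False
    then show ?thesis using \<rho>(2) unfolding supported_def by auto
  qed
  then have "\<rho> \<in> supported (insert (ws ! y) ((!) ws ` Y))" unfolding supported_def by blast
  moreover have "\<rho> (ws ! y) \<noteq> 0" using \<rho>(4) Y unfolding pull_def by simp
  ultimately show "forced L ((!) ws ` Y) (ws ! y)" using \<rho>(1) unfolding forced_def by blast
next
  assume "forced L ((!) ws ` Y) (ws ! y)"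
  then obtain \<rho> where \<rho>: "\<rho> \<in> L" "\<rho> \<in> supported (insert (ws ! y) ((!) ws ` Y))" "\<rho> (ws ! y) \<noteq> 0"
    unfolding forced_def by auto
  have "insert (ws ! y) ((!) ws ` Y) \<subseteq> set ws" using Y by auto
  then have "\<rho> \<in> supported (set ws)" using \<rho>(2) supported_mono by blast
  moreover have "pull ws \<rho> i = 0" if "i \<notin> insert y Y" for i
  proof (cases "i < length ws")
    case True
    have "ws ! i \<notin> insert (ws ! y) ((!) ws ` Y)"
    proof
      assume "ws ! i \<in> insert (ws ! y) ((!) ws ` Y)"
      then obtain i' where i': "i' \<in> insert y Y" "ws ! i = ws ! i'" by auto
      then have "i' < length ws" using Y by auto
      then have "i = i'" using nth_eq_iff_index_eq[OF ws True \<open>i' < length ws\<close>] i'(2) by blast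
      then show False using i'(1) that by simp
    qed
    then show ?thesis using \<rho>(2) unfolding supported_def pull_def by auto
  qed (simp add: pull_def)
  then have "pull ws \<rho> \<in> supported (insert y Y)" unfolding supported_def by blast
  moreover have "pull ws \<rho> y \<noteq> 0" using \<rho>(3) Y unfolding pull_def by simp
  ultimately show "forced (pull ws ` (L \<inter> supported (set ws))) Y y"
    using \<rho>(1) unfolding forced_def by blast
qed

lemma nullity_pull:
  assumes L: "fv.subspace L" and ws: "distinct ws" and V: "V \<subseteq> {..<length ws}"
  shows "nullity (pull ws ` (L \<inter> supported (set ws))) V = nullity L ((!) ws ` V)"
proof -
  have sub: "fv.subspace (pull ws ` (L \<inter> supported (set ws)))"
    by (intro subspace_pull fv.subspace_inter L subspace_supported)
  have "finite V" using V finite_subset by blast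
  then show ?thesis using V
  proof (induction V rule: finite_induct)
    case (insert y V)
    have "inj_on ((!) ws) (insert y V)" by (rule inj_on_nth[OF ws]) (use insert in auto)
    then have "ws ! y \<notin> (!) ws ` V" using insert.hyps by auto
    moreover have "V \<subseteq> {..<length ws}" "y < length ws" using insert.prems by auto
    ultimately show ?case
      using nullity_insert[OF sub insert.hyps] nullity_insert[OF L, of "(!) ws ` V" "ws ! y"]
        insert.IH insert.hyps forced_pull[OF ws, of V y L] by simp
  qed simp
qed

text \<open>
  A core is only a submatrix of \<open>M\<close>, and the entries of a solution selected by its columns need not
  satisfy any relation. Only its parameter is used, and the selected unknowns are instead those of a
  smallest set attaining the maximum in \<open>m_param M\<close>.
\<close>

lemma template_exists:
  assumes M: "irredundant M" "property_star M" and l: "0 < l" "l < K"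
    and m: "m_param M = real K / (real K - real l)" and q: "2 \<le> dim_col M"
  obtains \<kappa> :: nat and R :: "(nat \<Rightarrow> rat) set" and Z :: "int list set"
  where "fv.subspace R" "R \<subseteq> supported {..<\<kappa>}" "2 \<le> \<kappa>"
    "nullity R {..<\<kappa>} * K = l * (\<kappa> - 1)"
    "\<And>W. W \<subseteq> {..<\<kappa>} \<Longrightarrow> 2 \<le> card W \<Longrightarrow> card W < \<kappa> \<Longrightarrow> nullity R W * K < l * (card W - 1)"
    "\<And>i. i < \<kappa> \<Longrightarrow> nullity R {i} = 0"
    "\<And>z. z \<in> Z \<Longrightarrow> length z = \<kappa> \<and> distinct z"
    "\<And>z z' \<rho>. z \<in> Z \<Longrightarrow> z' \<in> Z \<Longrightarrow> \<rho> \<in> R \<Longrightarrow>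
      (\<Sum>i<\<kappa>. \<rho> i * (rat_of_int (z ! i) - rat_of_int (z' ! i))) = 0"
    "\<And>S x. distinct_solution (M, b) S x \<Longrightarrow> \<exists>z\<in>Z. set z \<subseteq> S"
proof -
  define tight where "tight W \<longleftrightarrow> W \<subseteq> {..<dim_col M} \<and> 2 \<le> card W \<and> nullity (row_space M) W * K = l * (card W - 1)"
    for W
  obtain W0 where "tight W0" using m_param_bound(2)[OF M l m q] unfolding tight_def by blast
  define W where "W = arg_min card tight"
  have W: "tight W" unfolding W_def by (fact arg_min_natI[of tight, OF \<open>tight W0\<close>])
  have W_min: "card W \<le> card V" if "tight V" for V
    unfolding W_def by (fact arg_min_nat_le[of tight, OF that])
  have Wq: "W \<subseteq> {..<dim_col M}" "2 \<le> card W" and Wt: "nullity (row_space M) W * K = l * (card W - 1)"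
    using W unfolding tight_def by auto
  have finW: "finite W" using Wq(1) finite_subset by blast
  define ws where "ws = sorted_list_of_set W"
  have ws: "distinct ws" "set ws = W" "length ws = card W" unfolding ws_def using finW by auto
  define R where "R = pull ws ` (row_space M \<inter> supported (set ws))"
  \<comment> \<open>All integer solutions are taken, so that one template serves every
    \<open>n\<close> and every colour class.\<close>
  define Z where "Z = {map (\<lambda>j. x $ j) ws | x. distinct_solution (M, b) UNIV x}"
  have null: "nullity R V = nullity (row_space M) ((!) ws ` V)" if "V \<subseteq> {..<card W}" for V
    unfolding R_def using nullity_pull[OF subspace_row_space ws(1)] that ws(3) by simp
  have img: "(!) ws ` {..<card W} = W" using ws by (auto simp: set_conv_nth)
  have inj: "inj_on ((!) ws) {..<card W}" by (rule inj_on_nth[OF ws(1)]) (use ws in auto)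
  show thesis
  proof (rule that[of R "card W" Z])
    show "fv.subspace R" unfolding R_def
      by (intro subspace_pull fv.subspace_inter subspace_row_space subspace_supported)
    show "R \<subseteq> supported {..<card W}" unfolding R_def supported_def pull_def using ws(3) by auto
    show "2 \<le> card W" by fact
    show "nullity R {..<card W} * K = l * (card W - 1)" using null[of "{..<card W}"] img Wt by simp
    show "nullity R V * K < l * (card V - 1)" if V: "V \<subseteq> {..<card W}" "2 \<le> card V" "card V < card W" for V
    proof -
      define V' where "V' = (!) ws ` V"
      have cV: "card V' = card V" unfolding V'_def by (rule card_image[OF inj_on_subset[OF inj V(1)]])
      have V'W: "V' \<subseteq> W" unfolding V'_def using img V(1) by blast
      then have V'q: "V' \<subseteq> {..<dim_col M}" using Wq by blast
      have "nullity (row_space M) V' * K \<le> l * (card V' - 1)"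
        using m_param_bound(1)[OF M l m q V'q] cV V by simp
      \<comment> \<open>Equality would make \<open>V'\<close> a tight set smaller than
        \<open>W\<close>; minimality is what makes the inequality strict.\<close>
      moreover have "\<not> tight V'" using W_min[of V'] cV V by auto
      then have "nullity (row_space M) V' * K \<noteq> l * (card V' - 1)"
        unfolding tight_def using V'q cV V by auto
      ultimately show ?thesis using null[OF V(1)] cV unfolding V'_def by simp
    qed
    show "nullity R {i} = 0" if i: "i < card W" for i
    proof -
      have wi: "ws ! i \<in> W" using i ws by auto
      obtain w where w: "w \<in> W" "w \<noteq> ws ! i"
        using Wq(2) card_le_Suc0_iff_eq[OF finW] wi by (metis One_nat_def Suc_1 not_less_eq_eq)
      have "nullity (row_space M) {ws ! i} \<le> nullity (row_space M) {ws ! i, w}"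
        by (intro nullity_mono subspace_row_space) auto
      also have "\<dots> = 0" using nullity_pair[OF M, of "ws ! i" w] w wi Wq(1) by auto
      finally show ?thesis using null[of "{i}"] i by simp
    qed
    show "length z = card W \<and> distinct z" if z: "z \<in> Z" for z
    proof -
      obtain x where x: "distinct_solution (M, b) UNIV x" "z = map (\<lambda>j. x $ j) ws" using z unfolding Z_def by auto
      have d: "dim_vec x = dim_col M" "distinct (list_of_vec x)" using x unfolding distinct_solution_def by auto
      have "inj_on (\<lambda>j. x $ j) {..<dim_col M}"
      proof (rule inj_onI)
        fix i j assume ij: "i \<in> {..<dim_col M}" "j \<in> {..<dim_col M}" "x $ i = x $ j"
        then have "list_of_vec x ! i = list_of_vec x ! j" using d by (simp add: list_of_vec_index)
        then show "i = j" using nth_eq_iff_index_eq[OF d(2)] ij d(1) by simp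
      qed
      then have "inj_on (\<lambda>j. x $ j) (set ws)" using ws(2) Wq(1) by (metis inj_on_subset)
      then show ?thesis using x(2) ws by (simp add: distinct_map)
    qed
    show "(\<Sum>i<card W. \<rho> i * (rat_of_int (z ! i) - rat_of_int (z' ! i))) = 0"
      if z: "z \<in> Z" "z' \<in> Z" and \<rho>: "\<rho> \<in> R" for z z' \<rho>
    proof -
      obtain x where x: "distinct_solution (M, b) UNIV x" "z = map (\<lambda>j. x $ j) ws" using z unfolding Z_def by auto
      obtain x' where x': "distinct_solution (M, b) UNIV x'" "z' = map (\<lambda>j. x' $ j) ws" using z unfolding Z_def by auto
      obtain \<sigma> where \<sigma>: "\<sigma> \<in> row_space M" "\<sigma> \<in> supported W" "\<rho> = pull ws \<sigma>" using \<rho> ws(2) unfolding R_def by auto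
      have "(\<Sum>i<card W. \<rho> i * (rat_of_int (z ! i) - rat_of_int (z' ! i))) =
          (\<Sum>i<card W. \<sigma> (ws ! i) * (rat_of_int (x $ (ws ! i)) - rat_of_int (x' $ (ws ! i))))"
        unfolding \<sigma>(3) x(2) x'(2) pull_def using ws(3) by (intro sum.cong) auto
      also have "\<dots> = (\<Sum>j\<in>W. \<sigma> j * (rat_of_int (x $ j) - rat_of_int (x' $ j)))"
      proof -
        have "(\<Sum>j\<in>(!) ws ` {..<card W}. \<sigma> j * (rat_of_int (x $ j) - rat_of_int (x' $ j))) =
            (\<Sum>i<card W. \<sigma> (ws ! i) * (rat_of_int (x $ (ws ! i)) - rat_of_int (x' $ (ws ! i))))"
          by (simp add: sum.reindex[OF inj])
        then show ?thesis unfolding img by (rule sym)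
      qed
      also have "\<dots> = (\<Sum>j<dim_col M. \<sigma> j * (rat_of_int (x $ j) - rat_of_int (x' $ j)))"
        using Wq(1) \<sigma>(2) by (intro sum.mono_neutral_left) (auto simp: supported_def)
      also have "\<dots> = 0"
        using x x' by (intro row_space_solutions[OF \<sigma>(1)]) (auto simp: distinct_solution_def)
      finally show ?thesis .
    qed
    show "\<exists>z\<in>Z. set z \<subseteq> S" if x: "distinct_solution (M, b) S x" for S x
    proof -
      have "distinct_solution (M, b) UNIV x" using x unfolding distinct_solution_def by auto
      then have "map (\<lambda>j. x $ j) ws \<in> Z" unfolding Z_def by blast
      moreover have "x $ j \<in> S" if "j \<in> set ws" for j
      proof -
        have "j < dim_vec x" using that ws(2) Wq(1) x unfolding distinct_solution_def by auto
        then have "x $ j \<in> set\<^sub>v x" by (simp add: vec_setI)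
        then show ?thesis using x unfolding distinct_solution_def by auto
      qed
      then have "set (map (\<lambda>j. x $ j) ws) \<subseteq> S" by auto
      ultimately show ?thesis by blast
    qed
  qed
qed

lemma core_param:
  assumes core: "is_core M C" and C: "C \<in> carrier_mat l k" and k: "k \<ge> l + 2"
  shows "m_param M = real (k - 1) / (real (k - 1) - real l)" "2 \<le> dim_col M"
proof -
  show "m_param M = real (k - 1) / (real (k - 1) - real l)"
    using m_param_core[OF C _ _ k] core k unfolding is_core_def by (simp add: of_nat_diff)
  obtain I J where "C = submatrix M I J" using core unfolding is_core_def by auto
  moreover have "k = dim_col C" using C by auto
  ultimately have "k = card {j. j < dim_col M \<and> j \<in> J}" by (simp only: dim_submatrix)
  also have "\<dots> \<le> card {..<dim_col M}" by (intro card_mono) auto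
  finally show "2 \<le> dim_col M" using k by simp
qed

text \<open>One instance of the locale handles both systems at once. Its colouring leaves no
  selected part of a solution of either system monochromatic in either colour, which is more than is
  needed to refute the Rado property.\<close>

lemma random_rado_zero:
  assumes A: "irredundant (fst A)" "property_star (fst A)" and B: "irredundant (fst B)" "property_star (fst B)"
    and l: "0 < l" "l < K"
    and mA: "m_param (fst A) = real K / (real K - real l)" "2 \<le> dim_col (fst A)"
    and mB: "m_param (fst B) = real K / (real K - real l)" "2 \<le> dim_col (fst B)"
    and p: "\<And>n. 1 \<le> n \<Longrightarrow> 0 \<le> p n \<and> p n \<le> 1 \<and> p n \<le> 1 / 20 * real n powr (- ((real K - real l) / real K))"
  shows "(\<lambda>n. measure_pmf.prob (random_subset n (p n)) {S. rado A B S}) \<longlonglongrightarrow> 0"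
proof -
  obtain kA RA ZA where tA: "fv.subspace RA" "RA \<subseteq> supported {..<kA}" "2 \<le> kA"
    "nullity RA {..<kA} * K = l * (kA - 1)"
    "\<And>W. W \<subseteq> {..<kA} \<Longrightarrow> 2 \<le> card W \<Longrightarrow> card W < kA \<Longrightarrow> nullity RA W * K < l * (card W - 1)"
    "\<And>i. i < kA \<Longrightarrow> nullity RA {i} = 0"
    "\<And>z. z \<in> ZA \<Longrightarrow> length z = kA \<and> distinct z"
    "\<And>z z' \<rho>. z \<in> ZA \<Longrightarrow> z' \<in> ZA \<Longrightarrow> \<rho> \<in> RA \<Longrightarrow>
      (\<Sum>i<kA. \<rho> i * (rat_of_int (z ! i) - rat_of_int (z' ! i))) = 0"
    "\<And>S x. distinct_solution (fst A, snd A) S x \<Longrightarrow> \<exists>z\<in>ZA. set z \<subseteq> S"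
    by (rule template_exists[OF A l mA]) blast
  obtain kB RB ZB where tB: "fv.subspace RB" "RB \<subseteq> supported {..<kB}" "2 \<le> kB"
    "nullity RB {..<kB} * K = l * (kB - 1)"
    "\<And>W. W \<subseteq> {..<kB} \<Longrightarrow> 2 \<le> card W \<Longrightarrow> card W < kB \<Longrightarrow> nullity RB W * K < l * (card W - 1)"
    "\<And>i. i < kB \<Longrightarrow> nullity RB {i} = 0"
    "\<And>z. z \<in> ZB \<Longrightarrow> length z = kB \<and> distinct z"
    "\<And>z z' \<rho>. z \<in> ZB \<Longrightarrow> z' \<in> ZB \<Longrightarrow> \<rho> \<in> RB \<Longrightarrow>
      (\<Sum>i<kB. \<rho> i * (rat_of_int (z ! i) - rat_of_int (z' ! i))) = 0"
    "\<And>S x. distinct_solution (fst B, snd B) S x \<Longrightarrow> \<exists>z\<in>ZB. set z \<subseteq> S"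
    by (rule template_exists[OF B l mB]) blast
  interpret ts: template_solutions "\<lambda>a. if a then kA else kB" "\<lambda>a. if a then RA else RB" K l "\<lambda>a. if a then ZA else ZB"
  proof
    show "0 < l" "l < K" by fact+
    fix a
    show "fv.subspace (if a then RA else RB)" using tA(1) tB(1) by simp
    show "(if a then RA else RB) \<subseteq> supported {..<if a then kA else kB}" using tA(2) tB(2) by simp
    show "2 \<le> (if a then kA else kB)" using tA(3) tB(3) by simp
    show "nullity (if a then RA else RB) {..<if a then kA else kB} * K = l * ((if a then kA else kB) - 1)"
      using tA(4) tB(4) by (cases a) simp_all
    show "nullity (if a then RA else RB) W * K < l * (card W - 1)"
      if "W \<subseteq> {..<if a then kA else kB}" "2 \<le> card W" "card W < (if a then kA else kB)" for W
      using that tA(5)[of W] tB(5)[of W] by (cases a) simp_all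
    show "nullity (if a then RA else RB) {i} = 0" if "i < (if a then kA else kB)" for i
      using that tA(6)[of i] tB(6)[of i] by (cases a) simp_all
    show "length z = (if a then kA else kB) \<and> distinct z" if "z \<in> (if a then ZA else ZB)" for z
      using that tA(7)[of z] tB(7)[of z] by (cases a) simp_all
    show "(\<Sum>i<if a then kA else kB. \<rho> i * (rat_of_int (z ! i) - rat_of_int (z' ! i))) = 0"
      if "z \<in> (if a then ZA else ZB)" "z' \<in> (if a then ZA else ZB)" "\<rho> \<in> (if a then RA else RB)" for z z' \<rho>
      using that tA(8)[of z z' \<rho>] tB(8)[of z z' \<rho>] by (cases a) simp_all
  qed
  have sub: "{S. rado A B S} \<subseteq> {S. \<not> ts.colourable S}"
  proof (clarify)
    fix S assume r: "rado A B S" and c: "ts.colourable S"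
    obtain clr :: "int \<Rightarrow> bool" where
      clr': "\<forall>a. \<forall>z\<in>(if a then ZA else ZB). set z \<subseteq> S \<longrightarrow> (\<exists>x\<in>set z. \<exists>y\<in>set z. clr x \<noteq> clr y)"
      using c unfolding ts.colourable_def by (elim exE)
    have clr: "\<exists>x\<in>set z. \<exists>y\<in>set z. clr x \<noteq> clr y" if "z \<in> (if a then ZA else ZB)" "set z \<subseteq> S" for a z
      using clr'[rule_format, OF that] .
    define f where "f s = (if clr s then 1 else 2 :: nat)" for s
    have "f ` S \<subseteq> {1, 2}" unfolding f_def by auto
    then consider x where "distinct_solution A {s \<in> S. f s = 1} x" | x where "distinct_solution B {s \<in> S. f s = 2} x"
      using r unfolding rado_def by blast
    then show False
    proof cases
      case 1
      then have "distinct_solution (fst A, snd A) {s \<in> S. f s = 1} x" unfolding prod.collapse .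
      then obtain z where z: "z \<in> ZA" "set z \<subseteq> {s \<in> S. f s = 1}" using tA(9) by blast
      then obtain x y where "x \<in> set z" "y \<in> set z" "clr x \<noteq> clr y" using clr[of z True] by auto
      then show False using z(2) unfolding f_def by (auto split: if_splits)
    next
      case 2
      then have "distinct_solution (fst B, snd B) {s \<in> S. f s = 2} x" unfolding prod.collapse .
      then obtain z where z: "z \<in> ZB" "set z \<subseteq> {s \<in> S. f s = 2}" using tB(9) by blast
      then obtain x y where "x \<in> set z" "y \<in> set z" "clr x \<noteq> clr y" using clr[of z False] by auto
      then show False using z(2) unfolding f_def by (auto split: if_splits)
    qed
  qed
  show ?thesis
  proof (rule Lim_null_comparison[OF _ ts.prob_not_colourable_tendsto[OF p]])
    show "\<forall>\<^sub>F n in sequentially. norm (measure_pmf.prob (random_subset n (p n)) {S. rado A B S})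
      \<le> measure_pmf.prob (random_subset n (p n)) {S. \<not> ts.colourable S}"
      using sub by (intro always_eventually allI) (auto intro!: measure_pmf.finite_measure_mono)
  qed
qed

theorem theorem3p1:
  fixes k l :: nat
  assumes "k \<ge> 1" and "l \<ge> 1" and "k \<ge> l + 2"
  shows "\<exists>c>0. \<forall>A B CA CB.
    is_linsys A \<and> is_linsys B \<and>
    irredundant (fst A) \<and> property_star (fst A) \<and>
    irredundant (fst B) \<and> property_star (fst B) \<and>
    is_core (fst A) CA \<and> CA \<in> carrier_mat l k \<and>
    is_core (fst B) CB \<and> CB \<in> carrier_mat l k \<longrightarrow>
      1 / m_param2 (fst A) (fst B) = (real k - real l - 1) / (real k - 1) \<and>
      (\<forall>p :: nat \<Rightarrow> real.
         (\<forall>n\<ge>1. 0 \<le> p n \<and> p n \<le> 1 \<and>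
            p n \<le> c * real n powr (- (1 / m_param2 (fst A) (fst B)))) \<longrightarrow>
         (\<lambda>n. measure_pmf.prob (random_subset n (p n)) {S. rado A B S}) \<longlonglongrightarrow> 0)"
proof (intro exI[of _ "1 / 20 :: real"] conjI allI impI)
  \<comment> \<open>The constant is the product of 1/5, which pays for the positions in regular
    edges, and 1/4, which pays for processing vertices; both work for all \<open>k\<close> and
    \<open>l\<close>.\<close>
  fix A B :: linsys and CA CB
  assume "is_linsys A \<and> is_linsys B \<and>
    irredundant (fst A) \<and> property_star (fst A) \<and>
    irredundant (fst B) \<and> property_star (fst B) \<and>
    is_core (fst A) CA \<and> CA \<in> carrier_mat l k \<and>
    is_core (fst B) CB \<and> CB \<in> carrier_mat l k"
  then have A: "irredundant (fst A)" "property_star (fst A)" and B: "irredundant (fst B)" "property_star (fst B)"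
    and cA: "is_core (fst A) CA" "CA \<in> carrier_mat l k" and cB: "is_core (fst B) CB" "CB \<in> carrier_mat l k"
    by auto
  \<comment> \<open>The potential is used with \<open>K = k - 1\<close>; the hypothesis
    \<open>k \<ge> l + 2\<close> is exactly \<open>l < K\<close>.\<close>
  have l: "0 < l" "l < k - 1" using assms by auto
  note mA = core_param[OF cA assms(3)] and mB = core_param[OF cB assms(3)]
  have m2: "m_param2 (fst A) (fst B) = real (k - 1) / (real (k - 1) - real l)"
    by (rule m_param2_eq[OF A l mA(1) mB(1) mA(2)])
  then show "1 / m_param2 (fst A) (fst B) = (real k - real l - 1) / (real k - 1)"
    using assms by (simp add: of_nat_diff)
  fix p :: "nat \<Rightarrow> real"
  assume "\<forall>n\<ge>1. 0 \<le> p n \<and> p n \<le> 1 \<and> p n \<le> 1 / 20 * real n powr (- (1 / m_param2 (fst A) (fst B)))"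
  then show "(\<lambda>n. measure_pmf.prob (random_subset n (p n)) {S. rado A B S}) \<longlonglongrightarrow> 0"
    unfolding m2 by (intro random_rado_zero[OF A B l mA mB]) simp
qed simp

end
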